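(* Let $H$ be a closed, connected subgroup of $G=\mathrm{SL}(3,\mathbb{R})$, and let $K_H$ be a maximal compact subgroup of $H$. If $\dim H-\dim K_H\ge 3$, then $H$ is a Cartan-decomposition subgroup of $G$.
   Context: A closed subgroup $H$ of a Lie group $G$ is a Cartan-decomposition subgroup of $G$ if $H$ is connected and there is a compact subset $C$ of $G$ (not necessarily a subgroup) such that $CHC=G$. *)

theory Defs
  imports "HOL-Analysis.Analysis" "HOL-Algebra.Coset"
begin

definition SL :: "(real ^ 'n ^ 'n) monoid" where
  "SL = \<lparr>carrier = {A. det A = 1}, mult = (**), one = mat 1\<rparr>"

lemma group_SL: "group SL"
proof (rule groupI)
  fix A :: "real ^ 'n ^ 'n"
  assume "A \<in> carrier SL"
  then have d: "det A = 1" by (simp add: SL_def)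
  then have "invertible A" by (simp add: invertible_det_nz)
  then obtain B where B: "B ** A = mat 1" by (auto simp: invertible_def)
  then have "det B * det A = 1" by (metis det_I det_mul)
  with d B show "\<exists>B \<in> carrier SL. B \<otimes>\<^bsub>SL\<^esub> A = \<one>\<^bsub>SL\<^esub>"
    by (auto simp: SL_def)
qed (auto simp: SL_def det_mul matrix_mul_assoc)

text \<open>The product of the type \<^typ>\<open>real ^ 'n ^ 'n\<close> as an algebra is componentwise, so the
  library's \<^const>\<open>exp\<close> is not available for matrices.\<close>

definition matrix_exp :: "real ^ 'n ^ 'n \<Rightarrow> real ^ 'n ^ 'n" where
  "matrix_exp X = (\<Sum>k. (1 / fact k) *\<^sub>R (((**) X) ^^ k) (mat 1))"

text \<open>A closed subgroup \<open>H\<close> of a linear group is a Lie group (Cartan's closed subgroup theorem).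
  Its Lie algebra, that is its tangent space at the identity, is the set of generators of
  the one-parameter subgroups contained in \<open>H\<close>, and its dimension is that of its Lie algebra.
  Both definitions are meant for closed \<open>H\<close> only.\<close>

definition lie_algebra :: "(real ^ 'n ^ 'n) set \<Rightarrow> (real ^ 'n ^ 'n) set" where
  "lie_algebra H = {X. \<forall>t::real. matrix_exp (t *\<^sub>R X) \<in> H}"

definition lie_dim :: "(real ^ 'n ^ 'n) set \<Rightarrow> nat" where
  "lie_dim H = dim (lie_algebra H)"

text \<open>In the following definitions the topology on the group \<open>G\<close> is the subspace topology
  inherited from the ambient type.\<close>

definition closed_subgroup :: "'a::topological_space set \<Rightarrow> ('a, 'b) monoid_scheme \<Rightarrow> bool" where
  "closed_subgroup H G \<longleftrightarrow> subgroup H G \<and> closedin (top_of_set (carrier G)) H"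

definition maximal_compact_subgroup ::
    "'a::topological_space set \<Rightarrow> ('a, 'b) monoid_scheme \<Rightarrow> bool" where
  "maximal_compact_subgroup K G \<longleftrightarrow>
     subgroup K G \<and> compact K \<and>
     (\<forall>L. subgroup L G \<and> compact L \<and> K \<subseteq> L \<longrightarrow> L = K)"

definition Cartan_decomposition_subgroup ::
    "'a::topological_space set \<Rightarrow> ('a, 'b) monoid_scheme \<Rightarrow> bool" where
  "Cartan_decomposition_subgroup H G \<longleftrightarrow>
     closed_subgroup H G \<and> connected H \<and>
     (\<exists>C. C \<subseteq> carrier G \<and> compact C \<and> C <#>\<^bsub>G\<^esub> H <#>\<^bsub>G\<^esub> C = carrier G)"

end

theory Submission
  imports Defs
begin

text \<open>
  Up to bounded factors a matrix of determinant one is determined, modulo multiplication by a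
  compact set on both sides, by the norms of the matrix and of its inverse. So it suffices to
  realize all pairs \<open>(\<alpha>, \<beta>)\<close> with \<open>1 \<le> \<alpha> \<le> \<beta>\<^sup>2\<close> and \<open>1 \<le> \<beta> \<le> \<alpha>\<^sup>2\<close> by elements of \<open>H\<close>.

  A Lie algebra \<open>h\<close> of traceless matrices of dimension at least two contains a nonzero singular
  element, since the determinant is odd. Such an element is, up to conjugation and scaling,
  \<open>diag(1, 0, -1)\<close>, a rotation generator, or nilpotent of rank one or two. If the dimension is at
  least three, looking at the eigenspaces of its adjoint action one finds in \<open>h\<close> a split Cartan
  subalgebra, a regular nilpotent matrix and its square, or the two-dimensional unipotent radical of
  a maximal parabolic subalgebra and a further non-elliptic element normalizing it; in these cases
  explicit exponentials realize all pairs. The only exceptions are the conjugates of \<open>so(3)\<close>,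
  \<open>so(2,1)\<close>, \<open>sl(2)\<close>, \<open>so(2) \<ltimes> \<real>\<^sup>2\<close> and its transpose, all of dimension three.

  In an exceptional case the hypothesis on the dimensions forces the maximal compact subgroup to be
  finite. This is absurd for \<open>so(3)\<close>, where \<open>H\<close> itself is compact. In the other cases minus the trace
  form has exactly one positive direction and its positive cone consists of elliptic elements;
  averaging over the finite group, one finds a circle in \<open>H\<close> which it normalizes, contrary to
  maximality.
\<close>

section \<open>The matrix exponential\<close>

text \<open>The case analysis rests on invariants that survive conjugation by any invertible matrix
  and transposition: \<open>fills_chamber\<close> tolerates bounded distortion of norms, and
  \<open>index_one\<close> speaks only of dimension, determinant and trace form. Every case may
  therefore move one element of the algebra into a normal form, and the exceptional algebras are
  never named up to conjugacy. Most cases run by contradiction: configurations already known to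
  satisfy the trichotomy are excluded until the rest is rigid enough to compute. Two norms suffice
  because they control the largest and the smallest singular value, while the determinant fixes the
  middle one. In the exceptional cases dimension at most three leaves dimension zero for the Lie
  algebra of the maximal compact subgroup; a compact group with zero Lie algebra cannot have an
  accumulation point. An average over that finite group could cancel. The one positive direction
  prevents this: the elliptic elements form a double cone with convex halves, so signs can be
  adjusted to keep all summands in one half. The resulting direction is elliptic, so its
  one-parameter group is periodic, hence compact.\<close>

lemma norm_matrix_mult_le:
  fixes A :: "real ^ 'n ^ 'm" and B :: "real ^ 'p ^ 'n"
  shows "norm (A ** B) \<le> norm A * norm B"
proof -
  \<comment> \<open>The norm here is the Frobenius norm; a row of the product is a combination of
    the rows of \<open>B\<close>, and Cauchy-Schwarz applies.\<close>
  have row: "norm ((A ** B) $ i) \<le> norm (A $ i) * norm B" for i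
  proof -
    have "(A ** B) $ i = (\<Sum>k\<in>UNIV. A $ i $ k *\<^sub>R B $ k)"
      by (simp add: matrix_matrix_mult_def vec_eq_iff)
    then have "norm ((A ** B) $ i) \<le> (\<Sum>k\<in>UNIV. \<bar>A $ i $ k\<bar> * \<bar>norm (B $ k)\<bar>)"
      by (simp add: sum_norm_le)
    also have "\<dots> \<le> L2_set (\<lambda>k. A $ i $ k) UNIV * L2_set (\<lambda>k. norm (B $ k)) UNIV"
      by (rule L2_set_mult_ineq)
    finally show ?thesis
      by (simp add: norm_vec_def[where 'b = 'n] norm_vec_def[of B] L2_set_def)
  qed
  have "norm (A ** B) \<le> L2_set (\<lambda>i. norm (A $ i) * norm B) UNIV"
    unfolding norm_vec_def[of "A ** B"] by (rule L2_set_mono) (use row in auto)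
  also have "\<dots> = norm A * norm B"
    by (simp add: norm_vec_def[of A] L2_set_left_distrib)
  finally show ?thesis .
qed

lemma matrix_mult_scaleR_left: "(c *\<^sub>R A) ** B = c *\<^sub>R (A ** B)"
  for A :: "real ^ 'n ^ 'm"
  by (simp add: matrix_matrix_mult_def vec_eq_iff sum_distrib_left mult.assoc)

lemma matrix_mult_scaleR_right: "A ** (c *\<^sub>R B) = c *\<^sub>R (A ** B)"
  for A :: "real ^ 'n ^ 'm"
  by (simp add: matrix_matrix_mult_def vec_eq_iff sum_distrib_left mult.left_commute)

lemma bounded_bilinear_matrix_mult:
  "bounded_bilinear ((**) :: real ^ 'n ^ 'm \<Rightarrow> real ^ 'p ^ 'n \<Rightarrow> real ^ 'p ^ 'm)"
proof
  fix A A' :: "real ^ 'n ^ 'm" and B B' :: "real ^ 'p ^ 'n" and r :: real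
  show "(A + A') ** B = A ** B + A' ** B"
    by (simp add: matrix_matrix_mult_def vec_eq_iff sum.distrib distrib_right)
  show "A ** (B + B') = A ** B + A ** B'"
    by (rule matrix_add_ldistrib)
  show "(r *\<^sub>R A) ** B = r *\<^sub>R (A ** B)" "A ** (r *\<^sub>R B) = r *\<^sub>R (A ** B)"
    by (rule matrix_mult_scaleR_left matrix_mult_scaleR_right)+
next
  show "\<exists>K. \<forall>(A :: real ^ 'n ^ 'm) (B :: real ^ 'p ^ 'n). norm (A ** B) \<le> norm A * norm B * K"
    by (intro exI[of _ 1]) (simp add: norm_matrix_mult_le)
qed

lemmas tendsto_matrix_mult [tendsto_intros] =
  bounded_bilinear.tendsto[OF bounded_bilinear_matrix_mult]
lemmas matrix_mult_add_left = bounded_bilinear.add_left[OF bounded_bilinear_matrix_mult]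
lemmas matrix_mult_add_right = bounded_bilinear.add_right[OF bounded_bilinear_matrix_mult]
lemmas matrix_mult_diff_left = bounded_bilinear.diff_left[OF bounded_bilinear_matrix_mult]
lemmas matrix_mult_diff_right = bounded_bilinear.diff_right[OF bounded_bilinear_matrix_mult]
lemmas matrix_mult_minus_left = bounded_bilinear.minus_left[OF bounded_bilinear_matrix_mult]
lemmas matrix_mult_minus_right = bounded_bilinear.minus_right[OF bounded_bilinear_matrix_mult]
lemmas matrix_mult_algebra = matrix_mult_add_left matrix_mult_add_right
  matrix_mult_diff_left matrix_mult_diff_right matrix_mult_minus_left matrix_mult_minus_right
  matrix_mult_scaleR_left matrix_mult_scaleR_right

lemmas has_vector_derivative_matrix_mult =
  bounded_bilinear.has_vector_derivative[OF bounded_bilinear_matrix_mult]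

lemma continuous_on_matrix_mult [continuous_intros]:
  "continuous_on S f \<Longrightarrow> continuous_on S g \<Longrightarrow> continuous_on S (\<lambda>x. f x ** g x)"
  for f :: "_ \<Rightarrow> real ^ 'n ^ 'm" and g :: "_ \<Rightarrow> real ^ 'p ^ 'n"
  by (rule bounded_bilinear.continuous_on[OF bounded_bilinear_matrix_mult])

lemma has_vector_derivative_vecI:
  fixes f :: "real \<Rightarrow> 'a::real_normed_vector ^ 'n"
  assumes "\<And>i. ((\<lambda>x. f x $ i) has_vector_derivative f' $ i) (at x within S)"
  shows "(f has_vector_derivative f') (at x within S)"
proof -
  have "((\<lambda>y. \<Sum>i\<in>UNIV. axis i (f y $ i)) has_vector_derivative (\<Sum>i\<in>UNIV. axis i (f' $ i)))
      (at x within S)"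
  proof (rule has_vector_derivative_sum)
    fix i :: 'n
    have "bounded_linear (axis i :: 'a \<Rightarrow> 'a ^ 'n)"
    proof
      show "\<exists>K. \<forall>x. norm (axis i x :: 'a ^ 'n) \<le> norm x * K"
        by (intro exI[of _ 1]) (simp add: norm_vec_def axis_def L2_set_def if_distrib[of norm]
            if_distrib[of "\<lambda>x. x\<^sup>2"] cong: if_cong)
    qed (simp_all add: vec_eq_iff axis_def)
    from bounded_linear.has_vector_derivative[OF this assms]
    show "((\<lambda>y. axis i (f y $ i)) has_vector_derivative axis i (f' $ i)) (at x within S)" .
  qed
  moreover have "(\<Sum>i\<in>UNIV. axis i (v $ i)) = v" for v :: "'a ^ 'n"
    by (simp add: vec_eq_iff axis_def if_distrib cong: if_cong)
  ultimately show ?thesis by simp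
qed

lemma matrix_power_comm: "(((**) X) ^^ k) (mat 1) ** X = X ** (((**) X) ^^ k) (mat 1)"
  for X :: "real ^ 'n ^ 'n"
  by (induction k) (simp_all add: matrix_mul_assoc[symmetric])

lemma matrix_power_scaleR:
  "(((**) (t *\<^sub>R X)) ^^ k) (mat 1) = t ^ k *\<^sub>R (((**) X) ^^ k) (mat 1)"
  for X :: "real ^ 'n ^ 'n"
  by (induction k) (simp_all add: matrix_mult_algebra)

lemma norm_matrix_power_le: "norm ((((**) X) ^^ k) (mat 1)) \<le> norm (mat 1 :: real ^ 'n ^ 'n) * norm X ^ k"
  for X :: "real ^ 'n ^ 'n"
proof (induction k)
  case (Suc k)
  have "norm ((((**) X) ^^ Suc k) (mat 1)) \<le> norm X * norm ((((**) X) ^^ k) (mat 1))"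
    by (simp add: norm_matrix_mult_le)
  also have "\<dots> \<le> norm X * (norm (mat 1 :: real ^ 'n ^ 'n) * norm X ^ k)"
    by (rule mult_left_mono[OF Suc]) simp
  finally show ?case by (simp add: mult.left_commute)
qed simp

lemma summable_matrix_exp: "summable (\<lambda>k. (1 / fact k) *\<^sub>R (((**) X) ^^ k) (mat 1))"
  for X :: "real ^ 'n ^ 'n"
proof (rule summable_comparison_test')
  show "summable (\<lambda>k. norm (mat 1 :: real ^ 'n ^ 'n) * (norm X ^ k /\<^sub>R fact k))"
    by (intro summable_mult summable_exp_generic)
  show "norm ((1 / fact k) *\<^sub>R (((**) X) ^^ k) (mat 1))
      \<le> norm (mat 1 :: real ^ 'n ^ 'n) * (norm X ^ k /\<^sub>R fact k)" for k
    using norm_matrix_power_le[where k = k and X = X] by (simp add: divide_simps mult.commute)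
qed

lemma bounded_linear_matrix_nth: "bounded_linear (\<lambda>A :: real ^ 'n ^ 'm. A $ i $ j)"
  by (rule bounded_linear_compose[of "\<lambda>v. v $ j" "\<lambda>A. A $ i"]) auto

text \<open>Passing to entries turns the exponential into real power series in t, which can be
  differentiated termwise.\<close>

lemma matrix_exp_nth:
  "summable (\<lambda>k. ((((**) X) ^^ k) (mat 1)) $ i $ j / fact k * t ^ k)"
  "matrix_exp (t *\<^sub>R X) $ i $ j = (\<Sum>k. ((((**) X) ^^ k) (mat 1)) $ i $ j / fact k * t ^ k)"
  for X :: "real ^ 'n ^ 'n"
proof -
  have *: "((1 / fact k) *\<^sub>R (((**) (t *\<^sub>R X)) ^^ k) (mat 1)) $ i $ j =
      ((((**) X) ^^ k) (mat 1)) $ i $ j / fact k * t ^ k" for k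
    by (simp add: matrix_power_scaleR)
  show "summable (\<lambda>k. ((((**) X) ^^ k) (mat 1)) $ i $ j / fact k * t ^ k)"
    using bounded_linear.summable[OF bounded_linear_matrix_nth summable_matrix_exp[of "t *\<^sub>R X"], of i j]
    by (simp only: *)
  show "matrix_exp (t *\<^sub>R X) $ i $ j = (\<Sum>k. ((((**) X) ^^ k) (mat 1)) $ i $ j / fact k * t ^ k)"
    unfolding matrix_exp_def
    using bounded_linear.suminf[OF bounded_linear_matrix_nth summable_matrix_exp[of "t *\<^sub>R X"], of i j]
    by (simp only: *)
qed

text \<open>The differentiated coefficients are powers of X times one more factor X, which may be
  put on either side; this gives the derivative and the commutation together.\<close>

lemma matrix_exp_nth_deriv:
  "((\<lambda>t. matrix_exp (t *\<^sub>R X) $ i $ j) has_real_derivative (X ** matrix_exp (t *\<^sub>R X)) $ i $ j) (at t)"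
  "(X ** matrix_exp (t *\<^sub>R X)) $ i $ j = (matrix_exp (t *\<^sub>R X) ** X) $ i $ j"
  for X :: "real ^ 'n ^ 'n"
proof -
  define c where "c = (\<lambda>i j k. ((((**) X) ^^ k) (mat 1)) $ i $ j / fact k)"
  have s: "summable (\<lambda>k. c i j k * t ^ k)" for i j t
    unfolding c_def by (rule matrix_exp_nth)
  have e: "matrix_exp (t *\<^sub>R X) $ i $ j = (\<Sum>k. c i j k * t ^ k)" for i j t
    unfolding c_def by (rule matrix_exp_nth)
  have d: "((\<lambda>t. \<Sum>k. c i j k * t ^ k) has_real_derivative (\<Sum>k. diffs (c i j) k * t ^ k)) (at t)"
    by (rule termdiffs_strong_converges_everywhere[OF s])
  have 1: "diffs (c i j) k = (\<Sum>l\<in>UNIV. X $ i $ l * c l j k)" for k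
  proof -
    have "diffs (c i j) k = (X ** (((**) X) ^^ k) (mat 1)) $ i $ j / fact k"
      by (simp add: diffs_def c_def divide_simps)
    then show ?thesis
      by (simp add: c_def matrix_matrix_mult_def sum_divide_distrib)
  qed
  have 2: "diffs (c i j) k = (\<Sum>l\<in>UNIV. c i l k * X $ l $ j)" for k
  proof -
    have "diffs (c i j) k = ((((**) X) ^^ k) (mat 1) ** X) $ i $ j / fact k"
      by (simp add: diffs_def c_def divide_simps matrix_power_comm)
    then show ?thesis
      by (simp add: c_def matrix_matrix_mult_def sum_divide_distrib)
  qed
  have "(\<Sum>k. diffs (c i j) k * t ^ k) = (\<Sum>k. \<Sum>l\<in>UNIV. X $ i $ l * (c l j k * t ^ k))"
    by (simp add: 1 sum_distrib_right mult.assoc)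
  also have "\<dots> = (\<Sum>l\<in>UNIV. X $ i $ l * (\<Sum>k. c l j k * t ^ k))"
    by (subst suminf_sum) (simp_all add: s suminf_mult)
  finally have 3: "(\<Sum>k. diffs (c i j) k * t ^ k) = (X ** matrix_exp (t *\<^sub>R X)) $ i $ j"
    by (simp add: matrix_matrix_mult_def e)
  have "(\<Sum>k. diffs (c i j) k * t ^ k) = (\<Sum>k. \<Sum>l\<in>UNIV. X $ l $ j * (c i l k * t ^ k))"
    by (simp add: 2 sum_distrib_right sum_distrib_left mult_ac)
  also have "\<dots> = (\<Sum>l\<in>UNIV. X $ l $ j * (\<Sum>k. c i l k * t ^ k))"
    by (subst suminf_sum) (simp_all add: s suminf_mult)
  finally have 4: "(\<Sum>k. diffs (c i j) k * t ^ k) = (matrix_exp (t *\<^sub>R X) ** X) $ i $ j"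
    by (simp add: matrix_matrix_mult_def e mult.commute)
  show "((\<lambda>t. matrix_exp (t *\<^sub>R X) $ i $ j) has_real_derivative (X ** matrix_exp (t *\<^sub>R X)) $ i $ j) (at t)"
    using d 3 by (simp add: e)
  show "(X ** matrix_exp (t *\<^sub>R X)) $ i $ j = (matrix_exp (t *\<^sub>R X) ** X) $ i $ j"
    by (rule trans[OF 3[symmetric] 4])
qed

lemma matrix_exp_comm: "X ** matrix_exp (t *\<^sub>R X) = matrix_exp (t *\<^sub>R X) ** X"
  by (intro vec_eq_iff[THEN iffD2] allI matrix_exp_nth_deriv(2))

lemma has_vector_derivative_matrix_exp:
  "((\<lambda>t. matrix_exp (t *\<^sub>R X)) has_vector_derivative X ** matrix_exp (t *\<^sub>R X)) (at t within S)"
proof (rule has_vector_derivative_at_within, intro has_vector_derivative_vecI)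
  show "((\<lambda>t. matrix_exp (t *\<^sub>R X) $ i $ j) has_vector_derivative (X ** matrix_exp (t *\<^sub>R X)) $ i $ j) (at t)"
    for i j
    using matrix_exp_nth_deriv(1) by (simp add: has_real_derivative_iff_has_vector_derivative)
qed

lemma matrix_exp_0 [simp]: "matrix_exp (0 :: real ^ 'n ^ 'n) = mat 1"
proof -
  have "matrix_exp (0 *\<^sub>R (0 :: real ^ 'n ^ 'n)) $ i $ j = mat 1 $ i $ j" for i j
  proof -
    define c where "c k = ((((**) (0 :: real ^ 'n ^ 'n)) ^^ k) (mat 1)) $ i $ j / fact k" for k
    have "matrix_exp (0 *\<^sub>R (0 :: real ^ 'n ^ 'n)) $ i $ j = (\<Sum>k. c k * 0 ^ k)"
      unfolding c_def by (rule matrix_exp_nth(2))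
    also have "\<dots> = c 0" by (rule powser_zero)
    finally show ?thesis by (simp add: c_def)
  qed
  then show ?thesis by (simp add: vec_eq_iff)
qed

text \<open>\<open>matrix_exp (-t X) ** F t\<close> has derivative zero.\<close>

lemma matrix_exp_unique:
  fixes F :: "real \<Rightarrow> real ^ 'm ^ 'n"
  assumes F: "\<And>t. (F has_vector_derivative X ** F t) (at t)"
  shows "F t = matrix_exp (t *\<^sub>R X) ** F 0"
proof -
  \<comment> \<open>Stated for any number of columns: it is applied to \<open>F\<close> and also to
    the exponential itself, which shows that the two exponentials are inverse.\<close>
  have const: "matrix_exp (t *\<^sub>R - X) ** F t = F 0"
    if F: "\<And>t. (F has_vector_derivative X ** F t) (at t)" for F :: "real \<Rightarrow> real ^ 'k ^ 'n" and t
  proof -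
    have "((\<lambda>t. matrix_exp (t *\<^sub>R - X) ** F t) has_vector_derivative 0) (at t)" for t
    proof -
      have "X ** matrix_exp (t *\<^sub>R - X) = matrix_exp (t *\<^sub>R - X) ** X"
        using matrix_exp_comm[of "- X" t]
        by (simp add: matrix_mult_minus_left matrix_mult_minus_right del: scaleR_minus_right)
      then show ?thesis
        using has_vector_derivative_matrix_mult[OF has_vector_derivative_matrix_exp[of "- X"] F, of t]
        by (simp only: matrix_mult_minus_left matrix_mul_assoc) simp
    qed
    then have "\<exists>c. \<forall>t\<in>UNIV. matrix_exp (t *\<^sub>R - X) ** F t = c"
      by (intro has_derivative_zero_constant convex_UNIV) (simp add: has_vector_derivative_def)
    then obtain c where c: "\<forall>t. matrix_exp (t *\<^sub>R - X) ** F t = c" by blast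
    from c[rule_format, of t] c[rule_format, of 0]
    have "matrix_exp (t *\<^sub>R - X) ** F t = matrix_exp (0 *\<^sub>R - X) ** F 0"
      by (rule trans[OF _ sym])
    then show ?thesis by simp
  qed
  have "matrix_exp (t *\<^sub>R - X) ** matrix_exp (t *\<^sub>R X) = mat 1"
  proof -
    have "matrix_exp (t *\<^sub>R - X) ** matrix_exp (t *\<^sub>R X) = matrix_exp (0 *\<^sub>R X)"
      by (rule const) (rule has_vector_derivative_matrix_exp)
    then show ?thesis by simp
  qed
  then have "matrix_exp (t *\<^sub>R X) ** matrix_exp (t *\<^sub>R - X) = mat 1"
    by (simp only: matrix_left_right_inverse)
  then have "matrix_exp (t *\<^sub>R X) ** (matrix_exp (t *\<^sub>R - X) ** F t) = F t"
    by (simp only: matrix_mul_assoc matrix_mul_lid)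
  moreover have "matrix_exp (t *\<^sub>R - X) ** F t = F 0"
    by (rule const[OF F])
  ultimately show ?thesis by simp
qed

text \<open>As a function of s the left side solves the linear equation with initial value
  \<open>matrix_exp (t *\<^sub>R X)\<close>. Conjugation and transposition are treated below by the
  same uniqueness argument.\<close>

lemma matrix_exp_add: "matrix_exp ((s + t) *\<^sub>R X) = matrix_exp (s *\<^sub>R X) ** matrix_exp (t *\<^sub>R X)"
proof -
  have "((\<lambda>s. matrix_exp ((s + t) *\<^sub>R X)) has_vector_derivative
      X ** matrix_exp ((s + t) *\<^sub>R X)) (at s)" for s
    using vector_diff_chain_at[OF _ has_vector_derivative_matrix_exp, of "\<lambda>s. s + t" 1 s X]
    by (simp add: o_def has_vector_derivative_add_const)
  from matrix_exp_unique[OF this, of s] show ?thesis by simp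
qed

lemma matrix_exp_minus: "matrix_exp (t *\<^sub>R X) ** matrix_exp (- t *\<^sub>R X) = mat 1"
  using matrix_exp_add[of t "- t" X] by simp

lemma continuous_on_matrix_exp: "continuous_on S (\<lambda>t. matrix_exp (t *\<^sub>R X))"
  using has_vector_derivative_matrix_exp by (rule continuous_on_vector_derivative)

lemma matrix_exp_conj:
  fixes P Q X :: "real ^ 'n ^ 'n"
  assumes "P ** Q = mat 1"
  shows "matrix_exp (t *\<^sub>R (P ** X ** Q)) = P ** matrix_exp (t *\<^sub>R X) ** Q"
proof -
  have QP: "Q ** P = mat 1" using assms by (simp add: matrix_left_right_inverse)
  have "((\<lambda>t. P ** matrix_exp (t *\<^sub>R X) ** Q) has_vector_derivative
     (P ** X ** Q) ** (P ** matrix_exp (t *\<^sub>R X) ** Q)) (at t)" for t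
  proof -
    have "(P ** X ** Q) ** (P ** matrix_exp (t *\<^sub>R X) ** Q) = P ** X ** (Q ** P) ** matrix_exp (t *\<^sub>R X) ** Q"
      by (simp only: matrix_mul_assoc)
    also have "\<dots> = P ** (X ** matrix_exp (t *\<^sub>R X)) ** Q"
      by (simp only: QP matrix_mul_assoc[symmetric] matrix_mul_lid)
    finally show ?thesis
      using has_vector_derivative_matrix_mult[OF has_vector_derivative_matrix_mult[OF
            has_vector_derivative_const[of P] has_vector_derivative_matrix_exp[of X]] has_vector_derivative_const[of Q], of t UNIV]
      by simp
  qed
  from matrix_exp_unique[OF this, of t] show ?thesis by (simp add: assms)
qed

lemma bounded_linear_transpose: "bounded_linear (transpose :: real ^ 'n ^ 'm \<Rightarrow> real ^ 'm ^ 'n)"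
  unfolding linear_conv_bounded_linear[symmetric] by (intro linearI) (simp_all add: transpose_def vec_eq_iff)

lemma matrix_exp_transpose: "matrix_exp (t *\<^sub>R transpose X) = transpose (matrix_exp (t *\<^sub>R X))"
proof -
  have "((\<lambda>t. transpose (matrix_exp (t *\<^sub>R X))) has_vector_derivative
      transpose X ** transpose (matrix_exp (t *\<^sub>R X))) (at t)" for t
    using bounded_linear.has_vector_derivative[OF bounded_linear_transpose
        has_vector_derivative_matrix_exp[of X t UNIV]]
    by (simp add: matrix_exp_comm matrix_transpose_mul)
  from matrix_exp_unique[OF this, of t] show ?thesis by simp
qed

section \<open>The Lie algebra of a closed matrix group\<close>

abbreviation matrix_power :: "real ^ 'n ^ 'n \<Rightarrow> nat \<Rightarrow> real ^ 'n ^ 'n" where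
  "matrix_power A k \<equiv> (((**) A) ^^ k) (mat 1)"

lemma norm_matrix_power_near_1:
  "norm (matrix_power A k) \<le> norm (mat 1 :: real ^ 'n ^ 'n) * exp (of_nat k * norm (A - mat 1))"
  for A :: "real ^ 'n ^ 'n"
proof (induction k)
  case (Suc k)
  let ?N = "norm (mat 1 :: real ^ 'n ^ 'n)" and ?e = "norm (A - mat 1)"
  have "matrix_power A (Suc k) = matrix_power A k + (A - mat 1) ** matrix_power A k"
    by (simp add: matrix_mult_diff_left)
  then have "norm (matrix_power A (Suc k)) \<le> norm (matrix_power A k) + ?e * norm (matrix_power A k)"
    by (metis norm_triangle_mono norm_matrix_mult_le order_refl)
  also have "\<dots> = (1 + ?e) * norm (matrix_power A k)" by (simp add: algebra_simps)
  also have "\<dots> \<le> exp ?e * (?N * exp (of_nat k * ?e))"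
    by (intro mult_mono Suc exp_ge_add_one_self) auto
  also have "\<dots> = ?N * exp (of_nat (Suc k) * ?e)"
    by (simp add: exp_add algebra_simps)
  finally show ?case .
qed simp

text \<open>Telescoping: A^n - B^n is the sum of the n terms A^i (A - B) B^(n-1-i).\<close>

lemma norm_matrix_power_diff_le:
  assumes A: "\<And>k. k \<le> n \<Longrightarrow> norm (matrix_power A k) \<le> a"
    and B: "\<And>k. k \<le> n \<Longrightarrow> norm (matrix_power B k) \<le> b"
  shows "norm (matrix_power A n - matrix_power B n) \<le> of_nat n * norm (A - B) * (a * b)"
proof -
  have comm: "matrix_power A j ** A = matrix_power A (Suc j)" for j
    by (simp add: matrix_power_comm)
  \<comment> \<open>The left factor \<open>matrix_power A j\<close> makes the induction close:
    powers of \<open>A\<close> accumulate there and stay bounded by \<open>a\<close>, where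
    splitting off \<open>norm A\<close> each time would lose.\<close>
  have "norm (matrix_power A j ** (matrix_power A m - matrix_power B m)) \<le> of_nat m * norm (A - B) * (a * b)"
    if "j + m \<le> n" for j m
    using that
  proof (induction m arbitrary: j)
    case (Suc m)
    have "matrix_power A j ** (matrix_power A (Suc m) - matrix_power B (Suc m)) =
        (matrix_power A j ** A) ** (matrix_power A m - matrix_power B m)
        + matrix_power A j ** ((A - B) ** matrix_power B m)"
      by (simp add: matrix_mult_diff_left matrix_mult_diff_right matrix_mul_assoc)
    moreover have "norm ((matrix_power A j ** A) ** (matrix_power A m - matrix_power B m))
        \<le> of_nat m * norm (A - B) * (a * b)"
      unfolding comm using Suc.prems by (intro Suc.IH) simp
    moreover have "norm (matrix_power A j ** ((A - B) ** matrix_power B m)) \<le> a * (norm (A - B) * b)"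
    proof -
      have "norm ((A - B) ** matrix_power B m) \<le> norm (A - B) * b"
        by (rule order_trans[OF norm_matrix_mult_le mult_left_mono]) (use Suc.prems B[of m] in auto)
      moreover have "norm (matrix_power A j) \<le> a" using Suc.prems A[of j] by simp
      ultimately show ?thesis
        by (intro order_trans[OF norm_matrix_mult_le[of "matrix_power A j"]] mult_mono)
          (auto intro: order_trans[OF norm_ge_zero])
    qed
    ultimately have "norm (matrix_power A j ** (matrix_power A (Suc m) - matrix_power B (Suc m)))
      \<le> of_nat m * norm (A - B) * (a * b) + a * (norm (A - B) * b)"
      by (metis norm_triangle_mono)
    then show ?case by (simp add: algebra_simps)
  qed simp
  from this[of 0 n] show ?thesis by simp
qed

lemma matrix_power_matrix_exp: "matrix_power (matrix_exp (t *\<^sub>R X)) k = matrix_exp ((of_nat k * t) *\<^sub>R X)"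
  by (induction k) (simp_all add: distrib_right matrix_exp_add)

lemma has_vector_derivative_LIMSEQ:
  assumes "(f has_vector_derivative d) (at 0)" "t \<longlonglongrightarrow> 0" "\<And>k. t k \<noteq> (0::real)"
  shows "(\<lambda>k. (f (t k) - f 0) /\<^sub>R t k) \<longlonglongrightarrow> d"
proof -
  have "((\<lambda>h. norm (f (0 + h) - f 0 - h *\<^sub>R d) / norm h) \<longlongrightarrow> 0) (at 0)"
    using assms(1) unfolding has_vector_derivative_def has_derivative_at by blast
  moreover have "filterlim t (at 0) sequentially"
    using assms(2,3) by (simp add: filterlim_at)
  ultimately have "(\<lambda>k. norm (f (0 + t k) - f 0 - t k *\<^sub>R d) / norm (t k)) \<longlonglongrightarrow> 0"
    by (rule filterlim_compose)
  moreover have "norm (f (0 + t k) - f 0 - t k *\<^sub>R d) / norm (t k) = norm ((f (t k) - f 0) /\<^sub>R t k - d)" for k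
  proof -
    have "(f (t k) - f 0) /\<^sub>R t k - d = (f (0 + t k) - f 0 - t k *\<^sub>R d) /\<^sub>R t k"
      using assms(3)[of k] by (simp add: scaleR_diff_right)
    then show ?thesis by (simp add: divide_inverse mult.commute)
  qed
  ultimately have "(\<lambda>k. norm ((f (t k) - f 0) /\<^sub>R t k - d)) \<longlonglongrightarrow> 0" by simp
  then show ?thesis by (rule LIM_zero_cancel[OF tendsto_norm_zero_cancel])
qed

locale closed_matrix_group =
  fixes H :: "(real ^ 'n ^ 'n) set"
  assumes closed_H: "closed H"
    and one_mem: "mat 1 \<in> H"
    and mult_mem: "A \<in> H \<Longrightarrow> B \<in> H \<Longrightarrow> A ** B \<in> H"
    and ex_inverse: "A \<in> H \<Longrightarrow> \<exists>B\<in>H. A ** B = mat 1"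
begin

lemma inverse_mem:
  assumes "A \<in> H" "A ** B = mat 1"
  shows "B \<in> H"
proof -
  obtain B' where B': "B' \<in> H" "A ** B' = mat 1" using ex_inverse[OF assms(1)] by blast
  have "B ** A = mat 1" using assms(2) by (simp only: matrix_left_right_inverse)
  then have "B = B'" using B' assms(2) by (metis matrix_mul_assoc matrix_mul_lid matrix_mul_rid)
  then show ?thesis using B' by simp
qed

lemma power_mem: "A \<in> H \<Longrightarrow> matrix_power A k \<in> H"
  by (induction k) (auto simp: one_mem mult_mem)

text \<open>\<open>h k ^ \<lfloor>s / t k\<rfloor>\<close> converges to \<open>matrix_exp (s X)\<close>.\<close>

lemma matrix_exp_mem_limit:
  assumes h: "\<And>k. h k \<in> H" and t: "\<And>k. t k > (0::real)" "t \<longlonglongrightarrow> 0"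
    and X: "(\<lambda>k. (h k - mat 1) /\<^sub>R t k) \<longlonglongrightarrow> X" and s: "s \<ge> 0"
  shows "matrix_exp (s *\<^sub>R X) \<in> H"
proof -
  define m where "m k = nat \<lfloor>s / t k\<rfloor>" for k
  define B where "B k = matrix_exp (t k *\<^sub>R X)" for k
  have m1: "real (m k) * t k \<le> s" for k
  proof -
    have "real (m k) \<le> s / t k"
      using s t(1)[of k] by (simp add: m_def)
    then show ?thesis using t(1)[of k] by (simp add: pos_le_divide_eq)
  qed
  have m2: "s - t k \<le> real (m k) * t k" for k
  proof -
    have "s / t k \<le> real (m k) + 1"
      using s t(1)[of k] by (simp add: m_def)
    then show ?thesis using t(1)[of k] by (simp add: pos_divide_le_eq algebra_simps)
  qed
  have mt: "(\<lambda>k. real (m k) * t k) \<longlonglongrightarrow> s"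
    by (rule tendsto_sandwich[of "\<lambda>k. s - t k" _ _ "\<lambda>k. s"])
      (use m1 m2 t(2) in \<open>auto intro!: always_eventually tendsto_eq_intros\<close>)
  have "compact ((\<lambda>u. matrix_exp (u *\<^sub>R X)) ` {0..s})"
    by (intro compact_continuous_image continuous_on_matrix_exp) simp
  then obtain b where b: "\<And>u. u \<in> {0..s} \<Longrightarrow> norm (matrix_exp (u *\<^sub>R X)) \<le> b"
    using compact_imp_bounded bounded_iff by (metis imageI)
  have "Bseq (\<lambda>k. (h k - mat 1) /\<^sub>R t k)"
    using X by (intro convergent_imp_Bseq convergentI)
  then obtain c where c: "c > 0" "\<And>k. norm ((h k - mat 1) /\<^sub>R t k) \<le> c"
    by (auto elim: BseqE)
  define a where "a = norm (mat 1 :: real ^ 'n ^ 'n) * exp (s * c)"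
  have hc: "norm (h k - mat 1) \<le> c * t k" for k
  proof -
    have "norm (h k - mat 1) / t k \<le> c"
      using c(2)[of k] t(1)[of k] by (simp add: divide_inverse mult.commute)
    then show ?thesis using t(1)[of k] by (simp add: pos_divide_le_eq)
  qed
  have A: "norm (matrix_power (h k) j) \<le> a" if "j \<le> m k" for j k
  proof -
    have "real j * norm (h k - mat 1) \<le> real (m k) * (c * t k)"
      using that hc by (intro mult_mono) auto
    also have "\<dots> = c * (real (m k) * t k)" by simp
    also have "\<dots> \<le> s * c"
      using m1[of k] c(1) by (simp add: mult.commute)
    finally have "exp (real j * norm (h k - mat 1)) \<le> exp (s * c)" by simp
    then show ?thesis
      unfolding a_def by (meson mult_left_mono norm_ge_zero norm_matrix_power_near_1 order_trans)
  qed
  have Bb: "norm (matrix_power (B k) j) \<le> b" if "j \<le> m k" for j k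
  proof -
    have "real j * t k \<le> real (m k) * t k"
      using that t(1)[of k] by simp
    also note m1[of k]
    finally show ?thesis
      unfolding B_def matrix_power_matrix_exp using t(1)[of k] by (intro b) auto
  qed
  have "(\<lambda>k. (B k - mat 1) /\<^sub>R t k) \<longlonglongrightarrow> X"
  proof -
    have "t k \<noteq> 0" for k using t(1)[of k] by simp
    from has_vector_derivative_LIMSEQ[OF has_vector_derivative_matrix_exp[of X 0 UNIV] t(2) this]
    show ?thesis by (simp add: B_def)
  qed
  then have "(\<lambda>k. (h k - mat 1) /\<^sub>R t k - (B k - mat 1) /\<^sub>R t k) \<longlonglongrightarrow> X - X"
    by (rule tendsto_diff[OF X])
  moreover have "(h k - mat 1) /\<^sub>R t k - (B k - mat 1) /\<^sub>R t k = (h k - B k) /\<^sub>R t k" for k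
    by (simp add: scaleR_diff_right[symmetric])
  ultimately have "(\<lambda>k. (h k - B k) /\<^sub>R t k) \<longlonglongrightarrow> 0" by simp
  then have lim: "(\<lambda>k. s * norm ((h k - B k) /\<^sub>R t k) * (a * b)) \<longlonglongrightarrow> 0"
    by (intro tendsto_mult_left_zero tendsto_mult_right_zero tendsto_norm_zero)
  have ab: "a * b \<ge> 0"
    using order_trans[OF norm_ge_zero A[of 0 0]] order_trans[OF norm_ge_zero Bb[of 0 0]] by simp
  \<comment> \<open>The error of one factor is multiplied by \<open>m k\<close>, which is at most s
    / t k, so it is enough that \<open>h k\<close> and \<open>B k\<close> agree to first
    order.\<close>
  have "norm (matrix_power (h k) (m k) - matrix_power (B k) (m k)) \<le> s * norm ((h k - B k) /\<^sub>R t k) * (a * b)" for k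
  proof -
    have "norm (matrix_power (h k) (m k) - matrix_power (B k) (m k)) \<le> real (m k) * norm (h k - B k) * (a * b)"
      by (rule norm_matrix_power_diff_le[OF A Bb])
    also have "real (m k) * norm (h k - B k) = (real (m k) * t k) * norm ((h k - B k) /\<^sub>R t k)"
      using t(1)[of k] by simp
    also have "\<dots> * (a * b) \<le> s * norm ((h k - B k) /\<^sub>R t k) * (a * b)"
      using m1[of k] ab by (intro mult_right_mono) auto
    finally show ?thesis .
  qed
  then have "(\<lambda>k. norm (matrix_power (h k) (m k) - matrix_power (B k) (m k))) \<longlonglongrightarrow> 0"
    by (intro tendsto_sandwich[OF _ _ tendsto_const lim]) (auto intro!: always_eventually)
  then have 1: "(\<lambda>k. matrix_power (h k) (m k) - matrix_power (B k) (m k)) \<longlonglongrightarrow> 0"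
    by (rule tendsto_norm_zero_cancel)
  have "isCont (\<lambda>u. matrix_exp (u *\<^sub>R X)) s"
    using continuous_on_matrix_exp[of UNIV X] by (simp add: continuous_on_eq_continuous_at)
  then have "(\<lambda>k. matrix_power (B k) (m k)) \<longlonglongrightarrow> matrix_exp (s *\<^sub>R X)"
    unfolding B_def matrix_power_matrix_exp using mt by (rule isCont_tendsto_compose)
  from tendsto_add[OF 1 this] have "(\<lambda>k. matrix_power (h k) (m k)) \<longlonglongrightarrow> matrix_exp (s *\<^sub>R X)"
    by simp
  then show ?thesis
    by (rule closed_sequentially[OF closed_H, rotated]) (simp add: power_mem h)
qed

lemma lie_algebraI_limit:
  assumes "\<And>k. h k \<in> H" and "\<And>k. t k > (0::real)" "t \<longlonglongrightarrow> 0"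
    and "(\<lambda>k. (h k - mat 1) /\<^sub>R t k) \<longlonglongrightarrow> X"
  shows "X \<in> lie_algebra H"
  unfolding lie_algebra_def
proof (intro CollectI allI)
  fix s :: real
  show "matrix_exp (s *\<^sub>R X) \<in> H"
  proof (cases "s \<ge> 0")
    case False
    then have "matrix_exp (- s *\<^sub>R X) \<in> H" by (intro matrix_exp_mem_limit[OF assms]) simp
    then show ?thesis
      by (rule inverse_mem) (use matrix_exp_minus[of "- s" X] in simp)
  qed (rule matrix_exp_mem_limit[OF assms])
qed

lemma lie_algebraI_curve:
  assumes "\<And>u. f u \<in> H" and "f 0 = mat 1" and "(f has_vector_derivative X) (at 0)"
  shows "X \<in> lie_algebra H"
proof (rule lie_algebraI_limit)
  show "(\<lambda>k. inverse (of_nat (Suc k)) :: real) \<longlonglongrightarrow> 0" by (rule LIMSEQ_inverse_real_of_nat)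
  then show "(\<lambda>k. (f (inverse (of_nat (Suc k))) - mat 1) /\<^sub>R inverse (of_nat (Suc k))) \<longlonglongrightarrow> X"
    using has_vector_derivative_LIMSEQ[OF assms(3), of "\<lambda>k. inverse (of_nat (Suc k))"]
    by (simp add: assms(2) del: of_nat_Suc)
qed (simp_all add: assms)

lemma matrix_exp_mem: "X \<in> lie_algebra H \<Longrightarrow> matrix_exp (t *\<^sub>R X) \<in> H"
  by (simp add: lie_algebra_def)

text \<open>A sum X + Y is the initial velocity of the product of the two one-parameter groups, a
  curve in \<open>H\<close>.\<close>

lemma lie_algebra_subspace: "subspace (lie_algebra H)"
proof (rule subspaceI)
  show "0 \<in> lie_algebra H" by (simp add: lie_algebra_def one_mem)
next
  fix X Y assume XY: "X \<in> lie_algebra H" "Y \<in> lie_algebra H"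
  show "X + Y \<in> lie_algebra H"
  proof (rule lie_algebraI_curve)
    show "matrix_exp (u *\<^sub>R X) ** matrix_exp (u *\<^sub>R Y) \<in> H" for u
      by (intro mult_mem matrix_exp_mem XY)
    show "((\<lambda>u. matrix_exp (u *\<^sub>R X) ** matrix_exp (u *\<^sub>R Y)) has_vector_derivative X + Y) (at 0)"
      using has_vector_derivative_matrix_mult[OF has_vector_derivative_matrix_exp[of X 0 UNIV]
          has_vector_derivative_matrix_exp[of Y 0 UNIV]] by (simp add: add.commute)
  qed simp
next
  fix c X assume "X \<in> lie_algebra H"
  then show "c *\<^sub>R X \<in> lie_algebra H" by (simp add: lie_algebra_def)
qed

lemma lie_algebra_Ad:
  assumes "X \<in> lie_algebra H" "A \<in> H" "A ** B = mat 1"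
  shows "A ** X ** B \<in> lie_algebra H"
proof -
  have "B \<in> H" by (rule inverse_mem[OF assms(2,3)])
  then show ?thesis
    unfolding lie_algebra_def using assms by (simp add: matrix_exp_conj matrix_exp_mem mult_mem)
qed

text \<open>The bracket is the derivative at 0 of Y conjugated by
  \<open>matrix_exp (u *\<^sub>R X)\<close>. This curve stays in the Lie algebra, which is closed as
  a finite-dimensional subspace.\<close>

lemma lie_algebra_bracket:
  assumes "X \<in> lie_algebra H" "Y \<in> lie_algebra H"
  shows "X ** Y - Y ** X \<in> lie_algebra H"
proof -
  let ?L = "lie_algebra H" and ?t = "\<lambda>k. inverse (of_nat (Suc k)) :: real"
  let ?F = "\<lambda>u. matrix_exp (u *\<^sub>R X) ** Y ** matrix_exp (u *\<^sub>R - X)"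
  have mem: "?F u \<in> ?L" for u
    using matrix_exp_minus[of u X] by (intro lie_algebra_Ad matrix_exp_mem assms) simp
  have "(?F has_vector_derivative X ** Y - Y ** X) (at 0)"
    using has_vector_derivative_matrix_mult[OF has_vector_derivative_matrix_mult[OF
        has_vector_derivative_matrix_exp[of X 0 UNIV] has_vector_derivative_const[of Y]]
        has_vector_derivative_matrix_exp[of "- X" 0 UNIV]]
    by (simp add: matrix_mult_minus_right)
  then have "(\<lambda>k. (?F (?t k) - ?F 0) /\<^sub>R ?t k) \<longlonglongrightarrow> X ** Y - Y ** X"
    by (rule has_vector_derivative_LIMSEQ) (simp_all add: LIMSEQ_inverse_real_of_nat del: of_nat_Suc)
  then show ?thesis
    by (rule closed_sequentially[OF closed_subspace[OF lie_algebra_subspace], rotated])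
      (intro subspace_mul subspace_diff lie_algebra_subspace mem)
qed

text \<open>Translate an accumulation point to the identity. The displacements from the identity,
  scaled to length one, subconverge to a unit vector, which is a tangent vector.\<close>

lemma lie_algebra_nontrivial:
  assumes "compact H" "infinite H"
  shows "\<exists>X\<in>lie_algebra H. X \<noteq> 0"
proof -
  obtain a where a: "a \<in> H" "a islimpt H"
    using assms compact_eq_Bolzano_Weierstrass by blast
  then obtain f where f: "\<And>k. f k \<in> H - {a}" "f \<longlonglongrightarrow> a"
    using islimpt_sequential by blast
  obtain b where b: "b \<in> H" "a ** b = mat 1" using ex_inverse[OF a(1)] by blast
  then have ba: "b ** a = mat 1" by (simp only: matrix_left_right_inverse)
  define g where "g k = b ** f k" for k
  have gH: "g k \<in> H" for k using f b by (auto simp: g_def intro: mult_mem)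
  have g1: "g k \<noteq> mat 1" for k
  proof
    assume "g k = mat 1"
    then have "a ** (b ** f k) = a" by (simp add: g_def)
    then have "f k = a" by (simp only: matrix_mul_assoc b(2) matrix_mul_lid)
    then show False using f(1)[of k] by blast
  qed
  have "g \<longlonglongrightarrow> mat 1"
    unfolding g_def ba[symmetric] by (intro tendsto_intros f)
  then have t: "(\<lambda>k. norm (g k - mat 1)) \<longlonglongrightarrow> 0"
    by (intro tendsto_norm_zero LIM_zero)
  have "\<forall>k. (g k - mat 1) /\<^sub>R norm (g k - mat 1) \<in> sphere 0 1"
    using g1 by simp
  then obtain X r where X: "X \<in> sphere 0 1" "strict_mono r"
    "((\<lambda>k. (g k - mat 1) /\<^sub>R norm (g k - mat 1)) \<circ> r) \<longlonglongrightarrow> X"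
    by (rule seq_compactE[OF compact_imp_seq_compact[OF compact_sphere]])
  have "X \<in> lie_algebra H"
  proof (rule lie_algebraI_limit)
    show "(\<lambda>k. norm (g (r k) - mat 1)) \<longlonglongrightarrow> 0"
      using LIMSEQ_subseq_LIMSEQ[OF t X(2)] by (simp add: o_def)
    show "(\<lambda>k. (g (r k) - mat 1) /\<^sub>R norm (g (r k) - mat 1)) \<longlonglongrightarrow> X"
      using X(3) by (simp add: o_def)
  qed (use gH g1 in auto)
  with X(1) show ?thesis by (intro bexI[of _ X]) auto
qed

end

section \<open>Singular values and the Weyl chamber\<close>

definition mat3 :: "real \<Rightarrow> real \<Rightarrow> real \<Rightarrow> real \<Rightarrow> real \<Rightarrow> real \<Rightarrow> real \<Rightarrow> real \<Rightarrow> real \<Rightarrow> real ^ 3 ^ 3" where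
  "mat3 a b c d e f g h i = vector [vector [a, b, c], vector [d, e, f], vector [g, h, i]]"

abbreviation D13 :: "real ^ 3 ^ 3" where "D13 \<equiv> mat3 1 0 0 0 0 0 0 0 (- 1)"
abbreviation E12 :: "real ^ 3 ^ 3" where "E12 \<equiv> mat3 0 1 0 0 0 0 0 0 0"
abbreviation E13 :: "real ^ 3 ^ 3" where "E13 \<equiv> mat3 0 0 1 0 0 0 0 0 0"
abbreviation E21 :: "real ^ 3 ^ 3" where "E21 \<equiv> mat3 0 0 0 1 0 0 0 0 0"
abbreviation E23 :: "real ^ 3 ^ 3" where "E23 \<equiv> mat3 0 0 0 0 0 1 0 0 0"
abbreviation E31 :: "real ^ 3 ^ 3" where "E31 \<equiv> mat3 0 0 0 0 0 0 1 0 0"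
abbreviation E32 :: "real ^ 3 ^ 3" where "E32 \<equiv> mat3 0 0 0 0 0 0 0 1 0"

lemma mat3_nth [simp]:
  "mat3 a b c d e f g h i $ 1 $ 1 = a" "mat3 a b c d e f g h i $ 1 $ 2 = b" "mat3 a b c d e f g h i $ 1 $ 3 = c"
  "mat3 a b c d e f g h i $ 2 $ 1 = d" "mat3 a b c d e f g h i $ 2 $ 2 = e" "mat3 a b c d e f g h i $ 2 $ 3 = f"
  "mat3 a b c d e f g h i $ 3 $ 1 = g" "mat3 a b c d e f g h i $ 3 $ 2 = h" "mat3 a b c d e f g h i $ 3 $ 3 = i"
  by (simp_all add: mat3_def)

lemma mat3_eta: "mat3 (A$1$1) (A$1$2) (A$1$3) (A$2$1) (A$2$2) (A$2$3) (A$3$1) (A$3$2) (A$3$3) = A"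
  by (simp add: vec_eq_iff forall_3)

lemma mat3_cases: obtains a b c d e f g h i where "A = mat3 a b c d e f g h i"
  using mat3_eta[of A] by metis

lemma mat3_eq_iff: "mat3 a b c d e f g h i = mat3 a' b' c' d' e' f' g' h' i' \<longleftrightarrow>
  a = a' \<and> b = b' \<and> c = c' \<and> d = d' \<and> e = e' \<and> f = f' \<and> g = g' \<and> h = h' \<and> i = i'"
  by (metis mat3_nth)

lemma mat3_mult: "mat3 a b c d e f g h i ** mat3 a' b' c' d' e' f' g' h' i' =
  mat3 (a*a' + b*d' + c*g') (a*b' + b*e' + c*h') (a*c' + b*f' + c*i')
       (d*a' + e*d' + f*g') (d*b' + e*e' + f*h') (d*c' + e*f' + f*i')
       (g*a' + h*d' + i*g') (g*b' + h*e' + i*h') (g*c' + h*f' + i*i')"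
  by (simp add: vec_eq_iff forall_3 matrix_matrix_mult_def sum_3)

lemma mat3_add: "mat3 a b c d e f g h i + mat3 a' b' c' d' e' f' g' h' i' =
  mat3 (a+a') (b+b') (c+c') (d+d') (e+e') (f+f') (g+g') (h+h') (i+i')"
  by (simp add: vec_eq_iff forall_3)

lemma mat3_diff: "mat3 a b c d e f g h i - mat3 a' b' c' d' e' f' g' h' i' =
  mat3 (a-a') (b-b') (c-c') (d-d') (e-e') (f-f') (g-g') (h-h') (i-i')"
  by (simp add: vec_eq_iff forall_3)

lemma mat3_scaleR: "r *\<^sub>R mat3 a b c d e f g h i = mat3 (r*a) (r*b) (r*c) (r*d) (r*e) (r*f) (r*g) (r*h) (r*i)"
  by (simp add: vec_eq_iff forall_3)

lemma mat3_0: "0 = mat3 0 0 0 0 0 0 0 0 0"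
  by (simp add: vec_eq_iff forall_3)

lemma mat3_1: "mat 1 = mat3 1 0 0 0 1 0 0 0 1"
  by (simp add: vec_eq_iff forall_3 mat_def)

lemma mat3_transpose: "transpose (mat3 a b c d e f g h i) = mat3 a d g b e h c f i"
  by (simp add: vec_eq_iff forall_3 transpose_def)

lemma mat3_trace: "trace (mat3 a b c d e f g h i) = a + e + i"
  by (simp add: trace_def sum_3)

lemmas mat3_simps = mat3_eq_iff mat3_mult mat3_add mat3_diff mat3_scaleR mat3_transpose mat3_trace

lemma norm_mat3_le:
  "norm (mat3 a b c d e f g h i) \<le> \<bar>a\<bar> + \<bar>b\<bar> + \<bar>c\<bar> + \<bar>d\<bar> + \<bar>e\<bar> + \<bar>f\<bar> + \<bar>g\<bar> + \<bar>h\<bar> + \<bar>i\<bar>"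
proof -
  let ?A = "mat3 a b c d e f g h i"
  have "norm ?A \<le> (\<Sum>i\<in>UNIV. norm (?A $ i))"
    unfolding norm_vec_def[of ?A] by (rule L2_set_le_sum) simp
  also have "\<dots> \<le> (\<Sum>i\<in>UNIV. \<Sum>j\<in>UNIV. \<bar>?A $ i $ j\<bar>)"
    by (intro sum_mono norm_le_l1_cart)
  finally show ?thesis by (simp add: sum_3)
qed

lemma matrix_nth_le_norm: "\<bar>A $ i $ j\<bar> \<le> norm A" for A :: "real ^ 'n ^ 'm"
  by (rule order_trans[OF component_le_norm_cart Finite_Cartesian_Product.norm_nth_le])

section \<open>Orthogonal matrices and singular values\<close>

lemma norm_orthogonal_matrix3_le:
  fixes Q :: "real ^ 3 ^ 3"
  assumes "orthogonal_matrix Q"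
  shows "norm Q \<le> 2"
proof -
  have "norm (Q $ i) = 1" for i
    using assms by (simp add: orthogonal_matrix_orthonormal_rows row_def)
  then have "norm Q = sqrt 3"
    by (simp add: norm_vec_def[of Q] L2_set_def)
  then show ?thesis by (simp add: real_le_lsqrt)
qed

lemma norm_conj_orthogonal_le:
  fixes A :: "real ^ 3 ^ 3"
  assumes "orthogonal_matrix K" "orthogonal_matrix L"
  shows "norm (K ** A ** L) \<le> 4 * norm A"
proof -
  have "norm (K ** A ** L) \<le> norm K * norm A * norm L"
    by (meson norm_matrix_mult_le order_trans mult_right_mono norm_ge_zero)
  also have "\<dots> \<le> 2 * norm A * 2"
    using assms by (intro mult_mono norm_orthogonal_matrix3_le) auto
  finally show ?thesis by simp
qed

text \<open>First variation. Maximality is required only on the plane of x and y, so the lemma also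
  serves for the second singular vector, whose competitors are orthogonal to the first.\<close>

lemma orthogonal_if_maximal:
  fixes A :: "real ^ 'n ^ 'm"
  assumes xy: "norm x = 1" "norm y = 1" "x \<bullet> y = 0"
    and max: "\<And>s t. norm (A *v (s *\<^sub>R x + t *\<^sub>R y)) \<le> norm (A *v x) * norm (s *\<^sub>R x + t *\<^sub>R y)"
  shows "(A *v x) \<bullet> (A *v y) = 0"
proof (rule ccontr)
  define c where "c = (A *v x) \<bullet> (A *v y)"
  define M where "M = (A *v x) \<bullet> (A *v x)"
  define N where "N = (A *v y) \<bullet> (A *v y)"
  assume "\<not> ?thesis"
  then have c: "c \<noteq> 0" by (simp add: c_def)
  have q: "2 * t * c + t\<^sup>2 * N \<le> t\<^sup>2 * M" for t
  proof -
    have 1: "(norm (A *v (1 *\<^sub>R x + t *\<^sub>R y)))\<^sup>2 \<le> (norm (A *v x) * norm (1 *\<^sub>R x + t *\<^sub>R y))\<^sup>2"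
      by (rule power_mono[OF max]) simp
    have 2: "(norm (1 *\<^sub>R x + t *\<^sub>R y))\<^sup>2 = 1 + t\<^sup>2"
      using xy unfolding power2_norm_eq_inner norm_eq_sqrt_inner
      by (simp add: inner_add_left inner_add_right inner_commute power2_eq_square)
    have 3: "(norm (A *v (1 *\<^sub>R x + t *\<^sub>R y)))\<^sup>2 = M + 2 * t * c + t\<^sup>2 * N"
      unfolding power2_norm_eq_inner M_def N_def c_def
      by (simp add: matrix_vector_right_distrib matrix_vector_mult_scaleR inner_add_left inner_add_right
          inner_commute power2_eq_square algebra_simps)
    have "(norm (A *v x))\<^sup>2 = M" by (simp add: M_def power2_norm_eq_inner)
    with 1 have "M + 2 * t * c + t\<^sup>2 * N \<le> M * (1 + t\<^sup>2)"
      by (simp only: power_mult_distrib 2 3)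
    then show ?thesis by (simp add: algebra_simps)
  qed
  have "M - N \<ge> 0"
  proof -
    have "norm (A *v y) \<le> norm (A *v x)" using max[of 0 1] xy by simp
    then have "(norm (A *v y))\<^sup>2 \<le> (norm (A *v x))\<^sup>2" by (rule power_mono) simp
    then show ?thesis by (simp add: M_def N_def power2_norm_eq_inner)
  qed
  \<comment> \<open>Testing \<open>q\<close> at t = c / D gives 2 D \<le> D - 1 after cancelling;
    the summand 1 keeps D positive when M = N.\<close>
  define D where "D = M - N + 1"
  have D: "D \<ge> 1" using \<open>M - N \<ge> 0\<close> by (simp add: D_def)
  have "2 * (c / D) * c \<le> (c / D)\<^sup>2 * (D - 1)" using q[of "c / D"] by (simp add: D_def algebra_simps)
  then have "2 * c\<^sup>2 * D \<le> c\<^sup>2 * (D - 1)" using D by (simp add: field_simps power2_eq_square)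
  moreover have "c\<^sup>2 * (D - 1) < 2 * c\<^sup>2 * D" using c D by (simp add: algebra_simps add_pos_pos)
  ultimately show False by simp
qed

definition diag3 :: "real \<Rightarrow> real \<Rightarrow> real \<Rightarrow> real ^ 3 ^ 3" where
  "diag3 a b c = mat3 a 0 0 0 b 0 0 0 c"

lemma diag3_mult: "diag3 a b c ** diag3 a' b' c' = diag3 (a * a') (b * b') (c * c')"
  by (simp add: diag3_def mat3_simps)

lemma diag3_1: "diag3 1 1 1 = mat 1"
  by (simp add: diag3_def mat3_1)

lemma det_diag3: "det (diag3 a b c) = a * b * c"
  by (simp add: diag3_def det_3)

lemma norm_diag3_le: "norm (diag3 a b c) \<le> \<bar>a\<bar> + \<bar>b\<bar> + \<bar>c\<bar>"
  using norm_mat3_le[of a 0 0 0 b 0 0 0 c] by (simp add: diag3_def)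

lemma norm_diag3_ge: "\<bar>a\<bar> \<le> norm (diag3 a b c)" "\<bar>c\<bar> \<le> norm (diag3 a b c)"
  using matrix_nth_le_norm[of "diag3 a b c" 1 1] matrix_nth_le_norm[of "diag3 a b c" 3 3]
  by (simp_all add: diag3_def)

lemma orthogonal_matrix_inverse:
  "orthogonal_matrix Q \<Longrightarrow> transpose Q ** Q = mat 1" "orthogonal_matrix Q \<Longrightarrow> Q ** transpose Q = mat 1"
  by (simp_all add: orthogonal_matrix_def)

unbundle cross3_syntax

text \<open>The length of \<open>A *v v\<close> is maximized over the unit sphere, then over the
  unit vectors orthogonal to the first maximizer. Both orthogonal factors get determinant one, so
  that the compact factors built from them stay in the group.\<close>

lemma singular_value_decomposition3:
  fixes A :: "real ^ 3 ^ 3"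
  assumes det: "det A = 1"
  obtains K L a b c where "orthogonal_matrix K" "orthogonal_matrix L" "det K = 1" "det L = 1"
    "A = K ** diag3 a b c ** L" "a \<ge> b" "b \<ge> c" "c > 0" "a * b * c = 1"
proof -
  have inj: "A *v v \<noteq> 0" if "v \<noteq> 0" for v
  proof
    assume Av: "A *v v = 0"
    have "invertible A" using det by (simp add: invertible_det_nz)
    then obtain B where "B ** A = mat 1" by (auto simp: invertible_def)
    then have "v = B *v (A *v v)" by (simp add: matrix_vector_mul_assoc)
    with Av that show False by simp
  qed
  have cont: "continuous_on S (\<lambda>v. norm (A *v v))" for S
    by (intro continuous_intros linear_continuous_on matrix_vector_mul_bounded_linear)
  have "axis 1 1 \<in> sphere (0 :: real ^ 3) 1" by simp
  then obtain x where x: "norm x = 1" "\<And>v. norm v = 1 \<Longrightarrow> norm (A *v v) \<le> norm (A *v x)"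
    using continuous_attains_sup[OF compact_sphere _ cont, of "0 :: real ^ 3" 1]
    by auto
  define S where "S = sphere (0 :: real ^ 3) 1 \<inter> {v. x \<bullet> v = 0}"
  have "compact S" unfolding S_def
    by (intro compact_Int_closed compact_sphere closed_hyperplane)
  moreover have "S \<noteq> {}"
  proof -
    obtain w :: "real ^ 3" where w: "w \<noteq> 0" "orthogonal x w"
      by (rule orthogonal_to_vector_exists[of x]) auto
    then have "w /\<^sub>R norm w \<in> S" by (simp add: S_def orthogonal_def)
    then show ?thesis by blast
  qed
  ultimately obtain y where y: "y \<in> S" "\<And>v. v \<in> S \<Longrightarrow> norm (A *v v) \<le> norm (A *v y)"
    using continuous_attains_sup[OF _ _ cont, of S] by blast
  then have y1: "norm y = 1" "x \<bullet> y = 0" by (auto simp: S_def)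
  \<comment> \<open>The cross product completes the frame with positive orientation, hence
    \<open>det L = 1\<close>; \<open>det K = 1\<close> then follows from the positive singular
    values.\<close>
  define z where "z = x \<times> y"
  have zx: "x \<bullet> z = 0" "y \<bullet> z = 0" by (simp_all add: z_def dot_cross_self)
  have z1: "norm z = 1"
    using norm_cross_dot[of x y] x(1) y1 by (simp add: z_def norm_eq_1 power2_norm_eq_inner)
  have scale: "norm (A *v v) \<le> norm (A *v x) * norm v" for v
  proof (cases "v = 0")
    case False
    then have "norm (A *v (v /\<^sub>R norm v)) \<le> norm (A *v x)" by (intro x(2)) simp
    with False show ?thesis by (simp add: matrix_vector_mult_scaleR field_simps)
  qed simp
  have scale2: "norm (A *v v) \<le> norm (A *v y) * norm v" if "x \<bullet> v = 0" for v
  proof (cases "v = 0")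
    case False
    then have "norm (A *v (v /\<^sub>R norm v)) \<le> norm (A *v y)" using that by (intro y(2)) (simp add: S_def)
    with False show ?thesis by (simp add: matrix_vector_mult_scaleR field_simps)
  qed simp
  have xy: "(A *v x) \<bullet> (A *v y) = 0" using x(1) y1 by (rule orthogonal_if_maximal[OF _ _ _ scale])
  have xz: "(A *v x) \<bullet> (A *v z) = 0" using x(1) z1 zx(1) by (rule orthogonal_if_maximal[OF _ _ _ scale])
  have yz: "(A *v y) \<bullet> (A *v z) = 0"
    by (rule orthogonal_if_maximal[OF y1(1) z1 zx(2)], rule scale2)
      (simp add: inner_add_right y1 zx)
  define a b c where abc: "a = norm (A *v x)" "b = norm (A *v y)" "c = norm (A *v z)"
  have "x \<noteq> 0" "y \<noteq> 0" "z \<noteq> 0" using x(1) y1(1) z1 by auto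
  then have pos: "a > 0" "b > 0" "c > 0" using inj by (simp_all add: abc)
  have ab: "a \<ge> b" "b \<ge> c" using x(2)[OF y1(1)] y(2)[of z] z1 zx by (auto simp: abc S_def)
  define L :: "real ^ 3 ^ 3" where "L = vector [x, y, z]"
  define K :: "real ^ 3 ^ 3" where
    "K = transpose (vector [(A *v x) /\<^sub>R a, (A *v y) /\<^sub>R b, (A *v z) /\<^sub>R c])"
  have L: "orthogonal_matrix L"
    unfolding orthogonal_matrix_orthonormal_rows
    using x(1) y1 z1 zx by (simp add: L_def forall_3 row_def orthogonal_def inner_commute)
  have K: "orthogonal_matrix K"
    unfolding orthogonal_matrix_orthonormal_columns K_def column_transpose
    using pos xy xz yz by (simp add: forall_3 row_def orthogonal_def inner_commute abc)
  have "A ** transpose L = K ** diag3 a b c"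
  proof -
    have "(A ** transpose L) $ i $ j = (K ** diag3 a b c) $ i $ j" for i j
      using exhaust_3[of j] pos
      by (auto simp: matrix_matrix_mult_def K_def L_def transpose_def diag3_def sum_3 matrix_vector_mult_def)
    then show ?thesis by (simp add: vec_eq_iff)
  qed
  then have A: "A = K ** diag3 a b c ** L"
    by (metis L matrix_mul_assoc matrix_mul_rid orthogonal_matrix_inverse(1))
  have detL: "det L = 1"
  proof -
    have "det L = x \<bullet> (y \<times> z)"
      by (simp add: L_def det_3 cross3_def inner_vec_def sum_3 algebra_simps)
    also have "\<dots> = z \<bullet> (x \<times> y)"
      by (simp add: cross3_def inner_vec_def sum_3 algebra_simps)
    finally show ?thesis using z1 by (simp add: z_def norm_eq_1)
  qed
  have "det K * (a * b * c) = 1"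
    using det detL A by (simp add: det_mul det_diag3)
  moreover have "det K = 1 \<or> det K = - 1" by (rule det_orthogonal_matrix[OF K])
  moreover have "a * b * c > 0" using pos by simp
  ultimately have "det K = 1" "a * b * c = 1" by auto
  with K L detL A ab pos show ?thesis by (intro that)
qed

unbundle no cross3_syntax

section \<open>From the Weyl chamber to the decomposition of the group\<close>

abbreviation realizes :: "(real ^ 3 ^ 3) set \<Rightarrow> real \<Rightarrow> real \<Rightarrow> real \<Rightarrow> bool" where
  "realizes H M \<alpha> \<beta> \<equiv> \<exists>g\<in>H. \<exists>g'. g ** g' = mat 1 \<and> \<alpha> \<le> M * norm g \<and> norm g \<le> M * \<alpha> \<and>
     \<beta> \<le> M * norm g' \<and> norm g' \<le> M * \<beta>"

text \<open>The Cartan projection of \<open>g\<close> is, up to a bounded error, given by the logarithms of the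
  norms of \<open>g\<close> and \<open>inverse g\<close>; the two inequalities between \<open>\<alpha>\<close> and \<open>\<beta>\<close> describe the Weyl chamber.\<close>

definition fills_chamber :: "(real ^ 3 ^ 3) set \<Rightarrow> bool" where
  "fills_chamber H \<longleftrightarrow> (\<exists>M>0. \<forall>\<alpha>\<ge>1. \<forall>\<beta>\<ge>1. \<alpha> \<le> \<beta>\<^sup>2 \<longrightarrow> \<beta> \<le> \<alpha>\<^sup>2 \<longrightarrow>
     (realizes H M \<alpha> \<beta>))"

lemma norm_orthogonal_conj_bounds:
  fixes D :: "real ^ 3 ^ 3"
  assumes "orthogonal_matrix K" "orthogonal_matrix L" and A: "A = K ** D ** L"
  shows "norm A \<le> 4 * norm D" "norm D \<le> 4 * norm A"
proof -
  show "norm A \<le> 4 * norm D" unfolding A by (rule norm_conj_orthogonal_le[OF assms(1,2)])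
  have "transpose K ** A ** transpose L = (transpose K ** K) ** D ** (L ** transpose L)"
    by (simp only: A matrix_mul_assoc)
  also have "\<dots> = D" using assms(1,2) by (simp add: orthogonal_matrix_inverse)
  finally show "norm D \<le> 4 * norm A"
    using norm_conj_orthogonal_le[of "transpose K" "transpose L" A] assms(1,2) by simp
qed

lemma matrix_inverse_unique:
  fixes A :: "real ^ 'n ^ 'n"
  assumes "A ** B = mat 1" "A ** C = mat 1"
  shows "B = C"
proof -
  have "B ** A = mat 1" using assms(1) by (simp only: matrix_left_right_inverse)
  then have "C = B ** (A ** C)" by (simp add: matrix_mul_assoc)
  then show ?thesis by (simp add: assms(2))
qed

text \<open>The constant 4 comes from two orthogonal factors of norm at most 2 (actually the square
  root of 3), and 12 from the three diagonal entries, each bounded by the largest.\<close>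

lemma singular_values_norm_bounds:
  fixes A B :: "real ^ 3 ^ 3"
  assumes KL: "orthogonal_matrix K" "orthogonal_matrix L" and A: "A = K ** diag3 a b c ** L"
    and abc: "a \<ge> b" "b \<ge> c" "c > 0" and AB: "A ** B = mat 1"
  shows "a \<le> 4 * norm A" "norm A \<le> 12 * a" "1 / c \<le> 4 * norm B" "norm B \<le> 12 * (1 / c)"
proof -
  show "a \<le> 4 * norm A"
    using norm_orthogonal_conj_bounds(2)[OF KL A] norm_diag3_ge(1)[of a b c] by linarith
  show "norm A \<le> 12 * a"
    using norm_orthogonal_conj_bounds(1)[OF KL A] norm_diag3_le[of a b c] abc by linarith
  let ?D = "diag3 (1 / a) (1 / b) (1 / c)"
  have "A ** (transpose L ** ?D ** transpose K) = K ** diag3 a b c ** (L ** transpose L) ** ?D ** transpose K"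
    by (simp only: A matrix_mul_assoc)
  also have "\<dots> = K ** (diag3 a b c ** ?D) ** transpose K"
    using KL by (simp add: orthogonal_matrix_inverse matrix_mul_assoc)
  also have "\<dots> = mat 1"
    using abc KL by (simp add: diag3_mult diag3_1 orthogonal_matrix_inverse)
  finally have B: "B = transpose L ** ?D ** transpose K" using AB by (rule matrix_inverse_unique[rotated])
  have KL': "orthogonal_matrix (transpose L)" "orthogonal_matrix (transpose K)" using KL by simp_all
  show "1 / c \<le> 4 * norm B"
    using norm_orthogonal_conj_bounds(2)[OF KL' B] norm_diag3_ge(2)[where a = "1/a" and b = "1/b" and c = "1/c"] by linarith
  have "1 / a \<le> 1 / c" "1 / b \<le> 1 / c" "1 / a > 0" "1 / b > 0" using abc by (auto simp: field_simps)
  then show "norm B \<le> 12 * (1 / c)"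
    using norm_orthogonal_conj_bounds(1)[OF KL' B] norm_diag3_le[of "1/a" "1/b" "1/c"] by linarith
qed

text \<open>If the singular values of \<open>A\<close> and of some \<open>g\<close> in
  \<open>H\<close> have bounded ratios, a bounded diagonal matrix \<delta> turns one diagonal part
  into the other, and the orthogonal factors absorb the rest.\<close>

lemma fills_chamber_imp_KHK:
  assumes fills: "fills_chamber H" and det: "\<And>A. A \<in> H \<Longrightarrow> det A = 1"
  shows "\<exists>R. \<forall>A :: real ^ 3 ^ 3. det A = 1 \<longrightarrow> (\<exists>g\<in>H. \<exists>c c'. A = c ** g ** c' \<and>
    det c = 1 \<and> norm c \<le> R \<and> det c' = 1 \<and> norm c' \<le> R)"
proof -
  obtain M where M: "M > 0" and big: "\<And>\<alpha> \<beta>. \<alpha> \<ge> 1 \<Longrightarrow> \<beta> \<ge> 1 \<Longrightarrow> \<alpha> \<le> \<beta>\<^sup>2 \<Longrightarrow> \<beta> \<le> \<alpha>\<^sup>2 \<Longrightarrow>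
     realizes H M \<alpha> \<beta>"
    using fills unfolding fills_chamber_def by blast
  define S where "S = 12 * M"
  \<comment> \<open>The parenthesis bounds the norm of \<delta>, multiplied by 4 for two orthogonal
    factors; the last 4 covers a product of two orthogonal matrices.\<close>
  define R where "R = 4 * (S + S * S + S) + 4"
  have S: "S > 0" using M by (simp add: S_def)
  have "\<exists>g\<in>H. \<exists>c c'. A = c ** g ** c' \<and> det c = 1 \<and> norm c \<le> R \<and> det c' = 1 \<and> norm c' \<le> R"
    if detA: "det A = 1" for A :: "real ^ 3 ^ 3"
  proof -
    obtain K L x y z where K: "orthogonal_matrix K" "det K = 1" and L: "orthogonal_matrix L" "det L = 1"
      and A: "A = K ** diag3 x y z ** L" and xyz: "x \<ge> y" "y \<ge> z" "z > 0" "x * y * z = 1"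
      by (rule singular_value_decomposition3[OF detA])
    have y: "y = 1 / (x * z)" using xyz by (auto simp: field_simps)
    have pos: "x > 0" "y > 0" using xyz by auto
    have "z * z * z \<le> x * y * z" "x * y * z \<le> x * x * x"
      by (intro mult_mono; use xyz pos in auto)+
    then have "z ^ 3 \<le> 1" "1 \<le> x ^ 3" by (simp_all add: power3_eq_cube xyz(4))
    then have z1: "z \<le> 1" and x1: "x \<ge> 1"
      using xyz(3) pos power_le_one_iff[of z 3] power_strict_mono[of x 1 3] by (auto simp: not_le[symmetric])
    \<comment> \<open>The two chamber inequalities are y \<ge> z and y \<le> x, rewritten with x y z
      = 1.\<close>
    have "x \<le> (1 / z)\<^sup>2"
    proof -
      have "x * (z * z) \<le> x * (y * z)" using xyz pos by (intro mult_left_mono mult_right_mono) auto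
      then show ?thesis using xyz(3,4) by (simp add: field_simps power2_eq_square)
    qed
    moreover have "1 / z \<le> x\<^sup>2"
    proof -
      have "x * y * z \<le> x * x * z" using xyz pos by (intro mult_left_mono mult_right_mono) auto
      then show ?thesis using xyz(3,4) by (simp add: field_simps power2_eq_square)
    qed
    moreover have "1 / z \<ge> 1" using z1 xyz by simp
    ultimately obtain g g' where g: "g \<in> H" "g ** g' = mat 1" "x \<le> M * norm g" "norm g \<le> M * x"
      "1 / z \<le> M * norm g'" "norm g' \<le> M * (1 / z)"
      using big[of x "1 / z"] x1 by blast
    obtain K2 L2 a b c where K2: "orthogonal_matrix K2" "det K2 = 1" and L2: "orthogonal_matrix L2" "det L2 = 1"
      and gd: "g = K2 ** diag3 a b c ** L2" and abc: "a \<ge> b" "b \<ge> c" "c > 0" "a * b * c = 1"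
      by (rule singular_value_decomposition3[OF det[OF g(1)]])
    have b: "b = 1 / (a * c)" using abc by (auto simp: field_simps)
    have apos: "a > 0" "b > 0" using abc by auto
    note bnd = singular_values_norm_bounds[OF K2(1) L2(1) gd abc(1-3) g(2)]
    have xa: "x \<le> S * a" "a \<le> S * x" "1 / z \<le> S * (1 / c)" "1 / c \<le> S * (1 / z)"
    proof -
      show "x \<le> S * a"
        using order_trans[OF g(3) mult_left_mono[OF bnd(2)]] M by (simp add: S_def mult_ac)
      show "a \<le> S * x"
        using bnd(1) g(4) M mult_pos_pos[OF M pos(1)] by (simp add: S_def)
      show "1 / z \<le> S * (1 / c)"
        using order_trans[OF g(5) mult_left_mono[OF bnd(4)]] M by (simp add: S_def mult_ac)
      have "M * (1 / z) > 0" using M xyz(3) by simp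
      then show "1 / c \<le> S * (1 / z)"
        using bnd(3) g(6) unfolding S_def by linarith
    qed
    define \<delta> where "\<delta> = diag3 (x / a) (y / b) (z / c)"
    have \<delta>: "\<delta> ** diag3 a b c = diag3 x y z"
      using apos abc(3) by (simp add: \<delta>_def diag3_mult)
    have det\<delta>: "det \<delta> = 1"
      using apos abc xyz by (simp add: \<delta>_def det_diag3)
    have "x / a \<le> S" using xa(1) apos by (simp add: field_simps)
    moreover have "z / c \<le> S" using xa(4) xyz(3) abc(3) by (simp add: field_simps)
    \<comment> \<open>The norms say nothing about the middle singular value; both determinants being
      one, its ratio is determined by the outer ratios.\<close>
    moreover have "y / b \<le> S * S"
    proof -
      have "y / b = (a / x) * (c / z)" unfolding y b using pos apos abc xyz by (simp add: field_simps)
      also have "\<dots> \<le> S * S"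
        using xa(2,3) pos apos abc(3) xyz(3) S by (intro mult_mono) (auto simp: field_simps)
      finally show ?thesis .
    qed
    moreover have "x / a > 0" "y / b > 0" "z / c > 0" using pos apos abc xyz by auto
    ultimately have "norm \<delta> \<le> S + S * S + S"
      using norm_diag3_le[of "x / a" "y / b" "z / c"] by (simp add: \<delta>_def)
    moreover have "norm (K ** \<delta> ** transpose K2) \<le> 4 * norm \<delta>"
      using K K2 by (intro norm_conj_orthogonal_le) auto
    ultimately have c: "norm (K ** \<delta> ** transpose K2) \<le> R" by (simp add: R_def)
    have "norm (transpose L2 ** L) \<le> norm (transpose L2) * norm L" by (rule norm_matrix_mult_le)
    also have "\<dots> \<le> 2 * 2"
      using L L2 by (intro mult_mono norm_orthogonal_matrix3_le) auto
    also have "\<dots> \<le> R" using S by (simp add: R_def)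
    finally have c': "norm (transpose L2 ** L) \<le> R" .
    have "(K ** \<delta> ** transpose K2) ** g ** (transpose L2 ** L) =
        K ** \<delta> ** (transpose K2 ** K2) ** diag3 a b c ** (L2 ** transpose L2) ** L"
      by (simp only: gd matrix_mul_assoc)
    also have "\<dots> = K ** (\<delta> ** diag3 a b c) ** L"
      using K2 L2 by (simp add: orthogonal_matrix_inverse matrix_mul_assoc)
    also have "\<dots> = A" by (simp add: \<delta> A)
    finally have "A = (K ** \<delta> ** transpose K2) ** g ** (transpose L2 ** L)" ..
    moreover have "det (K ** \<delta> ** transpose K2) = 1" "det (transpose L2 ** L) = 1"
      using K K2 L L2 det\<delta> by (simp_all add: det_mul)
    ultimately show ?thesis using g(1) c c' by blast
  qed
  then show ?thesis by blast
qed

lemma continuous_on_det3: "continuous_on S (\<lambda>A :: real ^ 3 ^ 3. det A)"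
  unfolding det_3 by (intro continuous_intros)

lemma fills_chamber_imp_Cartan_decomposition_subgroup:
  assumes H: "closed_subgroup H SL" "connected H" and fills: "fills_chamber H"
  shows "Cartan_decomposition_subgroup H SL"
proof -
  have sub: "subgroup H SL" using H(1) by (simp add: closed_subgroup_def)
  then have detH: "det A = 1" if "A \<in> H" for A
    using that subgroup.mem_carrier[OF sub] by (force simp: SL_def)
  obtain R where R: "\<And>A :: real ^ 3 ^ 3. det A = 1 \<Longrightarrow> \<exists>g\<in>H. \<exists>c c'. A = c ** g ** c' \<and>
    det c = 1 \<and> norm c \<le> R \<and> det c' = 1 \<and> norm c' \<le> R"
    using fills_chamber_imp_KHK[OF fills detH] by blast
  define C where "C = {c :: real ^ 3 ^ 3. det c = 1} \<inter> cball 0 R"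
  have "closed {c :: real ^ 3 ^ 3. det c = 1}"
    using continuous_closed_preimage_constant[OF continuous_on_det3 closed_UNIV, of 1] by simp
  then have "compact C"
    unfolding C_def by (intro closed_Int_compact compact_cball)
  moreover have "C \<subseteq> carrier SL" by (auto simp: C_def SL_def)
  moreover have "C <#>\<^bsub>SL\<^esub> H <#>\<^bsub>SL\<^esub> C = carrier SL"
  proof
    show "C <#>\<^bsub>SL\<^esub> H <#>\<^bsub>SL\<^esub> C \<subseteq> carrier SL"
      by (auto simp: set_mult_def SL_def C_def det_mul detH)
    show "carrier SL \<subseteq> C <#>\<^bsub>SL\<^esub> H <#>\<^bsub>SL\<^esub> C"
    proof
      fix A :: "real ^ 3 ^ 3" assume "A \<in> carrier SL"
      then have "det A = 1" by (simp add: SL_def)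
      then obtain g c c' where "g \<in> H" "A = c ** g ** c'" "c \<in> C" "c' \<in> C"
        using R[of A] by (auto simp: C_def)
      then show "A \<in> C <#>\<^bsub>SL\<^esub> H <#>\<^bsub>SL\<^esub> C"
        by (auto simp: set_mult_def SL_def)
    qed
  qed
  ultimately show ?thesis
    using H unfolding Cartan_decomposition_subgroup_def by blast
qed

section \<open>Groups with a Lie algebra of traceless matrices\<close>

lemma has_vector_derivative_matrixI:
  fixes F :: "real \<Rightarrow> real ^ 'n ^ 'm"
  assumes "\<And>i j. ((\<lambda>t. F t $ i $ j) has_real_derivative F' $ i $ j) (at t)"
  shows "(F has_vector_derivative F') (at t)"
  by (rule has_vector_derivative_vecI, rule has_vector_derivative_vecI)
    (rule assms[unfolded has_real_derivative_iff_has_vector_derivative])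

lemma matrix_exp_eqI3:
  fixes F :: "real \<Rightarrow> real ^ 3 ^ 3"
  assumes "\<And>t. \<forall>i j. ((\<lambda>t. F t $ i $ j) has_real_derivative (X ** F t) $ i $ j) (at t)" "F 0 = mat 1"
  shows "matrix_exp (t *\<^sub>R X) = F t"
  using matrix_exp_unique[of F X t, OF has_vector_derivative_matrixI] assms by simp

lemma matrix_exp_diag3: "matrix_exp (t *\<^sub>R diag3 a b c) = diag3 (exp (t * a)) (exp (t * b)) (exp (t * c))"
proof (rule matrix_exp_eqI3)
  show "\<forall>i j. ((\<lambda>t. diag3 (exp (t * a)) (exp (t * b)) (exp (t * c)) $ i $ j) has_real_derivative
      (diag3 a b c ** diag3 (exp (t * a)) (exp (t * b)) (exp (t * c))) $ i $ j) (at t)" for t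
    unfolding diag3_mult by (auto simp: forall_3 diag3_def intro!: derivative_eq_intros)
qed (simp add: diag3_1)

lemma matrix_exp_heisenberg:
  "matrix_exp (t *\<^sub>R mat3 0 x z 0 0 y 0 0 0) = mat3 1 (t * x) (t * z + t\<^sup>2 * x * y / 2) 0 1 (t * y) 0 0 1"
proof (rule matrix_exp_eqI3)
  show "\<forall>i j. ((\<lambda>t. mat3 1 (t * x) (t * z + t\<^sup>2 * x * y / 2) 0 1 (t * y) 0 0 1 $ i $ j) has_real_derivative
      (mat3 0 x z 0 0 y 0 0 0 ** mat3 1 (t * x) (t * z + t\<^sup>2 * x * y / 2) 0 1 (t * y) 0 0 1) $ i $ j) (at t)" for t
    unfolding mat3_mult by (auto simp: forall_3 field_simps intro!: derivative_eq_intros)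
qed (simp add: mat3_1)

text \<open>The intended \<open>h\<close> is \<open>lie_algebra H\<close>. The axioms are those of its properties which are
  visibly stable under conjugation and transposition, so that normal forms may be assumed.\<close>

locale lie_pair =
  fixes H h :: "(real ^ 3 ^ 3) set"
  assumes mult_mem: "A \<in> H \<Longrightarrow> B \<in> H \<Longrightarrow> A ** B \<in> H"
    and ex_inverse: "A \<in> H \<Longrightarrow> \<exists>B\<in>H. A ** B = mat 1"
    and det_1: "A \<in> H \<Longrightarrow> det A = 1"
    and exp_mem: "X \<in> h \<Longrightarrow> matrix_exp (t *\<^sub>R X) \<in> H"
    and subspace_h: "subspace h"
    and bracket: "X \<in> h \<Longrightarrow> Y \<in> h \<Longrightarrow> X ** Y - Y ** X \<in> h"
    and Ad: "X \<in> h \<Longrightarrow> A \<in> H \<Longrightarrow> A ** B = mat 1 \<Longrightarrow> A ** X ** B \<in> h"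
    and trace_0: "X \<in> h \<Longrightarrow> trace X = 0"
begin

lemma add_mem: "X \<in> h \<Longrightarrow> Y \<in> h \<Longrightarrow> X + Y \<in> h"
  and diff_mem: "X \<in> h \<Longrightarrow> Y \<in> h \<Longrightarrow> X - Y \<in> h"
  and scale_mem: "X \<in> h \<Longrightarrow> c *\<^sub>R X \<in> h"
  using subspace_h by (auto simp: subspace_add subspace_diff subspace_mul)

end

lemma conj_mult:
  fixes P Q :: "real ^ 'n ^ 'n"
  assumes "Q ** P = mat 1"
  shows "(P ** A ** Q) ** (P ** B ** Q) = P ** (A ** B) ** Q"
proof -
  have "(P ** A ** Q) ** (P ** B ** Q) = P ** A ** (Q ** P) ** B ** Q" by (simp only: matrix_mul_assoc)
  then show ?thesis by (simp add: assms matrix_mul_assoc)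
qed

lemma conj_inverse:
  fixes P Q :: "real ^ 'n ^ 'n"
  assumes "Q ** P = mat 1"
  shows "Q ** (P ** A ** Q) ** P = A"
proof -
  have "Q ** (P ** A ** Q) ** P = (Q ** P) ** A ** (Q ** P)" by (simp only: matrix_mul_assoc)
  then show ?thesis by (simp add: assms)
qed

lemma linear_conj: "linear (\<lambda>A. P ** A ** Q)" for P Q :: "real ^ 'n ^ 'n"
  by (intro linearI) (simp_all add: matrix_mult_algebra)

lemma trace_conj:
  fixes P Q :: "real ^ 'n ^ 'n"
  assumes "Q ** P = mat 1"
  shows "trace (P ** A ** Q) = trace A"
  using trace_mul_sym[of "P ** A" Q] by (simp add: matrix_mul_assoc assms)

lemma det_conj:
  fixes P Q :: "real ^ 'n ^ 'n"
  assumes "Q ** P = mat 1"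
  shows "det (P ** A ** Q) = det A"
proof -
  have "det Q * det P = 1" using assms by (metis det_I det_mul)
  then show ?thesis by (simp add: det_mul mult.commute mult.left_commute)
qed

lemma lie_pair_conj:
  assumes "lie_pair H h" and QP: "Q ** P = mat 1"
  shows "lie_pair ((\<lambda>A. P ** A ** Q) ` H) ((\<lambda>A. P ** A ** Q) ` h)"
proof -
  interpret lie_pair H h by fact
  have PQ: "P ** Q = mat 1" using QP by (simp only: matrix_left_right_inverse)
  show ?thesis
  proof
    fix A B assume "A \<in> (\<lambda>A. P ** A ** Q) ` H" "B \<in> (\<lambda>A. P ** A ** Q) ` H"
    then show "A ** B \<in> (\<lambda>A. P ** A ** Q) ` H"
      by (auto simp: conj_mult[OF QP] intro: mult_mem)
  next
    fix A assume "A \<in> (\<lambda>A. P ** A ** Q) ` H"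
    then obtain A' where A': "A' \<in> H" "A = P ** A' ** Q" by auto
    obtain B where B: "B \<in> H" "A' ** B = mat 1" using ex_inverse[OF A'(1)] by auto
    then have "A ** (P ** B ** Q) = mat 1" by (simp add: A'(2) conj_mult[OF QP] PQ)
    then show "\<exists>B\<in>(\<lambda>A. P ** A ** Q) ` H. A ** B = mat 1"
      using B(1) by blast
  next
    fix A assume "A \<in> (\<lambda>A. P ** A ** Q) ` H"
    then show "det A = 1" by (auto simp: det_conj[OF QP] det_1)
  next
    fix X t assume "X \<in> (\<lambda>A. P ** A ** Q) ` h"
    then show "matrix_exp (t *\<^sub>R X) \<in> (\<lambda>A. P ** A ** Q) ` H"
      by (auto simp: matrix_exp_conj[OF PQ] intro: exp_mem)
  next
    show "subspace ((\<lambda>A. P ** A ** Q) ` h)"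
      by (rule linear_subspace_image[OF linear_conj subspace_h])
  next
    fix X Y assume "X \<in> (\<lambda>A. P ** A ** Q) ` h" "Y \<in> (\<lambda>A. P ** A ** Q) ` h"
    then obtain X' Y' where "X' \<in> h" "Y' \<in> h" "X = P ** X' ** Q" "Y = P ** Y' ** Q" by auto
    then show "X ** Y - Y ** X \<in> (\<lambda>A. P ** A ** Q) ` h"
      using bracket[of X' Y'] by (auto simp: conj_mult[OF QP] matrix_mult_diff_left[symmetric]
          matrix_mult_diff_right[symmetric])
  next
    fix X A B
    assume "X \<in> (\<lambda>A. P ** A ** Q) ` h" "A \<in> (\<lambda>A. P ** A ** Q) ` H" and AB: "A ** B = mat 1"
    then obtain X' A' where XA: "X' \<in> h" "A' \<in> H" "X = P ** X' ** Q" "A = P ** A' ** Q" by auto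
    obtain B' where B': "A' ** B' = mat 1" using ex_inverse[OF XA(2)] by auto
    then have "A ** (P ** B' ** Q) = mat 1" by (simp add: XA conj_mult[OF QP] PQ)
    then have "B = P ** B' ** Q" using AB by (metis matrix_inverse_unique)
    then have "A ** X ** B = P ** (A' ** X' ** B') ** Q" by (simp add: XA conj_mult[OF QP])
    then show "A ** X ** B \<in> (\<lambda>A. P ** A ** Q) ` h"
      using Ad[OF XA(1,2) B'] by auto
  next
    fix X assume "X \<in> (\<lambda>A. P ** A ** Q) ` h"
    then show "trace X = 0" by (auto simp: trace_conj[OF QP] trace_0)
  qed
qed

lemma trace_transpose: "trace (transpose A) = trace A"
  by (simp add: trace_def transpose_def)

lemma lie_pair_transpose:
  assumes "lie_pair H h"
  shows "lie_pair (transpose ` H) (transpose ` h)"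
proof -
  interpret lie_pair H h by fact
  have inv: "B ** A = mat 1" if "A ** B = mat 1" for A B :: "real ^ 3 ^ 3"
    using that by (simp only: matrix_left_right_inverse)
  show ?thesis
  proof
    fix A B assume "A \<in> transpose ` H" "B \<in> transpose ` H"
    then show "A ** B \<in> transpose ` H"
      by (auto simp: matrix_transpose_mul[symmetric] intro: mult_mem)
  next
    fix A assume "A \<in> transpose ` H"
    then obtain A' where A': "A' \<in> H" "A = transpose A'" by auto
    obtain B where "B \<in> H" "A' ** B = mat 1" using ex_inverse[OF A'(1)] by auto
    then have "transpose B \<in> transpose ` H" "A ** transpose B = mat 1"
      using inv[of A' B] by (auto simp: A' matrix_transpose_mul[symmetric])
    then show "\<exists>B\<in>transpose ` H. A ** B = mat 1" by blast
  next
    fix A assume "A \<in> transpose ` H"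
    then show "det A = 1" by (auto simp: det_1)
  next
    fix X t assume "X \<in> transpose ` h"
    then show "matrix_exp (t *\<^sub>R X) \<in> transpose ` H"
      by (auto simp: matrix_exp_transpose intro: exp_mem)
  next
    show "subspace (transpose ` h)"
      by (intro linear_subspace_image subspace_h bounded_linear.linear bounded_linear_transpose)
  next
    fix X Y assume "X \<in> transpose ` h" "Y \<in> transpose ` h"
    then obtain X' Y' where "X' \<in> h" "Y' \<in> h" "X = transpose X'" "Y = transpose Y'" by auto
    then show "X ** Y - Y ** X \<in> transpose ` h"
      using bracket[of Y' X']
      by (auto simp: matrix_transpose_mul[symmetric] linear_diff[OF bounded_linear.linear[OF bounded_linear_transpose], symmetric])
  next
    fix X A B
    assume "X \<in> transpose ` h" "A \<in> transpose ` H" and AB: "A ** B = mat 1"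
    then obtain X' A' where XA: "X' \<in> h" "A' \<in> H" "X = transpose X'" "A = transpose A'" by auto
    obtain B' where B': "B' \<in> H" "A' ** B' = mat 1" using ex_inverse[OF XA(2)] by auto
    have BA: "B' ** A' = mat 1" by (rule inv[OF B'(2)])
    then have "A ** transpose B' = mat 1" by (simp add: XA(4) matrix_transpose_mul[symmetric])
    then have "B = transpose B'" using AB by (metis matrix_inverse_unique)
    then have "A ** X ** B = transpose (B' ** X' ** A')"
      by (simp add: XA matrix_transpose_mul matrix_mul_assoc)
    then show "A ** X ** B \<in> transpose ` h"
      using Ad[OF XA(1) B'(1) BA] by auto
  next
    fix X assume "X \<in> transpose ` h"
    then show "trace X = 0" by (auto simp: trace_transpose trace_0)
  qed
qed

text \<open>Invariant description of the Lie algebras of \<open>SL(2)\<close>, \<open>SO(2,1)\<close> and \<open>SO(2) \<ltimes> \<real>\<^sup>2\<close>: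
  the negative of the trace form has exactly one positive direction.\<close>

definition index_one :: "(real ^ 3 ^ 3) set \<Rightarrow> bool" where
  "index_one h \<longleftrightarrow> dim h \<le> 3 \<and> (\<forall>X\<in>h. det X = 0) \<and> (\<exists>X\<in>h. trace (X ** X) < 0) \<and>
    (\<exists>l f g :: real ^ 3 ^ 3 \<Rightarrow> real. linear l \<and> linear f \<and> linear g \<and>
      (\<forall>X\<in>h. trace (X ** X) = (f X)\<^sup>2 + (g X)\<^sup>2 - (l X)\<^sup>2))"

text \<open>The first alternative is the goal; the other two collect the exceptional algebras, with
  \<open>bounded H\<close> for conjugates of so(3), and are refuted at the end from maximality of
  the compact subgroup.\<close>

definition trichotomy :: "(real ^ 3 ^ 3) set \<Rightarrow> (real ^ 3 ^ 3) set \<Rightarrow> bool" where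
  "trichotomy H h \<longleftrightarrow> fills_chamber H \<or> index_one h \<or> bounded H"

text \<open>The hypothesis on inverses is phrased so as to fit both a homomorphism (conjugation) and
  an antihomomorphism (transposition).\<close>

lemma fills_chamber_image:
  assumes fills: "fills_chamber (\<phi> ` H)" and m: "m > 0"
    and norm: "\<And>A. norm (\<phi> A) \<le> m * norm A" "\<And>A. norm A \<le> m * norm (\<phi> A)"
    and inv: "\<And>A B. \<phi> A ** B = mat 1 \<Longrightarrow> \<exists>B'. A ** B' = mat 1 \<and> B = \<phi> B'"
  shows "fills_chamber H"
proof -
  obtain M where M: "M > 0" and big: "\<And>\<alpha> \<beta>. \<alpha> \<ge> 1 \<Longrightarrow> \<beta> \<ge> 1 \<Longrightarrow> \<alpha> \<le> \<beta>\<^sup>2 \<Longrightarrow> \<beta> \<le> \<alpha>\<^sup>2 \<Longrightarrow>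
     realizes (\<phi> ` H) M \<alpha> \<beta>"
    using fills unfolding fills_chamber_def by blast
  show ?thesis
    unfolding fills_chamber_def
  proof (intro exI[of _ "m * M"] conjI allI impI)
    show "m * M > 0" using m M by simp
    fix \<alpha> \<beta> :: real assume "\<alpha> \<ge> 1" "\<beta> \<ge> 1" "\<alpha> \<le> \<beta>\<^sup>2" "\<beta> \<le> \<alpha>\<^sup>2"
    from big[OF this] obtain g B where g: "g \<in> H" "\<phi> g ** B = mat 1"
      "\<alpha> \<le> M * norm (\<phi> g)" "norm (\<phi> g) \<le> M * \<alpha>" "\<beta> \<le> M * norm B" "norm B \<le> M * \<beta>" by blast
    obtain g' where g': "g ** g' = mat 1" "B = \<phi> g'" using inv[OF g(2)] by blast
    have up: "x \<le> m * M * norm A" if "x \<le> M * norm (\<phi> A)" for x A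
      using order_trans[OF that mult_left_mono[OF norm(1)[of A], of M]] M by (simp add: mult_ac)
    have lo: "norm A \<le> m * M * x" if "norm (\<phi> A) \<le> M * x" for x A
      using order_trans[OF norm(2)[of A] mult_left_mono[OF that, of m]] m by (simp add: mult_ac)
    show "realizes H (m * M) \<alpha> \<beta>"
      using g g' up lo by blast
  qed
qed

lemma norm_transpose: "norm (transpose A) = norm A" for A :: "real ^ 'n ^ 'm"
proof -
  have "(norm A)\<^sup>2 = (\<Sum>i\<in>UNIV. \<Sum>j\<in>UNIV. (A $ i $ j)\<^sup>2)" for A :: "real ^ 'k ^ 'l"
    by (simp add: norm_vec_def L2_set_def sum_nonneg)
  from this[of A] this[of "transpose A"] have "(norm (transpose A))\<^sup>2 = (norm A)\<^sup>2"
    by (simp add: transpose_def sum.swap[of "\<lambda>i j. (A $ j $ i)\<^sup>2"])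
  then show ?thesis by (simp add: power2_eq_iff_nonneg)
qed

lemma index_one_image:
  assumes "index_one (\<phi> ` h)" and "linear \<phi>" "inj \<phi>"
    and "\<And>A. det (\<phi> A) = det A" "\<And>A. trace (\<phi> A ** \<phi> A) = trace (A ** A)"
  shows "index_one h"
proof -
  obtain l f g :: "real ^ 3 ^ 3 \<Rightarrow> real" where "linear l" "linear f" "linear g" and
    tr: "\<forall>X\<in>\<phi> ` h. trace (X ** X) = (f X)\<^sup>2 + (g X)\<^sup>2 - (l X)\<^sup>2"
    using assms(1) unfolding index_one_def by blast
  then have "linear (l \<circ> \<phi>)" "linear (f \<circ> \<phi>)" "linear (g \<circ> \<phi>)"
    using assms(2) by (auto intro: linear_compose)
  moreover have "\<forall>X\<in>h. trace (X ** X) = ((f \<circ> \<phi>) X)\<^sup>2 + ((g \<circ> \<phi>) X)\<^sup>2 - ((l \<circ> \<phi>) X)\<^sup>2"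
    using tr assms(5) by auto
  moreover have "dim (\<phi> ` h) = dim h"
    using assms(2,3) by (intro dim_image_eq) (auto intro: inj_on_subset)
  then have "dim h \<le> 3" "\<forall>X\<in>h. det X = 0" "\<exists>X\<in>h. trace (X ** X) < 0"
    using assms(1,4,5) unfolding index_one_def by simp_all
  ultimately show ?thesis
    unfolding index_one_def by blast
qed

lemma trichotomy_conj:
  assumes QP: "Q ** P = mat 1" and "trichotomy ((\<lambda>A. P ** A ** Q) ` H) ((\<lambda>A. P ** A ** Q) ` h)"
  shows "trichotomy H h"
proof -
  have PQ: "P ** Q = mat 1" using QP by (simp only: matrix_left_right_inverse)
  define m where "m = norm P * norm Q"
  have n: "norm (P ** A ** Q) \<le> m * norm A" "norm (Q ** A ** P) \<le> m * norm A" for A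
  proof -
    have "norm (P ** A ** Q) \<le> norm P * norm A * norm Q" "norm (Q ** A ** P) \<le> norm Q * norm A * norm P"
      by (meson norm_matrix_mult_le order_trans mult_right_mono norm_ge_zero)+
    then show "norm (P ** A ** Q) \<le> m * norm A" "norm (Q ** A ** P) \<le> m * norm A"
      by (simp_all add: m_def mult_ac)
  qed
  have n': "norm A \<le> m * norm (P ** A ** Q)" for A
    using n(2)[of "P ** A ** Q"] by (simp add: conj_inverse[OF QP])
  have "P \<noteq> 0" "Q \<noteq> 0" using QP by (auto simp: mat3_0 mat3_1 mat3_mult mat3_eq_iff intro: mat3_cases[of P] mat3_cases[of Q])
  then have m: "m > 0" by (simp add: m_def)
  consider "fills_chamber ((\<lambda>A. P ** A ** Q) ` H)" | "index_one ((\<lambda>A. P ** A ** Q) ` h)"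
    | "bounded ((\<lambda>A. P ** A ** Q) ` H)" using assms(2) unfolding trichotomy_def by blast
  then show ?thesis
  proof cases
    case 1
    have "fills_chamber H"
    proof (rule fills_chamber_image[OF 1 m n(1) n'])
      fix A B assume "P ** A ** Q ** B = mat 1"
      then have "Q ** (P ** A ** Q ** B) ** P = mat 1" by (simp add: QP)
      then have "A ** (Q ** B ** P) = mat 1"
        using QP by (simp add: matrix_mul_assoc)
      then show "\<exists>B'. A ** B' = mat 1 \<and> B = P ** B' ** Q"
        using conj_inverse[OF PQ, of B] by metis
    qed
    then show ?thesis by (simp add: trichotomy_def)
  next
    case 2
    have "inj (\<lambda>A. P ** A ** Q)" by (rule inj_on_inverseI[where g = "\<lambda>A. Q ** A ** P"]) (simp add: conj_inverse[OF QP])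
    with 2 have "index_one h"
      by (rule index_one_image[OF _ linear_conj])
        (simp_all add: det_conj[OF QP] conj_mult[OF QP] trace_conj[OF QP])
    then show ?thesis by (simp add: trichotomy_def)
  next
    case 3
    then obtain r where r: "\<And>A. A \<in> H \<Longrightarrow> norm (P ** A ** Q) \<le> r" by (auto simp: bounded_iff)
    have "norm A \<le> m * r" if "A \<in> H" for A
      using n'[of A] mult_left_mono[OF r[OF that], of m] m by linarith
    then show ?thesis unfolding trichotomy_def bounded_iff by blast
  qed
qed

lemma trichotomy_transpose:
  assumes "trichotomy (transpose ` H) (transpose ` h)"
  shows "trichotomy H h"
proof -
  consider "fills_chamber (transpose ` H)" | "index_one (transpose ` h)" | "bounded (transpose ` H)"
    using assms(1) unfolding trichotomy_def by blast
  then show ?thesis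
  proof cases
    case 1
    have "fills_chamber H"
    proof (rule fills_chamber_image[OF 1 zero_less_one])
      fix A B :: "real ^ 3 ^ 3" assume "transpose A ** B = mat 1"
      then have "B ** transpose A = mat 1" by (simp only: matrix_left_right_inverse)
      then have "transpose (B ** transpose A) = mat 1" by simp
      then show "\<exists>B'. A ** B' = mat 1 \<and> B = transpose B'"
        by (intro exI[of _ "transpose B"]) (simp add: matrix_transpose_mul)
    qed (simp_all add: norm_transpose)
    then show ?thesis by (simp add: trichotomy_def)
  next
    case 2
    have "inj (transpose :: real ^ 3 ^ 3 \<Rightarrow> _)" by (rule injI) simp
    with 2 have "index_one h"
      by (rule index_one_image[OF _ bounded_linear.linear[OF bounded_linear_transpose]])
        (simp_all add: matrix_transpose_mul[symmetric] trace_transpose)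
    then show ?thesis by (simp add: trichotomy_def)
  next
    case 3
    then show ?thesis by (simp add: trichotomy_def bounded_iff norm_transpose)
  qed
qed

lemma dim_conj_image:
  fixes P Q :: "real ^ 'n ^ 'n"
  assumes "Q ** P = mat 1"
  shows "dim ((\<lambda>A. P ** A ** Q) ` h) = dim h"
proof (rule dim_image_eq[OF linear_conj])
  show "inj_on (\<lambda>A. P ** A ** Q) (span h)"
    by (rule inj_on_inverseI[where g = "\<lambda>A. Q ** A ** P"]) (simp add: conj_inverse[OF assms])
qed

lemma dim_transpose_image: "dim (transpose ` h) = dim h" for h :: "(real ^ 'n ^ 'm) set"
  by (rule dim_image_eq[OF bounded_linear.linear[OF bounded_linear_transpose]]) (auto intro: inj_onI)

section \<open>Subgroups filling the Weyl chamber\<close>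

lemma exp_ode:
  fixes f :: "real \<Rightarrow> real"
  assumes "\<And>t. (f has_real_derivative c * f t) (at t)"
  shows "f t = f 0 * exp (c * t)"
proof -
  have "((\<lambda>t. f t * exp (- c * t)) has_real_derivative 0) (at t)" for t
    by (auto intro!: derivative_eq_intros assms)
  then have "f t * exp (- c * t) = f 0 * exp (- c * 0)"
    by (intro DERIV_isconst_all) blast
  then show ?thesis by (simp add: exp_minus field_simps)
qed

lemma mat3_inverse_parabolic:
  assumes "a * d - b * c = D" "D \<noteq> 0"
  shows "mat3 a b x c d y 0 0 (1 / D) ** mat3 (d / D) (- b / D) (b * y - d * x) (- c / D) (a / D) (c * x - a * y) 0 0 D = mat 1"
  using assms unfolding mat3_mult mat3_1 mat3_eq_iff by (auto simp: field_simps) algebra+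

text \<open>With \<rho> = \<beta> / \<alpha> \<le> \<alpha>, the block has size about \<rho>, so the
  corner of length \<alpha> dominates the matrix. The corner of the inverse is the adjugate block
  applied to it, and \<open>xy\<close> selects an axis stretched by at least \<rho>, giving size
  \<rho> \<alpha> = \<beta>. The constant 20 is generous.\<close>

lemma parabolic_norm_bounds:
  assumes F: "a\<^sup>2 + b\<^sup>2 + c\<^sup>2 + d\<^sup>2 = 2 * (\<beta> / \<alpha>)\<^sup>2" and D: "a * d - b * c = D" "D \<ge> 1"
    and \<alpha>: "1 \<le> \<alpha>" "\<alpha> \<le> \<beta>" "\<beta> \<le> \<alpha>\<^sup>2"
    and xy: "(x = \<alpha> \<and> y = 0 \<and> c\<^sup>2 + d\<^sup>2 \<ge> (\<beta> / \<alpha>)\<^sup>2) \<or> (x = 0 \<and> y = \<alpha> \<and> a\<^sup>2 + b\<^sup>2 \<ge> (\<beta> / \<alpha>)\<^sup>2)"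
  shows "\<alpha> \<le> 20 * norm (mat3 a b x c d y 0 0 (1 / D))" "norm (mat3 a b x c d y 0 0 (1 / D)) \<le> 20 * \<alpha>"
    "\<beta> \<le> 20 * norm (mat3 (d / D) (- b / D) (b * y - d * x) (- c / D) (a / D) (c * x - a * y) 0 0 D)"
    "norm (mat3 (d / D) (- b / D) (b * y - d * x) (- c / D) (a / D) (c * x - a * y) 0 0 D) \<le> 20 * \<beta>"
proof -
  define \<rho> where "\<rho> = \<beta> / \<alpha>"
  have \<rho>: "\<rho> \<ge> 1" "\<rho> \<le> \<alpha>" "\<rho> * \<alpha> = \<beta>" "\<rho> \<le> \<beta>" "\<rho>\<^sup>2 \<le> \<beta>"
  proof -
    show 1: "\<rho> \<ge> 1" using \<alpha> by (simp add: \<rho>_def)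
    show 2: "\<rho> \<le> \<alpha>" using \<alpha> by (simp add: \<rho>_def field_simps power2_eq_square)
    show 3: "\<rho> * \<alpha> = \<beta>" using \<alpha> by (simp add: \<rho>_def)
    show "\<rho> \<le> \<beta>" using 1 \<alpha> mult_left_mono[of 1 \<alpha> \<rho>] by (simp add: 3)
    show "\<rho>\<^sup>2 \<le> \<beta>" using mult_left_mono[OF 2, of \<rho>] 1 by (simp add: 3 power2_eq_square)
  qed
  have ent: "\<bar>z\<bar> \<le> 2 * \<rho>" if "z\<^sup>2 \<le> 2 * \<rho>\<^sup>2" for z
  proof -
    have "z\<^sup>2 \<le> (2 * \<rho>)\<^sup>2" using that by (simp add: power_mult_distrib) (use zero_le_power2[of \<rho>] in linarith)
    then show ?thesis using \<rho>(1) abs_le_square_iff[of z "2 * \<rho>"] by simp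
  qed
  have abcd: "\<bar>a\<bar> \<le> 2 * \<rho>" "\<bar>b\<bar> \<le> 2 * \<rho>" "\<bar>c\<bar> \<le> 2 * \<rho>" "\<bar>d\<bar> \<le> 2 * \<rho>"
    using F by (auto intro!: ent simp: \<rho>_def[symmetric]) (smt (verit) zero_le_power2)+
  \<comment> \<open>Twice the determinant is at most the squared Frobenius norm, whence D \<le>
    \<rho>^2 \<le> \<beta>: the last entry of the inverse does no harm.\<close>
  have "2 * D \<le> a\<^sup>2 + b\<^sup>2 + c\<^sup>2 + d\<^sup>2"
    using D(1) zero_le_power2[of "a - d"] zero_le_power2[of "b + c"] by (simp add: power2_eq_square algebra_simps)
  then have D2: "D \<le> \<rho>\<^sup>2" using F by (simp add: \<rho>_def)
  have quot: "\<bar>z / D\<bar> \<le> 2 * \<rho>" if "\<bar>z\<bar> \<le> 2 * \<rho>" for z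
    using that D(2) \<rho>(1) by (auto simp: abs_divide divide_le_eq intro: order_trans mult_left_mono[of 1 D "2 * \<rho>", simplified])
  have inv: "\<bar>1 / D\<bar> \<le> 1" using D(2) by simp
  have xy': "\<bar>x\<bar> + \<bar>y\<bar> \<le> \<alpha>" using xy \<alpha> by auto
  show "\<alpha> \<le> 20 * norm (mat3 a b x c d y 0 0 (1 / D))"
    using xy matrix_nth_le_norm[of "mat3 a b x c d y 0 0 (1 / D)" 1 3]
      matrix_nth_le_norm[of "mat3 a b x c d y 0 0 (1 / D)" 2 3] \<alpha> by auto
  show "norm (mat3 a b x c d y 0 0 (1 / D)) \<le> 20 * \<alpha>"
    using norm_mat3_le[of a b x c d y 0 0 "1 / D"] abcd inv \<rho> xy' \<alpha> by linarith
  let ?B = "mat3 (d / D) (- b / D) (b * y - d * x) (- c / D) (a / D) (c * x - a * y) 0 0 D"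
  have cor: "\<bar>b * y - d * x\<bar> \<le> 2 * \<beta>" "\<bar>c * x - a * y\<bar> \<le> 2 * \<beta>"
    using xy abcd[THEN mult_right_mono, of \<alpha>] \<alpha> \<rho>(3) by (auto simp: abs_mult mult.assoc)
  have q: "\<bar>d / D\<bar> \<le> 2 * \<rho>" "\<bar>- b / D\<bar> \<le> 2 * \<rho>" "\<bar>- c / D\<bar> \<le> 2 * \<rho>" "\<bar>a / D\<bar> \<le> 2 * \<rho>"
    using abcd by (auto intro!: quot simp del: abs_divide)
  have "\<bar>D\<bar> \<le> \<beta>" using D2 D(2) \<rho>(5) by linarith
  then show "norm ?B \<le> 20 * \<beta>"
    using norm_mat3_le[of "d / D" "- b / D" "b * y - d * x" "- c / D" "a / D" "c * x - a * y" 0 0 D] cor q \<rho>(4) \<alpha>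
    by linarith
  have big: "\<beta> \<le> 2 * max (\<bar>u\<bar> * \<alpha>) (\<bar>w\<bar> * \<alpha>)" if "u\<^sup>2 + w\<^sup>2 \<ge> \<rho>\<^sup>2" for u w
  proof (rule ccontr)
    assume "\<not> ?thesis"
    then have "2 * \<bar>u\<bar> * \<alpha> < \<rho> * \<alpha>" "2 * \<bar>w\<bar> * \<alpha> < \<rho> * \<alpha>" using \<rho>(3) by auto
    then have "2 * \<bar>u\<bar> < \<rho>" "2 * \<bar>w\<bar> < \<rho>" using \<alpha>(1) by auto
    then have "(2 * \<bar>u\<bar>)\<^sup>2 < \<rho>\<^sup>2" "(2 * \<bar>w\<bar>)\<^sup>2 < \<rho>\<^sup>2"
      using power_strict_mono[of "2 * \<bar>u\<bar>" \<rho> 2] power_strict_mono[of "2 * \<bar>w\<bar>" \<rho> 2] by simp_all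
    moreover have "(2 * \<bar>u\<bar>)\<^sup>2 = 4 * u\<^sup>2" "(2 * \<bar>w\<bar>)\<^sup>2 = 4 * w\<^sup>2"
      by (simp_all add: power_mult_distrib)
    ultimately show False using that zero_le_power2[of u] by linarith
  qed
  have "\<beta> \<le> 2 * max \<bar>b * y - d * x\<bar> \<bar>c * x - a * y\<bar>"
    using xy big[of d c] big[of b a] \<alpha> by (auto simp: abs_mult \<rho>_def[symmetric] add.commute)
  moreover have "max \<bar>b * y - d * x\<bar> \<bar>c * x - a * y\<bar> \<le> norm ?B"
    using matrix_nth_le_norm[of ?B 1 3] matrix_nth_le_norm[of ?B 2 3] by simp
  moreover have "\<beta> \<le> 20 * n" if "\<beta> \<le> 2 * u" "u \<le> n" "0 \<le> n" for u n
    using that by linarith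
  ultimately show "\<beta> \<le> 20 * norm ?B"
    using norm_ge_zero by blast
qed

context lie_pair
begin

lemma inverse_mem:
  assumes "A \<in> H" "A ** B = mat 1"
  shows "B \<in> H"
  using ex_inverse[OF assms(1)] matrix_inverse_unique[OF assms(2)] by blast

text \<open>Inverting a group element exchanges the roles of \<alpha> and \<beta>.\<close>

lemma fills_chamberI_half:
  assumes M: "M > 0" and half: "\<And>\<alpha> \<beta>. 1 \<le> \<alpha> \<Longrightarrow> \<alpha> \<le> \<beta> \<Longrightarrow> \<beta> \<le> \<alpha>\<^sup>2 \<Longrightarrow>
     realizes H M \<alpha> \<beta>"
  shows "fills_chamber H"
  unfolding fills_chamber_def
proof (intro exI[of _ M] conjI M allI impI)
  fix \<alpha> \<beta> :: real assume ab: "\<alpha> \<ge> 1" "\<beta> \<ge> 1" "\<alpha> \<le> \<beta>\<^sup>2" "\<beta> \<le> \<alpha>\<^sup>2"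
  show "realizes H M \<alpha> \<beta>"
  proof (cases "\<alpha> \<le> \<beta>")
    case True
    then show ?thesis using ab half by blast
  next
    case False
    then obtain g g' where g: "g \<in> H" "g ** g' = mat 1" "\<beta> \<le> M * norm g" "norm g \<le> M * \<beta>"
      "\<alpha> \<le> M * norm g'" "norm g' \<le> M * \<alpha>"
      using half[of \<beta> \<alpha>] ab by auto
    have "g' ** g = mat 1" using g(2) by (simp only: matrix_left_right_inverse)
    then show ?thesis using g inverse_mem[OF g(1,2)] by blast
  qed
qed

lemma fills_chamber_diagonal:
  assumes "diag3 1 0 (- 1) \<in> h" "diag3 1 (- 2) 1 \<in> h"
  shows "fills_chamber H"
proof (rule fills_chamberI_half[of 3])
  fix \<alpha> \<beta> :: real assume ab: "1 \<le> \<alpha>" "\<alpha> \<le> \<beta>" "\<beta> \<le> \<alpha>\<^sup>2"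
  \<comment> \<open>Logarithms of the outer entries of the target diag(\<alpha>, \<beta>/\<alpha>,
    1/\<beta>); its middle entry lies between them because 1 \<le> \<beta>/\<alpha> \<le>
    \<alpha>.\<close>
  define x z where "x = ln \<alpha>" and "z = - ln \<beta>"
  have "diag3 x (- x - z) z = ((x - z) / 2) *\<^sub>R diag3 1 0 (- 1) + ((x + z) / 2) *\<^sub>R diag3 1 (- 2) 1"
    by (simp add: diag3_def mat3_simps field_simps)
  then have "diag3 x (- x - z) z \<in> h" by (simp add: add_mem scale_mem assms)
  from exp_mem[OF this, of 1] have "diag3 (exp x) (exp (- x - z)) (exp z) \<in> H"
    by (simp add: matrix_exp_diag3[of 1, simplified])
  moreover have "exp x = \<alpha>" "exp (- x - z) = \<beta> / \<alpha>" "exp z = 1 / \<beta>"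
    using ab by (simp_all add: x_def z_def exp_diff exp_minus divide_inverse)
  ultimately have H: "diag3 \<alpha> (\<beta> / \<alpha>) (1 / \<beta>) \<in> H" by simp
  have "diag3 \<alpha> (\<beta> / \<alpha>) (1 / \<beta>) ** diag3 (1 / \<alpha>) (\<alpha> / \<beta>) \<beta> = mat 1"
    using ab by (simp add: diag3_mult diag3_1)
  moreover have "\<beta> / \<alpha> \<le> \<alpha>" "1 / \<beta> \<le> 1" "1 / \<alpha> \<le> 1" "\<alpha> / \<beta> \<le> 1"
    using ab by (auto simp: field_simps power2_eq_square)
  moreover have "\<beta> / \<alpha> \<ge> 0" "1 / \<beta> \<ge> 0" "1 / \<alpha> \<ge> 0" "\<alpha> / \<beta> \<ge> 0" using ab by auto
  ultimately show "realizes H 3 \<alpha> \<beta>"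
    using H norm_diag3_le[of \<alpha> "\<beta> / \<alpha>" "1 / \<beta>"] norm_diag3_ge(1)[of \<alpha> "\<beta> / \<alpha>" "1 / \<beta>"]
      norm_diag3_le[of "1 / \<alpha>" "\<alpha> / \<beta>" \<beta>] norm_diag3_ge(2)[where a = "1 / \<alpha>" and b = "\<alpha> / \<beta>" and c = \<beta>] ab
    by (intro bexI[OF _ H] exI[of _ "diag3 (1 / \<alpha>) (\<alpha> / \<beta>) \<beta>"]) linarith
qed simp

text \<open>A unipotent matrix with superdiagonal u, v and corner w has an inverse with corner u v -
  w. Choosing x with x^2 b f = \<sigma> (\<alpha> + \<beta>) makes the corners \<sigma> \<alpha> and
  \<sigma> \<beta> possible at once, while the superdiagonal grows only like the square root of
  \<alpha> + \<beta>.\<close>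

lemma fills_chamber_regular_nilpotent:
  assumes N: "mat3 0 b 0 0 0 f 0 0 0 \<in> h" "E13 \<in> h" and bf: "b \<noteq> 0" "f \<noteq> 0"
  shows "fills_chamber H"
proof -
  define r where "r = sqrt \<bar>b * f\<bar>"
  have r: "r > 0" "r\<^sup>2 = \<bar>b * f\<bar>" using bf by (simp_all add: r_def)
  define k where "k = 2 * (\<bar>b\<bar> + \<bar>f\<bar>) / r"
  have k: "k > 0" using bf r by (simp add: k_def)
  show ?thesis
  proof (rule fills_chamberI_half[of "4 + k"])
    show "4 + k > 0" using k by simp
    fix \<alpha> \<beta> :: real assume ab: "1 \<le> \<alpha>" "\<alpha> \<le> \<beta>" "\<beta> \<le> \<alpha>\<^sup>2"
    define x where "x = sqrt (\<alpha> + \<beta>) / r"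
    define \<sigma> where "\<sigma> = sgn (b * f)"
    have \<sigma>: "\<bar>\<sigma>\<bar> = 1" "\<bar>b * f\<bar> = \<sigma> * (b * f)" "\<sigma> * \<sigma> = 1" using bf by (auto simp: \<sigma>_def sgn_if abs_if)
    have x: "x\<^sup>2 * b * f = \<sigma> * (\<alpha> + \<beta>)"
    proof -
      have "x\<^sup>2 = (\<alpha> + \<beta>) / \<bar>b * f\<bar>" using ab by (simp add: x_def power_divide r(2))
      moreover have "b * f = \<sigma> * \<bar>b * f\<bar>" using \<sigma> by (metis mult.assoc mult_1)
      ultimately have "x\<^sup>2 * b * f = (\<alpha> + \<beta>) / \<bar>b * f\<bar> * (\<sigma> * \<bar>b * f\<bar>)"
        by (metis mult.assoc)
      then show ?thesis using bf by simp
    qed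
    have sq: "sqrt (\<alpha> + \<beta>) \<le> 2 * \<alpha>" "sqrt (\<alpha> + \<beta>) \<le> 2 * \<beta>" "sqrt (\<alpha> + \<beta>) \<ge> 0"
    proof -
      have "\<alpha> \<le> \<alpha>\<^sup>2" "\<beta> \<le> \<beta>\<^sup>2" using ab by (auto simp: power2_eq_square)
      then show "sqrt (\<alpha> + \<beta>) \<le> 2 * \<alpha>" "sqrt (\<alpha> + \<beta>) \<le> 2 * \<beta>" "sqrt (\<alpha> + \<beta>) \<ge> 0"
        using ab by (auto intro!: real_le_lsqrt simp: power_mult_distrib)
    qed
    have xbf: "\<bar>x * b\<bar> + \<bar>x * f\<bar> \<le> k * y" if "sqrt (\<alpha> + \<beta>) \<le> 2 * y" for y
    proof -
      have "\<bar>x * b\<bar> + \<bar>x * f\<bar> = sqrt (\<alpha> + \<beta>) * ((\<bar>b\<bar> + \<bar>f\<bar>) / r)"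
        using r sq(3) by (simp add: x_def abs_mult distrib_left add_divide_distrib)
      also have "\<dots> \<le> 2 * y * ((\<bar>b\<bar> + \<bar>f\<bar>) / r)"
        using that r by (intro mult_right_mono) auto
      also have "\<dots> = k * y" by (simp add: k_def)
      finally show ?thesis .
    qed
    \<comment> \<open>Subtracts the quadratic term of the exponential, so that the corner becomes
      exactly \<sigma> \<alpha>.\<close>
    define z where "z = \<sigma> * \<alpha> - x\<^sup>2 * b * f / 2"
    have "mat3 0 (x * b) z 0 0 (x * f) 0 0 0 = x *\<^sub>R mat3 0 b 0 0 0 f 0 0 0 + z *\<^sub>R E13"
      by (simp add: mat3_simps)
    then have "mat3 0 (x * b) z 0 0 (x * f) 0 0 0 \<in> h" by (simp add: add_mem scale_mem N)
    from exp_mem[OF this, of 1] have H: "mat3 1 (x * b) (\<sigma> * \<alpha>) 0 1 (x * f) 0 0 1 \<in> H"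
      by (simp add: matrix_exp_heisenberg[of 1, simplified] z_def power2_eq_square mult_ac)
    have "x * b * (x * f) = \<sigma> * \<alpha> + \<sigma> * \<beta>" using x by (simp add: power2_eq_square algebra_simps)
    then have inv: "mat3 1 (x * b) (\<sigma> * \<alpha>) 0 1 (x * f) 0 0 1 ** mat3 1 (- x * b) (\<sigma> * \<beta>) 0 1 (- x * f) 0 0 1 = mat 1"
      by (simp add: mat3_1 mat3_simps)
    have n: "y \<le> (4 + k) * norm (mat3 1 u (\<sigma> * y) 0 1 v 0 0 1)" "norm (mat3 1 u (\<sigma> * y) 0 1 v 0 0 1) \<le> (4 + k) * y"
      if "y \<ge> 1" "\<bar>u\<bar> + \<bar>v\<bar> \<le> k * y" for u v y
    proof -
      let ?A = "mat3 1 u (\<sigma> * y) 0 1 v 0 0 1"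
      have y: "\<bar>\<sigma> * y\<bar> = y" using \<sigma>(1) that by (simp add: abs_mult)
      have "y \<le> norm ?A" using matrix_nth_le_norm[of ?A 1 3] y by simp
      also have "\<dots> \<le> (4 + k) * norm ?A" using k mult_right_mono[of 1 "4 + k" "norm ?A"] by simp
      finally show "y \<le> (4 + k) * norm ?A" .
      show "norm ?A \<le> (4 + k) * y"
        using norm_mat3_le[of 1 u "\<sigma> * y" 0 1 v 0 0 1] y that by (simp add: distrib_right)
    qed
    show "realizes H (4 + k) \<alpha> \<beta>"
      using n[of \<alpha> "x * b" "x * f"] n[of \<beta> "- x * b" "- x * f"] xbf[OF sq(1)] xbf[OF sq(2)] ab
      by (intro bexI[OF _ H] exI[of _ "mat3 1 (- x * b) (\<sigma> * \<beta>) 0 1 (- x * f) 0 0 1"] conjI inv) auto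
  qed
qed

text \<open>Let \<open>B\<close> be the upper left block of \<open>exp (t X)\<close>. The upper right corner \<open>v\<close> of elements of \<open>H\<close> with
  this block is arbitrary, and the corner of the inverse is \<open>- adj B v\<close>. For \<open>\<alpha> \<le> \<beta>\<close> choose \<open>t\<close> such that
  the norm of \<open>B\<close> is about \<open>\<beta> / \<alpha>\<close>, and \<open>v\<close> of length \<open>\<alpha>\<close> in a direction expanded by \<open>adj B\<close>.\<close>

lemma fills_chamber_parabolic:
  assumes U: "E13 \<in> h" "E23 \<in> h"
    and X: "X \<in> h" "X $ 3 $ 1 = 0" "X $ 3 $ 2 = 0"
    and cond: "X $ 3 $ 3 < 0 \<or>
      X $ 3 $ 3 = 0 \<and> X $ 1 $ 1 * X $ 2 $ 2 \<le> X $ 1 $ 2 * X $ 2 $ 1 \<and> (X $ 1 $ 1 \<noteq> 0 \<or> X $ 1 $ 2 \<noteq> 0 \<or> X $ 2 $ 1 \<noteq> 0)"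
  shows "fills_chamber H"
proof -
  define p q r s u v where "p = X $ 1 $ 1" and "q = X $ 1 $ 2" and "r = X $ 1 $ 3"
    and "s = X $ 2 $ 1" and "u = X $ 2 $ 2" and "v = X $ 2 $ 3"
  define \<tau> where "\<tau> = - X $ 3 $ 3"
  have X_eq: "X = mat3 p q r s u v 0 0 (- \<tau>)"
    using mat3_eta[of X] X(2,3) by (simp add: p_def q_def r_def s_def u_def v_def \<tau>_def)
  have tr: "p + u = \<tau>" using trace_0[OF X(1)] by (simp add: X_eq mat3_trace)
  define E where "E t = matrix_exp (t *\<^sub>R X)" for t
  have E0: "E 0 = mat 1" by (simp add: E_def)
  have dE: "((\<lambda>t. E t $ i $ j) has_real_derivative (X ** E t) $ i $ j) (at t)" for i j t
    unfolding E_def by (rule matrix_exp_nth_deriv)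
  have row3: "E t $ 3 $ j = E 0 $ 3 $ j * exp (- \<tau> * t)" for j t
  proof (rule exp_ode)
    show "((\<lambda>t. E t $ 3 $ j) has_real_derivative - \<tau> * E t $ 3 $ j) (at t)" for t
      using dE[of 3 j t] by (simp add: matrix_matrix_mult_def sum_3 X_eq)
  qed
  have E3: "E t $ 3 $ 1 = 0" "E t $ 3 $ 2 = 0" "E t $ 3 $ 3 = exp (- \<tau> * t)" for t
    using row3[of t 1] row3[of t 2] row3[of t 3] by (simp_all add: E0 mat3_1)
  define D where "D t = E t $ 1 $ 1 * E t $ 2 $ 2 - E t $ 1 $ 2 * E t $ 2 $ 1" for t
  have D: "D t = exp (\<tau> * t)" for t
  proof -
    have "det (E t) = 1" unfolding E_def by (intro det_1 exp_mem X)
    then have "D t * exp (- \<tau> * t) = 1" by (simp add: det_3 E3 D_def algebra_simps)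
    then show ?thesis by (simp add: exp_minus field_simps)
  qed
  define F where "F t = (E t $ 1 $ 1)\<^sup>2 + (E t $ 1 $ 2)\<^sup>2 + (E t $ 2 $ 1)\<^sup>2 + (E t $ 2 $ 2)\<^sup>2" for t
  have F0: "F 0 = 2" by (simp add: F_def E0 mat3_1)
  have contF: "isCont F t" for t
    unfolding F_def by (intro continuous_intros DERIV_isCont[OF dE])
  \<comment> \<open>The block is unbounded along the one-parameter group: its determinant grows, or
    it has a positive eigenvalue, or it is nonzero nilpotent and grows linearly.\<close>
  have unb: "\<exists>t\<ge>0. F t \<ge> y" if y: "y \<ge> 0" for y
  proof -
    consider (pos) "\<tau> > 0" | (hyp) "\<tau> = 0" "q * s - p * u > 0" | (nil) "\<tau> = 0" "p * u = q * s" "p \<noteq> 0 \<or> q \<noteq> 0 \<or> s \<noteq> 0"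
      using cond unfolding p_def q_def s_def u_def \<tau>_def by fastforce
    then show ?thesis
    proof cases
      case pos
      have "y \<le> exp y" using exp_ge_add_one_self[of y] by linarith
      also have "\<dots> = D (y / \<tau>)" using pos by (simp add: D)
      also have "\<dots> \<le> F (y / \<tau>)"
        unfolding D_def F_def
        using zero_le_power2[of "E (y / \<tau>) $ 1 $ 1 - E (y / \<tau>) $ 2 $ 2"] zero_le_power2[of "E (y / \<tau>) $ 1 $ 2 + E (y / \<tau>) $ 2 $ 1"]
          zero_le_power2[of "E (y / \<tau>) $ 1 $ 1"] zero_le_power2[of "E (y / \<tau>) $ 1 $ 2"]
          zero_le_power2[of "E (y / \<tau>) $ 2 $ 1"] zero_le_power2[of "E (y / \<tau>) $ 2 $ 2"]
        unfolding power2_diff power2_sum by linarith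
      finally show ?thesis using pos y by (intro exI[of _ "y / \<tau>"]) simp
    next
      case hyp
      define l where "l = sqrt (q * s - p * u)"
      have l: "l > 0" "l\<^sup>2 = q * s - p * u" using hyp by (simp_all add: l_def)
      have u: "u = - p" using tr hyp by simp
      have l2: "l * l = p * p + q * s" using l(2) by (simp add: u power2_eq_square)
      \<comment> \<open>An eigenvector of the block for the eigenvalue l. The usual choice (q, l -
        p) vanishes only if q = 0 and l = p, and then (l + p, s) works.\<close>
      obtain w1 w2 where w: "w1 \<noteq> 0 \<or> w2 \<noteq> 0" "p * w1 + q * w2 = l * w1" "s * w1 + u * w2 = l * w2"
      proof (cases "q = 0 \<and> l = p")
        case True
        show ?thesis
          by (rule that[of "l + p" s]) (use True l in \<open>auto simp: u algebra_simps\<close>)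
      next
        case False
        show ?thesis
          by (rule that[of q "l - p"]) (use False l2 in \<open>auto simp: u algebra_simps\<close>)
      qed
      \<comment> \<open>The zero third row hides the last column of \<open>X\<close>, so only the
        block acts.\<close>
      define W where "W = mat3 w1 0 0 w2 0 0 0 0 0"
      have XW: "X ** W = l *\<^sub>R W" using w by (simp add: X_eq W_def mat3_simps)
      have "((\<lambda>t. exp (l * t) *\<^sub>R W) has_vector_derivative X ** (exp (l * t) *\<^sub>R W)) (at t)" for t
        unfolding matrix_mult_scaleR_right XW by (auto intro!: derivative_eq_intros)
      from matrix_exp_unique[OF this] have EW: "exp (l * t) *\<^sub>R W = E t ** W" for t
        by (simp add: E_def)
      define t where "t = y / (2 * l)"
      have "exp (l * t) * w1 = E t $ 1 $ 1 * w1 + E t $ 1 $ 2 * w2" "exp (l * t) * w2 = E t $ 2 $ 1 * w1 + E t $ 2 $ 2 * w2"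
        using arg_cong[OF EW[of t], of "\<lambda>A. A $ 1 $ 1"] arg_cong[OF EW[of t], of "\<lambda>A. A $ 2 $ 1"]
        by (simp_all add: W_def matrix_matrix_mult_def sum_3)
      moreover have cs: "(a * w1 + b * w2)\<^sup>2 \<le> (a\<^sup>2 + b\<^sup>2) * (w1\<^sup>2 + w2\<^sup>2)" for a b
        using zero_le_power2[of "a * w2 - b * w1"] by (simp add: power2_eq_square algebra_simps)
      ultimately have "(exp (l * t) * w1)\<^sup>2 + (exp (l * t) * w2)\<^sup>2 \<le> F t * (w1\<^sup>2 + w2\<^sup>2)"
        using cs[of "E t $ 1 $ 1" "E t $ 1 $ 2"] cs[of "E t $ 2 $ 1" "E t $ 2 $ 2"]
        by (simp add: F_def algebra_simps)
      then have "(exp (l * t))\<^sup>2 * (w1\<^sup>2 + w2\<^sup>2) \<le> F t * (w1\<^sup>2 + w2\<^sup>2)" by (simp add: algebra_simps power_mult_distrib)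
      moreover have "w1\<^sup>2 + w2\<^sup>2 > 0" using w(1) by (simp add: sum_power2_gt_zero_iff)
      ultimately have "(exp (l * t))\<^sup>2 \<le> F t" by simp
      moreover have "(exp (l * t))\<^sup>2 = exp y" using l by (simp add: t_def exp_double[symmetric])
      ultimately have "y \<le> F t" using exp_ge_add_one_self[of y] by linarith
      moreover have "t \<ge> 0" using l y by (simp add: t_def)
      ultimately show ?thesis by blast
    next
      case nil
      have u: "u = - p" using tr nil by simp
      define W where "W = diag3 1 1 0"
      \<comment> \<open>The block is traceless of determinant zero, hence has square zero by
        Cayley-Hamilton.\<close>
      have XXW: "X ** (X ** W) = 0"
        using nil(2) by (simp add: X_eq W_def diag3_def mat3_simps mat3_0 u nil(1) algebra_simps)
      have "((\<lambda>t. W + t *\<^sub>R (X ** W)) has_vector_derivative X ** (W + t *\<^sub>R (X ** W))) (at t)" for t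
        unfolding matrix_mult_scaleR_right matrix_mult_add_right XXW by (auto intro!: derivative_eq_intros)
      from matrix_exp_unique[OF this] have EW: "W + t *\<^sub>R (X ** W) = E t ** W" for t
        by (simp add: E_def)
      have EE: "E t $ 1 $ 1 = 1 + t * p" "E t $ 1 $ 2 = t * q" "E t $ 2 $ 1 = t * s" "E t $ 2 $ 2 = 1 - t * p" for t
        using arg_cong[OF EW[of t], of "\<lambda>A. A $ 1 $ 1"] arg_cong[OF EW[of t], of "\<lambda>A. A $ 1 $ 2"]
          arg_cong[OF EW[of t], of "\<lambda>A. A $ 2 $ 1"] arg_cong[OF EW[of t], of "\<lambda>A. A $ 2 $ 2"]
        by (simp_all add: W_def X_eq diag3_def mat3_mult matrix_matrix_mult_def[of "E t"] sum_3 u)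
      have F: "F t = 2 + t\<^sup>2 * (2 * p\<^sup>2 + q\<^sup>2 + s\<^sup>2)" for t
        unfolding F_def EE by (simp add: power2_eq_square algebra_simps)
      define n where "n = 2 * p\<^sup>2 + q\<^sup>2 + s\<^sup>2"
      have n: "n > 0" using nil(3) by (auto simp: n_def add_pos_nonneg add_nonneg_pos)
      have "F (sqrt (y / n)) = 2 + y" using n y by (simp add: F n_def[symmetric])
      then show ?thesis using n y by (intro exI[of _ "sqrt (y / n)"]) simp
    qed
  qed
  have mem: "mat3 (E t $ 1 $ 1) (E t $ 1 $ 2) x (E t $ 2 $ 1) (E t $ 2 $ 2) y 0 0 (1 / D t) \<in> H" for t x y
  proof -
    \<comment> \<open>Left multiplication by the unipotent adds v times the entry 1 / D t of
      \<open>E t\<close> to its corner.\<close>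
    define v1 v2 where "v1 = D t * (x - E t $ 1 $ 3)" and "v2 = D t * (y - E t $ 2 $ 3)"
    have "mat3 0 0 v1 0 0 v2 0 0 0 = v1 *\<^sub>R E13 + v2 *\<^sub>R E23"
      by (simp add: mat3_simps)
    then have "mat3 0 0 v1 0 0 v2 0 0 0 \<in> h" by (simp add: add_mem scale_mem U)
    from exp_mem[OF this, of 1] have "mat3 1 0 v1 0 1 v2 0 0 1 \<in> H"
      using matrix_exp_heisenberg[of 1 0 v1 v2] by simp
    then have "mat3 1 0 v1 0 1 v2 0 0 1 ** E t \<in> H"
      unfolding E_def by (intro mult_mem exp_mem X)
    moreover have "mat3 1 0 v1 0 1 v2 0 0 1 ** E t = mat3 (E t $ 1 $ 1) (E t $ 1 $ 2) x (E t $ 2 $ 1) (E t $ 2 $ 2) y 0 0 (1 / D t)"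
      by (simp add: vec_eq_iff forall_3 matrix_matrix_mult_def sum_3 E3 v1_def v2_def D exp_minus field_simps)
    ultimately show ?thesis by simp
  qed
  show ?thesis
  proof (rule fills_chamberI_half[of 20])
    fix \<alpha> \<beta> :: real assume ab: "1 \<le> \<alpha>" "\<alpha> \<le> \<beta>" "\<beta> \<le> \<alpha>\<^sup>2"
    define \<rho> where "\<rho> = \<beta> / \<alpha>"
    have \<rho>: "\<rho> \<ge> 1" using ab by (simp add: \<rho>_def)
    \<comment> \<open>\<open>F\<close> starts at 2, the target value for \<rho> = 1, so the
      intermediate value theorem reaches 2 \<rho>^2; then one of the two block rows has squared
      length at least \<rho>^2.\<close>
    obtain T where T: "T \<ge> 0" "F T \<ge> 2 * \<rho>\<^sup>2" using unb[of "2 * \<rho>\<^sup>2"] by auto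
    have "F 0 \<le> 2 * \<rho>\<^sup>2" using \<rho> by (simp add: F0)
    then obtain t where t: "t \<ge> 0" "F t = 2 * \<rho>\<^sup>2"
      using IVT[of F 0 "2 * \<rho>\<^sup>2" T] T contF by auto
    let ?a = "E t $ 1 $ 1" and ?b = "E t $ 1 $ 2" and ?c = "E t $ 2 $ 1" and ?d = "E t $ 2 $ 2"
    obtain x y where xy: "(x = \<alpha> \<and> y = 0 \<and> ?c\<^sup>2 + ?d\<^sup>2 \<ge> \<rho>\<^sup>2) \<or> (x = 0 \<and> y = \<alpha> \<and> ?a\<^sup>2 + ?b\<^sup>2 \<ge> \<rho>\<^sup>2)"
    proof (cases "?c\<^sup>2 + ?d\<^sup>2 \<ge> \<rho>\<^sup>2")
      case False
      then have "?a\<^sup>2 + ?b\<^sup>2 \<ge> \<rho>\<^sup>2" using t(2) unfolding F_def by linarith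
      then show ?thesis using that by blast
    qed (use that in blast)
    have "\<tau> \<ge> 0" using cond by (auto simp: \<tau>_def)
    then have D1: "D t \<ge> 1" using t(1) by (simp add: D)
    have "?a * ?d - ?b * ?c = D t" by (simp add: D_def)
    moreover have "?a\<^sup>2 + ?b\<^sup>2 + ?c\<^sup>2 + ?d\<^sup>2 = 2 * (\<beta> / \<alpha>)\<^sup>2" using t(2) by (simp add: F_def \<rho>_def)
    ultimately show "realizes H 20 \<alpha> \<beta>"
      using parabolic_norm_bounds[of ?a ?b ?c ?d \<beta> \<alpha> "D t" x y] mat3_inverse_parabolic[of ?a ?d ?b ?c "D t" x y]
        D1 ab xy[unfolded \<rho>_def] mem[of t x y]
      by (intro bexI[OF _ mem[of t x y]] exI) auto
  qed simp
qed

end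

section \<open>Classification of the Lie algebras\<close>

lemma dim_le_3I:
  fixes V :: "'a::euclidean_space set"
  assumes "\<And>X. X \<in> V \<Longrightarrow> \<exists>a b c. X = a *\<^sub>R A + b *\<^sub>R B + c *\<^sub>R C"
  shows "dim V \<le> 3"
proof -
  have "V \<subseteq> span {A, B, C}"
  proof
    fix X assume "X \<in> V"
    then obtain a b c where "X = a *\<^sub>R A + b *\<^sub>R B + c *\<^sub>R C" using assms by blast
    then show "X \<in> span {A, B, C}" by (simp add: span_add span_scale span_base)
  qed
  then have "dim V \<le> card {A, B, C}" by (intro dim_le_card) auto
  also have "\<dots> \<le> 3" by (simp add: card_insert_if)
  finally show ?thesis .
qed

text \<open>Also used with one or both vectors zero, to get an element off a line or a nonzero
  element.\<close>

lemma ex_outside_plane: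
  fixes V :: "'a::euclidean_space set"
  assumes "dim V \<ge> 3"
  obtains X where "X \<in> V" "\<And>a b. X \<noteq> a *\<^sub>R A + b *\<^sub>R B"
proof -
  have "\<not> V \<subseteq> span {A, B}"
  proof
    assume "V \<subseteq> span {A, B}"
    then have "dim V \<le> card {A, B}" by (intro dim_le_card) auto
    also have "\<dots> \<le> 2" by (simp add: card_insert_if)
    finally show False using assms by simp
  qed
  then obtain X where X: "X \<in> V" "X \<notin> span {A, B}" by blast
  moreover have "a *\<^sub>R A + b *\<^sub>R B \<in> span {A, B}" for a b
    by (simp add: span_add span_scale span_base)
  ultimately show ?thesis using that by metis
qed

lemma linear_matrix_nth: "linear (\<lambda>X :: real ^ 'n ^ 'm. c * X $ i $ j)"
  by (intro linearI) (simp_all add: algebra_simps)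

section \<open>Algebras containing the unipotent radical of a maximal parabolic\<close>

locale lie_pair3 = lie_pair +
  assumes dim_h: "dim h \<ge> 3"
begin

lemma conj_pair3:
  assumes "Q ** P = mat 1"
  shows "lie_pair3 ((\<lambda>A. P ** A ** Q) ` H) ((\<lambda>A. P ** A ** Q) ` h)"
  by (intro lie_pair3.intro lie_pair_conj lie_pair3_axioms.intro)
    (use assms dim_h in \<open>auto simp: dim_conj_image intro: lie_pair_axioms\<close>)

lemma transpose_pair3: "lie_pair3 (transpose ` H) (transpose ` h)"
  by (intro lie_pair3.intro lie_pair_transpose lie_pair3_axioms.intro lie_pair_axioms)
    (use dim_h in \<open>simp add: dim_transpose_image\<close>)

text \<open>An element not normalizing the radical produces a normalizing one that contracts the
  third axis. Otherwise the whole algebra normalizes the radical; if no element fits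
  \<open>fills_chamber_parabolic\<close>, the blocks are all elliptic or zero and form a
  line.\<close>

lemma trichotomy_parabolic:
  assumes U: "E13 \<in> h" "E23 \<in> h"
  shows "trichotomy H h"
proof (cases "\<exists>X\<in>h. X $ 3 $ 1 \<noteq> 0 \<or> X $ 3 $ 2 \<noteq> 0")
  case True
  then obtain X where X: "X \<in> h" "X $ 3 $ 1 \<noteq> 0 \<or> X $ 3 $ 2 \<noteq> 0" by blast
  \<comment> \<open>Minus the offending row, used as a column: the bracket with \<open>X\<close> has
    lower right entry -(X31^2 + X32^2) < 0 and zeros to its left.\<close>
  define V where "V = mat3 0 0 (- X $ 3 $ 1) 0 0 (- X $ 3 $ 2) 0 0 0"
  have "V = (- X $ 3 $ 1) *\<^sub>R E13 + (- X $ 3 $ 2) *\<^sub>R E23"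
    by (simp add: V_def mat3_simps)
  then have "V \<in> h" by (simp only: add_mem scale_mem U)
  then have Y: "X ** V - V ** X \<in> h" by (intro bracket X)
  obtain x1 x2 x3 x4 x5 x6 x7 x8 x9 where Xm: "X = mat3 x1 x2 x3 x4 x5 x6 x7 x8 x9" by (rule mat3_cases)
  have pos: "x7 * x7 + x8 * x8 > 0"
    using X(2) unfolding Xm mat3_nth by (metis power2_eq_square sum_power2_gt_zero_iff)
  have "fills_chamber H"
    by (rule fills_chamber_parabolic[OF U Y]) (use pos in \<open>simp_all add: V_def Xm mat3_simps algebra_simps\<close>)
  then show ?thesis by (simp add: trichotomy_def)
next
  case False
  then have row3: "X $ 3 $ 1 = 0" "X $ 3 $ 2 = 0" if "X \<in> h" for X using that by auto
  have neg: "- X \<in> h" if "X \<in> h" for X using scale_mem[OF that, of "- 1"] by simp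
  show ?thesis
  proof (cases "\<exists>X\<in>h. X $ 3 $ 3 < 0 \<or>
      X $ 3 $ 3 = 0 \<and> X $ 1 $ 1 * X $ 2 $ 2 \<le> X $ 1 $ 2 * X $ 2 $ 1 \<and> (X $ 1 $ 1 \<noteq> 0 \<or> X $ 1 $ 2 \<noteq> 0 \<or> X $ 2 $ 1 \<noteq> 0)")
    case True
    then show ?thesis using fills_chamber_parabolic[OF U _ row3] unfolding trichotomy_def by blast
  next
    case False
    \<comment> \<open>Both X and -X violate the condition, so neither sign is possible.\<close>
    have X33: "X $ 3 $ 3 = 0" if "X \<in> h" for X
      using False that neg[OF that] by (smt (verit, best) vector_uminus_component)
    have form: "X = mat3 (X$1$1) (X$1$2) (X$1$3) (X$2$1) (- X$1$1) (X$2$3) 0 0 0" if "X \<in> h" for X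
    proof -
      have "X $ 1 $ 1 + X $ 2 $ 2 + X $ 3 $ 3 = 0" using trace_0[OF that] by (simp add: trace_def sum_3)
      then have "X $ 2 $ 2 = - X $ 1 $ 1" using X33[OF that] by simp
      then show ?thesis using mat3_eta[of X] row3[OF that] X33[OF that] by simp
    qed
    have ell: "(X$1$1)\<^sup>2 + X$1$2 * X$2$1 < 0" if "X \<in> h" "X $ 1 $ 1 \<noteq> 0 \<or> X $ 1 $ 2 \<noteq> 0 \<or> X $ 2 $ 1 \<noteq> 0" for X
    proof -
      have "X $ 2 $ 2 = - X $ 1 $ 1" using arg_cong[OF form[OF that(1)], of "\<lambda>A. A $ 2 $ 2"] by simp
      then show ?thesis using False that X33[OF that(1)] by (auto simp: power2_eq_square not_le)
    qed
    \<comment> \<open>An elliptic block has a nonzero (1,2) entry, so this entry is a coordinate for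
      the block; \<open>ratio\<close> makes it explicit.\<close>
    have zero: "X $ 1 $ 1 = 0 \<and> X $ 2 $ 1 = 0" if "X \<in> h" "X $ 1 $ 2 = 0" for X
      using ell[OF that(1)] that(2) zero_le_power2[of "X$1$1"] by fastforce
    obtain X0 where X0: "X0 \<in> h" "\<And>a b. X0 \<noteq> a *\<^sub>R E13 + b *\<^sub>R E23"
      by (rule ex_outside_plane[OF dim_h, of "E13" "E23"]) blast
    have q0: "X0 $ 1 $ 2 \<noteq> 0"
    proof
      assume "X0 $ 1 $ 2 = 0"
      with zero[OF X0(1)] form[OF X0(1)] have "X0 = mat3 0 0 (X0$1$3) 0 0 (X0$2$3) 0 0 0" by simp
      also have "\<dots> = (X0$1$3) *\<^sub>R E13 + (X0$2$3) *\<^sub>R E23"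
        by (simp add: mat3_simps)
      finally show False using X0(2) by blast
    qed
    define m where "m = - ((X0$1$1)\<^sup>2 + X0$1$2 * X0$2$1)"
    have m: "m > 0" using ell[OF X0(1)] q0 by (simp add: m_def)
    have ratio: "X$1$1 = X$1$2 / X0$1$2 * X0$1$1" "X$2$1 = X$1$2 / X0$1$2 * X0$2$1" if "X \<in> h" for X
      using zero[of "X - (X$1$2 / X0$1$2) *\<^sub>R X0"] q0 diff_mem[OF that scale_mem[OF X0(1)]] by auto
    have "index_one h"
      unfolding index_one_def
    proof (intro conjI ballI)
      show "dim h \<le> 3"
      proof (rule dim_le_3I, intro exI)
        fix X assume X: "X \<in> h"
        let ?c = "X$1$2 / X0$1$2"
        show "X = ?c *\<^sub>R X0 + (X$1$3 - ?c * X0$1$3) *\<^sub>R E13 + (X$2$3 - ?c * X0$2$3) *\<^sub>R E23"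
          using q0 ratio[OF X] by (subst form[OF X], subst (2) form[OF X0(1)]) (simp add: mat3_simps)
      qed
      show "det X = 0" if "X \<in> h" for X
        by (simp add: det_3 row3[OF that] X33[OF that])
      have tr: "trace (X ** X) = 2 * ((X$1$1)\<^sup>2 + X$1$2 * X$2$1)" if "X \<in> h" for X
        by (subst (1 2) form[OF that]) (simp add: mat3_simps power2_eq_square)
      show "\<exists>X\<in>h. trace (X ** X) < 0"
        using tr[OF X0(1)] m X0(1) by (intro bexI[of _ X0]) (simp_all add: m_def)
      \<comment> \<open>On these algebras the trace form is degenerate, just minus one square; the
        two positive squares are taken to be zero.\<close>
      define k where "k = sqrt (2 * m) / X0$1$2"
      have "trace (X ** X) = (0 * X$1$1)\<^sup>2 + (0 * X$1$1)\<^sup>2 - (k * X$1$2)\<^sup>2" if "X \<in> h" for X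
      proof -
        have "(k * X$1$2)\<^sup>2 = 2 * m * (X$1$2 / X0$1$2)\<^sup>2"
          using m by (simp add: k_def power_mult_distrib power_divide)
        moreover have "(X$1$1)\<^sup>2 + X$1$2 * X$2$1 = - m * (X$1$2 / X0$1$2)\<^sup>2"
        proof -
          define c where "c = X$1$2 / X0$1$2"
          have "X$1$2 = c * X0$1$2" using q0 by (simp add: c_def)
          moreover have "X$1$1 = c * X0$1$1" "X$2$1 = c * X0$2$1"
            using ratio[OF that] by (simp_all only: c_def)
          ultimately have "(X$1$1)\<^sup>2 + X$1$2 * X$2$1 = - m * c\<^sup>2"
            by (simp add: m_def power2_eq_square algebra_simps)
          then show ?thesis by (simp only: c_def)
        qed
        ultimately show ?thesis using tr[OF that] by simp
      qed
      then show "\<exists>l f g :: real ^ 3 ^ 3 \<Rightarrow> real. linear l \<and> linear f \<and> linear g \<and>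
          (\<forall>X\<in>h. trace (X ** X) = (f X)\<^sup>2 + (g X)\<^sup>2 - (l X)\<^sup>2)"
        using linear_matrix_nth by blast
    qed
    then show ?thesis by (simp add: trichotomy_def)
  qed
qed

text \<open>Used with \<open>J\<close> a transposition matrix, to relabel the basis vectors.\<close>

lemma trichotomy_involution:
  assumes J: "J ** J = mat 1" and AB: "A \<in> h" "B \<in> h"
    and normal: "\<And>H' h'. lie_pair3 H' h' \<Longrightarrow> J ** A ** J \<in> h' \<Longrightarrow> J ** B ** J \<in> h' \<Longrightarrow> trichotomy H' h'"
  shows "trichotomy H h"
  by (rule trichotomy_conj[OF J normal[OF conj_pair3[OF J]]]) (use AB in blast)+

lemma trichotomy_parabolic_12_32:
  assumes "E12 \<in> h" "E32 \<in> h"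
  shows "trichotomy H h"
  by (rule trichotomy_involution[of "mat3 1 0 0 0 0 1 0 1 0", OF _ assms])
    (auto simp: mat3_simps mat3_1 intro: lie_pair3.trichotomy_parabolic)

lemma trichotomy_parabolic_21_31:
  assumes "E21 \<in> h" "E31 \<in> h"
  shows "trichotomy H h"
  by (rule trichotomy_involution[of "mat3 0 0 1 0 1 0 1 0 0", OF _ assms])
    (auto simp: mat3_simps mat3_1 intro: lie_pair3.trichotomy_parabolic)

lemma trichotomy_parabolic_dual:
  assumes "E12 \<in> h" "E13 \<in> h"
  shows "trichotomy H h"
proof (rule trichotomy_transpose, rule lie_pair3.trichotomy_parabolic_21_31[OF transpose_pair3])
  show "E21 \<in> transpose ` h" by (rule rev_image_eqI[OF assms(1)]) (simp add: mat3_simps)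
  show "E31 \<in> transpose ` h" by (rule rev_image_eqI[OF assms(2)]) (simp add: mat3_simps)
qed

lemma trichotomy_parabolic_21_23:
  assumes "E21 \<in> h" "E23 \<in> h"
  shows "trichotomy H h"
  by (rule trichotomy_involution[of "mat3 0 1 0 1 0 0 0 0 1", OF _ assms])
    (auto simp: mat3_simps mat3_1 intro: lie_pair3.trichotomy_parabolic_dual)

text \<open>If both entries are nonzero, \<open>E13\<close> is a multiple of the square of a regular
  nilpotent; if only one is, it spans with \<open>E13\<close> the radical of a maximal
  parabolic.\<close>

lemma trichotomy_E13:
  assumes E13: "E13 \<in> h" and N: "mat3 0 b 0 0 0 f 0 0 0 \<in> h" and bf: "b \<noteq> 0 \<or> f \<noteq> 0"
  shows "trichotomy H h"
proof -
  consider "b \<noteq> 0" "f \<noteq> 0" | "b = 0" "f \<noteq> 0" | "b \<noteq> 0" "f = 0" using bf by blast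
  then show ?thesis
  proof cases
    case 1
    then show ?thesis using fills_chamber_regular_nilpotent[OF N E13] by (simp add: trichotomy_def)
  next
    case 2
    have "E23 \<in> h" using scale_mem[OF N, of "1 / f"] 2 by (simp add: mat3_scaleR)
    then show ?thesis by (rule trichotomy_parabolic[OF E13])
  next
    case 3
    have "E12 \<in> h" using scale_mem[OF N, of "1 / b"] 3 by (simp add: mat3_scaleR)
    then show ?thesis using E13 by (rule trichotomy_parabolic_dual)
  qed
qed

end

lemma det_eq_0_imp_ex_kernel:
  fixes A :: "real ^ 'n ^ 'n"
  assumes "det A = 0"
  obtains v where "v \<noteq> 0" "A *v v = 0"
proof -
  have "\<not> (\<exists>B. B ** A = mat 1)"
    using assms invertible_det_nz[of A] by (auto simp: invertible_left_inverse)
  then show ?thesis using that matrix_left_invertible_ker[of A] by blast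
qed

lemma columns_mult_vector:
  fixes u v w :: "real ^ 3"
  shows "transpose (vector [u, v, w] :: real ^ 3 ^ 3) *v c = c $ 1 *\<^sub>R u + c $ 2 *\<^sub>R v + c $ 3 *\<^sub>R w"
  by (simp add: vec_eq_iff forall_3 matrix_vector_mult_def transpose_def sum_3 mult.commute)

lemma mat3_mult_vector:
  "mat3 a b c d e f g h i *v x = vector [a * x $ 1 + b * x $ 2 + c * x $ 3,
     d * x $ 1 + e * x $ 2 + f * x $ 3, g * x $ 1 + h * x $ 2 + i * x $ 3]"
  by (simp add: vec_eq_iff forall_3 matrix_vector_mult_def sum_3)

lemma conj_columns:
  fixes u v w :: "real ^ 3"
  assumes "X *v u = a *\<^sub>R u + d *\<^sub>R v + g *\<^sub>R w" "X *v v = b *\<^sub>R u + e *\<^sub>R v + h *\<^sub>R w"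
    "X *v w = c *\<^sub>R u + f *\<^sub>R v + i *\<^sub>R w"
  shows "X ** transpose (vector [u, v, w] :: real ^ 3 ^ 3) = transpose (vector [u, v, w]) ** mat3 a b c d e f g h i"
proof -
  have "(X ** transpose (vector [u, v, w] :: real ^ 3 ^ 3)) *v x = (transpose (vector [u, v, w]) ** mat3 a b c d e f g h i) *v x" for x
    unfolding matrix_vector_mul_assoc[symmetric] columns_mult_vector mat3_mult_vector
    by (simp add: matrix_vector_right_distrib matrix_vector_mult_scaleR assms algebra_simps)
  then show ?thesis by (simp add: matrix_eq)
qed

text \<open>Cayley-Hamilton: when trace and determinant vanish, the only coefficient left is
  -tr(X^2)/2. Its sign separates hyperbolic, elliptic and nilpotent elements.\<close>

lemma cube_singular_traceless:
  fixes X :: "real ^ 3 ^ 3"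
  assumes "trace X = 0" "det X = 0"
  shows "X ** X ** X = (trace (X ** X) / 2) *\<^sub>R X"
proof -
  obtain a b c d e f g k l where X: "X = mat3 a b c d e f g k l" by (rule mat3_cases)
  have l: "l = - a - e" using assms(1) by (simp add: X mat3_trace)
  have "2 *\<^sub>R (X ** X ** X) = trace (X ** X) *\<^sub>R X + (2 * det X) *\<^sub>R mat 1"
    unfolding X mat3_mult mat3_trace mat3_scaleR mat3_1 mat3_add mat3_eq_iff det_3 mat3_nth l
    by (intro conjI; simp add: algebra_simps)
  then have "2 *\<^sub>R (X ** X ** X) = trace (X ** X) *\<^sub>R X" by (simp add: assms(2))
  then have "(1 / 2) *\<^sub>R (2 *\<^sub>R (X ** X ** X)) = (1 / 2) *\<^sub>R (trace (X ** X) *\<^sub>R X)" by simp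
  then show ?thesis by simp
qed

lemma det_minus_scalar:
  fixes X :: "real ^ 3 ^ 3"
  assumes "trace X = 0" "det X = 0"
  shows "det (X - s *\<^sub>R mat 1) = s * (trace (X ** X) / 2 - s * s)"
proof -
  obtain a b c d e f g k l where X: "X = mat3 a b c d e f g k l" by (rule mat3_cases)
  have l: "l = - a - e" using assms(1) by (simp add: X mat3_trace)
  have "a * e * l + b * f * g + c * d * k - a * f * k - b * d * l - c * e * g = 0"
    using assms(2) by (simp add: X det_3)
  then show ?thesis
    unfolding X mat3_1 mat3_mult mat3_trace mat3_scaleR mat3_diff det_3 mat3_nth l by (simp add: field_simps)
qed

section \<open>Change of basis and algebras with a hyperbolic element\<close>

context lie_pair3
begin

text \<open>Writing X in the basis u, v, w conjugates the whole pair, so \<open>normal\<close> has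
  to be available for every pair containing the normal form.\<close>

lemma trichotomy_normal_form:
  fixes u v w :: "real ^ 3"
  assumes X: "X \<in> h" "X *v u = a *\<^sub>R u + d *\<^sub>R v + g *\<^sub>R w" "X *v v = b *\<^sub>R u + e *\<^sub>R v + k *\<^sub>R w"
      "X *v w = c *\<^sub>R u + f *\<^sub>R v + l *\<^sub>R w"
    and ind: "\<And>x y z. x *\<^sub>R u + y *\<^sub>R v + z *\<^sub>R w = 0 \<Longrightarrow> x = 0 \<and> y = 0 \<and> z = 0"
    and normal: "\<And>H' h'. lie_pair3 H' h' \<Longrightarrow> mat3 a b c d e f g k l \<in> h' \<Longrightarrow> trichotomy H' h'"
  shows "trichotomy H h"
proof -
  define B :: "real ^ 3 ^ 3" where "B = transpose (vector [u, v, w])"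
  have XB: "X ** B = B ** mat3 a b c d e f g k l"
    unfolding B_def by (rule conj_columns[OF X(2-4)])
  have "x = 0" if "B *v x = 0" for x
  proof -
    have "x $ 1 *\<^sub>R u + x $ 2 *\<^sub>R v + x $ 3 *\<^sub>R w = 0" using that by (simp only: B_def columns_mult_vector)
    then have "x $ 1 = 0 \<and> x $ 2 = 0 \<and> x $ 3 = 0" by (rule ind)
    then show ?thesis by (simp add: vec_eq_iff forall_3)
  qed
  then obtain R where R: "R ** B = mat 1" using matrix_left_invertible_ker[of B] by blast
  then have BR: "B ** R = mat 1" by (simp only: matrix_left_right_inverse)
  have "R ** X ** B = R ** (X ** B)" by (simp only: matrix_mul_assoc)
  also have "\<dots> = R ** B ** mat3 a b c d e f g k l" by (simp only: XB matrix_mul_assoc)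
  also have "\<dots> = mat3 a b c d e f g k l" by (simp add: R)
  finally have "R ** X ** B = mat3 a b c d e f g k l" .
  then have "mat3 a b c d e f g k l \<in> (\<lambda>A. R ** A ** B) ` h" using X(1) by (metis imageI)
  then have "trichotomy ((\<lambda>A. R ** A ** B) ` H) ((\<lambda>A. R ** A ** B) ` h)"
    by (rule normal[OF conj_pair3[OF BR]])
  then show ?thesis by (rule trichotomy_conj[OF BR])
qed

text \<open>The components of a matrix in the eigenspaces of \<open>ad (diag (1, 0, -1))\<close> are obtained by
  applying polynomials in this operator.\<close>

lemma graded_D:
  assumes D: "D13 \<in> h" and X: "mat3 a b c d e f g k l \<in> h"
  shows "mat3 a 0 0 0 e 0 0 0 l \<in> h" "mat3 0 b 0 0 0 f 0 0 0 \<in> h" "mat3 0 0 c 0 0 0 0 0 0 \<in> h"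
    "mat3 0 0 0 d 0 0 0 k 0 \<in> h" "mat3 0 0 0 0 0 0 g 0 0 \<in> h"
proof -
  let ?S1 = "mat3 0 b 0 d 0 f 0 k 0" and ?A1 = "mat3 0 b 0 (- d) 0 f 0 (- k) 0"
  let ?S2 = "mat3 0 0 c 0 0 0 g 0 0" and ?A2 = "mat3 0 0 c 0 0 0 (- g) 0 0"
  \<comment> \<open>The weights are 0, \<plusminus>1, \<plusminus>2. Fourth minus second iterate is
    12 times the part of weights \<plusminus>2, third minus first is 6 times its antisymmetrized
    version.\<close>
  have X1: "mat3 0 b (2 * c) (- d) 0 f (- 2 * g) (- k) 0 \<in> h" using bracket[OF D X] by (simp add: mat3_simps)
  have X2: "mat3 0 b (4 * c) d 0 f (4 * g) k 0 \<in> h" using bracket[OF D X1] by (simp add: mat3_simps)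
  have X3: "mat3 0 b (8 * c) (- d) 0 f (- 8 * g) (- k) 0 \<in> h" using bracket[OF D X2] by (simp add: mat3_simps)
  have X4: "mat3 0 b (16 * c) d 0 f (16 * g) k 0 \<in> h" using bracket[OF D X3] by (simp add: mat3_simps)
  have S2: "?S2 \<in> h" using scale_mem[OF diff_mem[OF X4 X2], of "1 / 12"] by (simp add: mat3_simps)
  have A2: "?A2 \<in> h" using scale_mem[OF diff_mem[OF X3 X1], of "1 / 6"] by (simp add: mat3_simps)
  have S1: "?S1 \<in> h" using diff_mem[OF X2 scale_mem[OF S2, of 4]] by (simp add: mat3_simps)
  have A1: "?A1 \<in> h" using diff_mem[OF X1 scale_mem[OF A2, of 2]] by (simp add: mat3_simps)
  show "mat3 a 0 0 0 e 0 0 0 l \<in> h" using diff_mem[OF diff_mem[OF X S1] S2] by (simp add: mat3_simps)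
  show "mat3 0 b 0 0 0 f 0 0 0 \<in> h" using scale_mem[OF add_mem[OF S1 A1], of "1 / 2"] by (simp add: mat3_simps)
  show "mat3 0 0 c 0 0 0 0 0 0 \<in> h" using scale_mem[OF add_mem[OF S2 A2], of "1 / 2"] by (simp add: mat3_simps)
  show "mat3 0 0 0 d 0 0 0 k 0 \<in> h" using scale_mem[OF diff_mem[OF S1 A1], of "1 / 2"] by (simp add: mat3_simps)
  show "mat3 0 0 0 0 0 0 g 0 0 \<in> h" using scale_mem[OF diff_mem[OF S2 A2], of "1 / 2"] by (simp add: mat3_simps)
qed

text \<open>The diagonal part of X is independent of \<open>D13\<close>, so the two span the split
  Cartan subalgebra.\<close>

lemma trichotomy_D_T:
  assumes D: "D13 \<in> h" and X: "X \<in> h" "X $ 2 $ 2 \<noteq> 0"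
  shows "trichotomy H h"
proof -
  obtain a b c d e f g k l where Xm: "X = mat3 a b c d e f g k l" by (rule mat3_cases)
  have tr: "a + e + l = 0" using trace_0[OF X(1)] by (simp add: Xm mat3_trace)
  have e: "e \<noteq> 0" using X(2) by (simp add: Xm)
  have "mat3 a 0 0 0 e 0 0 0 l \<in> h" using graded_D[OF D] X(1) unfolding Xm by blast
  from scale_mem[OF diff_mem[OF this scale_mem[OF D, of "(a - l) / 2"]], of "- 2 / e"]
  have "mat3 (- 2 / e * (a - (a - l) / 2)) 0 0 0 (- 2) 0 0 0 (- 2 / e * (l + (a - l) / 2)) \<in> h"
    using e by (simp add: mat3_simps)
  moreover have "- 2 / e * (a - (a - l) / 2) = 1" "- 2 / e * (l + (a - l) / 2) = 1"
    using tr e by (auto simp: field_simps)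
  ultimately have "fills_chamber H"
    using D by (intro fills_chamber_diagonal) (simp_all add: diag3_def)
  then show ?thesis by (simp add: trichotomy_def)
qed

text \<open>After exclusion of the Cartan subalgebra and of weights \<plusminus>1, only the sl(2) on
  the first and third coordinates remains, and the dimension forces all of it.\<close>

lemma trichotomy_D_E13:
  assumes D: "D13 \<in> h" and E13: "E13 \<in> h"
  shows "trichotomy H h"
proof (rule ccontr)
  assume not: "\<not> trichotomy H h"
  have form: "X = mat3 (X$1$1) 0 (X$1$3) 0 0 0 (X$3$1) 0 (- X$1$1)" if X: "X \<in> h" for X
  proof -
    obtain a b c d e f g k l where Xm: "X = mat3 a b c d e f g k l" by (rule mat3_cases)
    have e: "e = 0" using trichotomy_D_T[OF D X] not by (auto simp: Xm)
    have "b = 0 \<and> f = 0"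
      using trichotomy_E13[OF E13 graded_D(2)[OF D X[unfolded Xm]]] not by blast
    \<comment> \<open>Bracketing with \<open>E13\<close> moves weight -1 to weight 1, where the
      exclusion already holds.\<close>
    moreover have "mat3 0 k 0 0 0 (- d) 0 0 0 \<in> h"
      using bracket[OF E13 graded_D(4)[OF D X[unfolded Xm]]] by (simp add: mat3_simps)
    then have "k = 0 \<and> d = 0"
      using trichotomy_E13[OF E13] not by fastforce
    moreover have "l = - a" using trace_0[OF X] e by (simp add: Xm mat3_trace)
    ultimately show ?thesis by (simp add: Xm e)
  qed
  obtain X where X: "X \<in> h" "\<And>a b. X \<noteq> a *\<^sub>R D13 + b *\<^sub>R E13"
    by (rule ex_outside_plane[OF dim_h, of "D13" "E13"]) blast
  have "X $ 3 $ 1 \<noteq> 0"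
  proof
    assume "X $ 3 $ 1 = 0"
    then have "X = X$1$1 *\<^sub>R D13 + X$1$3 *\<^sub>R E13"
      by (subst form[OF X(1)]) (simp add: mat3_simps)
    with X(2) show False by blast
  qed
  moreover have "mat3 0 0 0 0 0 0 (X$3$1) 0 0 \<in> h"
    using X(1) by (subst (asm) form[OF X(1)]) (rule graded_D(5)[OF D])
  ultimately have E31: "E31 \<in> h"
    using scale_mem[of "mat3 0 0 0 0 0 0 (X$3$1) 0 0" "1 / X$3$1"] by (simp add: mat3_scaleR)
  have tr: "trace (X ** X) = 2 * (X$1$1 * X$1$1 + X$1$3 * X$3$1)" if "X \<in> h" for X
    by (subst (1 2) form[OF that]) (simp add: mat3_simps)
  have "index_one h"
    unfolding index_one_def
  proof (intro conjI ballI)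
    show "dim h \<le> 3"
    proof (rule dim_le_3I, intro exI)
      fix X assume "X \<in> h"
      then show "X = X$1$1 *\<^sub>R D13 + X$1$3 *\<^sub>R E13 + X$3$1 *\<^sub>R E31"
        by (subst form) (simp_all add: mat3_simps)
    qed
    show "det X = 0" if "X \<in> h" for X
      by (subst form[OF that]) (simp add: det_3)
    show "\<exists>X\<in>h. trace (X ** X) < 0"
      by (rule bexI[OF _ diff_mem[OF E13 E31]]) (simp add: mat3_simps)
    define l f :: "real ^ 3 ^ 3 \<Rightarrow> real" where "l X = (X$1$3 - X$3$1) / sqrt 2" and "f X = (X$1$3 + X$3$1) / sqrt 2" for X
    have "linear l" "linear f"
      by (auto intro!: linearI simp: l_def f_def add_divide_distrib diff_divide_distrib algebra_simps)
    moreover have "trace (X ** X) = (sqrt 2 * X$1$1)\<^sup>2 + (f X)\<^sup>2 - (l X)\<^sup>2" if "X \<in> h" for X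
      unfolding tr[OF that] l_def f_def power_mult_distrib power_divide
      by (simp add: power2_eq_square field_simps)
    ultimately show "\<exists>l f g :: real ^ 3 ^ 3 \<Rightarrow> real. linear l \<and> linear f \<and> linear g \<and>
        (\<forall>X\<in>h. trace (X ** X) = (f X)\<^sup>2 + (g X)\<^sup>2 - (l X)\<^sup>2)"
      using linear_matrix_nth by blast
  qed
  with not show False by (simp add: trichotomy_def)
qed

text \<open>With weights \<plusminus>2 excluded, brackets within weight 1 and within weight -1 must
  vanish, and mixed brackets must be multiples of \<open>D13\<close>. So each weight space is at
  most a line, and together they give a parabolic radical or a copy of so(2,1).\<close>

lemma trichotomy_D:
  assumes D: "D13 \<in> h"
  shows "trichotomy H h"
proof (rule ccontr)
  assume not: "\<not> trichotomy H h"
  have X31: "X $ 3 $ 1 = 0" if X: "X \<in> h" for X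
  proof (rule ccontr)
    assume nz: "X $ 3 $ 1 \<noteq> 0"
    interpret T: lie_pair3 "transpose ` H" "transpose ` h" by (rule transpose_pair3)
    have "mat3 0 0 0 0 0 0 (X$3$1) 0 0 \<in> h"
      using X by (subst (asm) mat3_eta[symmetric]) (rule graded_D(5)[OF D])
    from scale_mem[OF this, of "1 / X$3$1"] have E31: "E31 \<in> h"
      using nz by (simp add: mat3_scaleR)
    have "trichotomy (transpose ` H) (transpose ` h)"
      by (rule T.trichotomy_D_E13; rule rev_image_eqI[OF D] rev_image_eqI[OF E31]) (simp_all add: mat3_simps)
    with not show False using trichotomy_transpose by blast
  qed
  have X13: "X $ 1 $ 3 = 0" if X: "X \<in> h" for X
  proof (rule ccontr)
    assume nz: "X $ 1 $ 3 \<noteq> 0"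
    have "mat3 0 0 (X$1$3) 0 0 0 0 0 0 \<in> h"
      using X by (subst (asm) mat3_eta[symmetric]) (rule graded_D(3)[OF D])
    from scale_mem[OF this, of "1 / X$1$3"] show False
      using nz trichotomy_D_E13[OF D] not by (simp add: mat3_scaleR)
  qed
  have form: "X = mat3 (X$1$1) (X$1$2) 0 (X$2$1) 0 (X$2$3) 0 (X$3$2) (- X$1$1)" if X: "X \<in> h" for X
  proof -
    obtain a b c d e f g k l where Xm: "X = mat3 a b c d e f g k l" by (rule mat3_cases)
    have e: "e = 0" using trichotomy_D_T[OF D X] not by (auto simp: Xm)
    moreover have "l = - a" using trace_0[OF X] e by (simp add: Xm mat3_trace)
    ultimately show ?thesis using X13[OF X] X31[OF X] by (simp add: Xm)
  qed
  have up: "mat3 0 (X$1$2) 0 0 0 (X$2$3) 0 0 0 \<in> h" and lo: "mat3 0 0 0 (X$2$1) 0 0 0 (X$3$2) 0 \<in> h" if "X \<in> h" for X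
    using that by (subst (asm) form[OF that], blast intro: graded_D[OF D])+
  have up_up: "X$1$2 * Y$2$3 = Y$1$2 * X$2$3" if "X \<in> h" "Y \<in> h" for X Y
    using X13[OF bracket[OF up[OF that(1)] up[OF that(2)]]] by (simp add: mat3_simps)
  have lo_lo: "X$2$1 * Y$3$2 = Y$2$1 * X$3$2" if "X \<in> h" "Y \<in> h" for X Y
    using X31[OF bracket[OF lo[OF that(1)] lo[OF that(2)]]] by (simp add: mat3_simps algebra_simps)
  have up_lo: "X$1$2 * Y$2$1 = X$2$3 * Y$3$2" if "X \<in> h" "Y \<in> h" for X Y
    using form[OF bracket[OF up[OF that(1)] lo[OF that(2)]]] by (simp add: mat3_simps)
  \<comment> \<open>Without weight 1 the algebra would be spanned by \<open>D13\<close> and one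
    vector of weight -1, of dimension at most two.\<close>
  have ex_up: "\<exists>X\<in>h. X$1$2 \<noteq> 0 \<or> X$2$3 \<noteq> 0"
  proof (rule ccontr)
    assume "\<not> ?thesis"
    then have z: "X$1$2 = 0" "X$2$3 = 0" if "X \<in> h" for X using that by auto
    obtain X where X: "X \<in> h" "\<And>a b. X \<noteq> a *\<^sub>R D13 + b *\<^sub>R 0"
      by (rule ex_outside_plane[OF dim_h, of "D13" 0]) blast
    have nz: "X$2$1 \<noteq> 0 \<or> X$3$2 \<noteq> 0"
    proof (rule ccontr)
      assume "\<not> ?thesis"
      then have "X = X$1$1 *\<^sub>R D13 + 0 *\<^sub>R 0"
        using z[OF X(1)] by (subst form[OF X(1)]) (simp add: mat3_simps)
      with X(2) show False by blast
    qed
    obtain Y where Y: "Y \<in> h" "\<And>a b. Y \<noteq> a *\<^sub>R D13 + b *\<^sub>R mat3 0 0 0 (X$2$1) 0 0 0 (X$3$2) 0"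
      by (rule ex_outside_plane[OF dim_h, of "D13" "mat3 0 0 0 (X$2$1) 0 0 0 (X$3$2) 0"]) blast
    obtain r where "Y$2$1 = r * X$2$1" "Y$3$2 = r * X$3$2"
    proof (cases "X$2$1 = 0")
      case True
      then show ?thesis using nz lo_lo[OF X(1) Y(1)] by (intro that[of "Y$3$2 / X$3$2"]) auto
    next
      case False
      then show ?thesis using nz lo_lo[OF X(1) Y(1)] by (intro that[of "Y$2$1 / X$2$1"]) (auto simp: field_simps)
    qed
    then have "Y = Y$1$1 *\<^sub>R D13 + r *\<^sub>R mat3 0 0 0 (X$2$1) 0 0 0 (X$3$2) 0"
      using z[OF Y(1)] by (subst form[OF Y(1)]) (simp add: mat3_simps)
    with Y(2) show False by blast
  qed
  then obtain N where N: "N \<in> h" "N$1$2 \<noteq> 0 \<or> N$2$3 \<noteq> 0" by blast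
  have up_prop: "\<exists>r. Y$1$2 = r * N$1$2 \<and> Y$2$3 = r * N$2$3" if Y: "Y \<in> h" for Y
  proof (cases "N$1$2 = 0")
    case True
    then show ?thesis using N(2) up_up[OF N(1) Y] by (intro exI[of _ "Y$2$3 / N$2$3"]) auto
  next
    case False
    then show ?thesis using N(2) up_up[OF N(1) Y] by (intro exI[of _ "Y$1$2 / N$1$2"]) (auto simp: field_simps)
  qed
  obtain L where L: "L \<in> h" "\<And>a b. L \<noteq> a *\<^sub>R D13 + b *\<^sub>R mat3 0 (N$1$2) 0 0 0 (N$2$3) 0 0 0"
    by (rule ex_outside_plane[OF dim_h, of "D13" "mat3 0 (N$1$2) 0 0 0 (N$2$3) 0 0 0"]) blast
  have Lnz: "L$2$1 \<noteq> 0 \<or> L$3$2 \<noteq> 0"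
  proof (rule ccontr)
    assume "\<not> ?thesis"
    moreover obtain r where "L$1$2 = r * N$1$2" "L$2$3 = r * N$2$3" using up_prop[OF L(1)] by blast
    ultimately have "L = L$1$1 *\<^sub>R D13 + r *\<^sub>R mat3 0 (N$1$2) 0 0 0 (N$2$3) 0 0 0"
      by (subst form[OF L(1)]) (simp add: mat3_simps)
    with L(2) show False by blast
  qed
  define b f d k where "b = N$1$2" and "f = N$2$3" and "d = L$2$1" and "k = L$3$2"
  have bfdk: "b * d = f * k" using up_lo[OF N(1) L(1)] by (simp add: b_def f_def d_def k_def)
  have bf: "b \<noteq> 0 \<or> f \<noteq> 0" and dk: "d \<noteq> 0 \<or> k \<noteq> 0" using N(2) Lnz by (auto simp: b_def f_def d_def k_def)
  have U: "mat3 0 b 0 0 0 f 0 0 0 \<in> h" and V: "mat3 0 0 0 d 0 0 0 k 0 \<in> h"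
    using up[OF N(1)] lo[OF L(1)] by (simp_all add: b_def f_def d_def k_def)
  \<comment> \<open>The relation \<open>b * d = f * k\<close> then leaves multiples of
    \<open>E21\<close> and \<open>E23\<close>, a parabolic radical; \<open>f = 0\<close> is
    symmetric.\<close>
  have b0: "b \<noteq> 0"
  proof
    assume "b = 0"
    then have z: "b = 0" "f \<noteq> 0" "k = 0" "d \<noteq> 0" using bf dk bfdk by auto
    have "E21 \<in> h" using scale_mem[OF V, of "1 / d"] z by (simp add: mat3_scaleR)
    moreover have "E23 \<in> h" using scale_mem[OF U, of "1 / f"] z by (simp add: mat3_scaleR)
    ultimately show False using not trichotomy_parabolic_21_23 by blast
  qed
  have f0: "f \<noteq> 0"
  proof
    assume "f = 0"
    then have z: "f = 0" "b \<noteq> 0" "d = 0" "k \<noteq> 0" using bf dk bfdk by auto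
    have "E12 \<in> h" using scale_mem[OF U, of "1 / b"] z by (simp add: mat3_scaleR)
    moreover have "E32 \<in> h" using scale_mem[OF V, of "1 / k"] z by (simp add: mat3_scaleR)
    ultimately show False using not trichotomy_parabolic_12_32 by blast
  qed
  have d0: "d \<noteq> 0" and k0: "k \<noteq> 0" using bfdk b0 f0 dk by auto
  have coords: "X = mat3 (X$1$1) (X$1$2) 0 (X$2$1) 0 (X$1$2 / b * f) 0 (X$2$1 / d * k) (- X$1$1)" if X: "X \<in> h" for X
  proof -
    have "X$2$3 = X$1$2 / b * f" using up_up[OF N(1) X] b0 by (simp add: b_def f_def field_simps)
    moreover have "X$3$2 = X$2$1 / d * k" using lo_lo[OF L(1) X] d0 by (simp add: d_def k_def field_simps)
    ultimately show ?thesis using form[OF X] by simp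
  qed
  have coords_prod: "X$1$2 / b * f * (X$2$1 / d * k) = X$1$2 * X$2$1" for X :: "real ^ 3 ^ 3"
  proof -
    have "X$1$2 / b * f * (X$2$1 / d * k) = X$1$2 * X$2$1 * (f * k) / (b * d)" by simp
    also have "\<dots> = X$1$2 * X$2$1" using b0 d0 by (simp add: bfdk[symmetric])
    finally show ?thesis .
  qed
  have tr: "trace (X ** X) = 2 * (X$1$1 * X$1$1 + 2 * (X$1$2 * X$2$1))" if X: "X \<in> h" for X
  proof -
    have "trace (mat3 a p 0 q 0 u 0 v (- a) ** mat3 a p 0 q 0 u 0 v (- a)) = 2 * (a * a + (p * q + u * v))" for a p q u v
      by (simp add: mat3_simps)
    then have "trace (X ** X) = 2 * (X$1$1 * X$1$1 + (X$1$2 * X$2$1 + X$1$2 / b * f * (X$2$1 / d * k)))"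
      by (subst (1 2) coords[OF X]) (simp only:)
    then show ?thesis unfolding coords_prod by simp
  qed
  have "index_one h"
    unfolding index_one_def
  proof (intro conjI ballI)
    show "dim h \<le> 3"
    proof (rule dim_le_3I, intro exI)
      fix X assume "X \<in> h"
      then show "X = X$1$1 *\<^sub>R D13 + (X$1$2 / b) *\<^sub>R mat3 0 b 0 0 0 f 0 0 0 + (X$2$1 / d) *\<^sub>R mat3 0 0 0 d 0 0 0 k 0"
        using b0 d0 by (subst coords) (simp_all add: mat3_simps)
    qed
    show "det X = 0" if X: "X \<in> h" for X
    proof -
      have "X$1$1 * (X$1$2 * X$2$1 - X$1$2 / b * f * (X$2$1 / d * k)) = 0"
        unfolding coords_prod by simp
      moreover have "det (mat3 a p 0 q 0 u 0 v (- a)) = a * (p * q - u * v)" for a p q u v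
        by (simp add: det_3 algebra_simps)
      ultimately show ?thesis
        by (subst coords[OF X]) (simp only:)
    qed
    have "(1 / b) *\<^sub>R mat3 0 b 0 0 0 f 0 0 0 - (1 / d) *\<^sub>R mat3 0 0 0 d 0 0 0 k 0 \<in> h" (is "?Y \<in> h")
      by (intro diff_mem scale_mem U V)
    moreover have "trace (?Y ** ?Y) < 0"
      using tr[OF \<open>?Y \<in> h\<close>] b0 d0 by simp
    ultimately show "\<exists>X\<in>h. trace (X ** X) < 0" by blast
    define l g :: "real ^ 3 ^ 3 \<Rightarrow> real" where "l X = X$1$2 - X$2$1" and "g X = X$1$2 + X$2$1" for X
    have "linear l" "linear g"
      by (auto intro!: linearI simp: l_def g_def algebra_simps)
    moreover have "trace (X ** X) = (sqrt 2 * X$1$1)\<^sup>2 + (g X)\<^sup>2 - (l X)\<^sup>2" if "X \<in> h" for X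
      unfolding tr[OF that] l_def g_def power_mult_distrib
      by (simp add: power2_eq_square algebra_simps)
    ultimately show "\<exists>l f g :: real ^ 3 ^ 3 \<Rightarrow> real. linear l \<and> linear f \<and> linear g \<and>
        (\<forall>X\<in>h. trace (X ** X) = (f X)\<^sup>2 + (g X)\<^sup>2 - (l X)\<^sup>2)"
      using linear_matrix_nth by blast
  qed
  with not show False by (simp add: trichotomy_def)
qed

text \<open>The eigenvalues s, 0, -s are distinct, so there is an eigenbasis, and rescaling gives
  \<open>D13\<close>.\<close>

lemma trichotomy_hyperbolic:
  assumes X: "X \<in> h" "det X = 0" "trace (X ** X) > 0"
  shows "trichotomy H h"
proof -
  define s where "s = sqrt (trace (X ** X) / 2)"
  have s: "s > 0" "s * s = trace (X ** X) / 2" using X(3) by (simp_all add: s_def)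
  have ex: "\<exists>v. v \<noteq> 0 \<and> X *v v = r *\<^sub>R v" if "r * (s * s - r * r) = 0" for r
  proof -
    have "det (X - r *\<^sub>R mat 1) = 0"
      using det_minus_scalar[OF trace_0[OF X(1)] X(2), of r] that s(2) by simp
    then obtain v where "v \<noteq> 0" "(X - r *\<^sub>R mat 1) *v v = 0" by (rule det_eq_0_imp_ex_kernel)
    then show ?thesis
      by (auto simp: matrix_vector_mult_diff_rdistrib scaleR_matrix_vector_assoc[symmetric])
  qed
  obtain u v w where u: "u \<noteq> 0" "X *v u = s *\<^sub>R u" and v: "v \<noteq> 0" "X *v v = 0"
    and w: "w \<noteq> 0" "X *v w = (- s) *\<^sub>R w"
    using ex[of s] ex[of 0] ex[of "- s"] by auto
  show ?thesis
  proof (rule trichotomy_normal_form[of X u s 0 v 0 w 0 0 0 0 0 "- s"])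
    show "trichotomy H' h'" if "lie_pair3 H' h'" and m: "mat3 s 0 0 0 0 0 0 0 (- s) \<in> h'" for H' h'
    proof -
      interpret N: lie_pair3 H' h' by fact
      show ?thesis
        using N.scale_mem[OF m, of "1 / s"] s(1) by (intro N.trichotomy_D) (simp add: mat3_scaleR)
    qed
    fix x y z assume e: "x *\<^sub>R u + y *\<^sub>R v + z *\<^sub>R w = 0"
    have "X *v (x *\<^sub>R u + y *\<^sub>R v + z *\<^sub>R w) = s *\<^sub>R (x *\<^sub>R u - z *\<^sub>R w)"
      by (simp add: matrix_vector_right_distrib matrix_vector_mult_scaleR u v w algebra_simps)
    then have e1: "x *\<^sub>R u - z *\<^sub>R w = 0" using s(1) by (simp add: e)
    have "X *v (x *\<^sub>R u - z *\<^sub>R w) = s *\<^sub>R (x *\<^sub>R u + z *\<^sub>R w)"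
      by (simp add: matrix_vector_mult_diff_distrib matrix_vector_mult_scaleR u v w algebra_simps)
    then have e2: "x *\<^sub>R u + z *\<^sub>R w = 0" using s(1) by (simp add: e1)
    have "x *\<^sub>R u + x *\<^sub>R u = (x *\<^sub>R u + z *\<^sub>R w) + (x *\<^sub>R u - z *\<^sub>R w)" by simp
    then have "2 *\<^sub>R (x *\<^sub>R u) = 0" unfolding scaleR_2 e1 e2 by simp
    then have x: "x = 0" using u by simp
    then have "z = 0" using e2 w by simp
    with x e v show "x = 0 \<and> y = 0 \<and> z = 0" by simp
  qed (use X u v w in simp_all)
qed

end

section \<open>Nilpotent normal forms and the rotation generator\<close>

context lie_pair3
begin

text \<open>Since ad N is nilpotent, the last of its iterates on W lying off the line of N satisfies
  [N, Z] = c N. For c = 0 it lies in the span of N and \<open>E13\<close>; for c \<noteq> 0 it is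
  hyperbolic.\<close>

lemma trichotomy_regular_nilpotent:
  assumes N: "mat3 0 1 0 0 0 1 0 0 0 \<in> h" (is "?N \<in> h")
  shows "trichotomy H h"
proof -
  define ad where "ad Y = ?N ** Y - Y ** ?N" for Y
  obtain W where W: "W \<in> h" "\<And>a b. W \<noteq> a *\<^sub>R ?N + b *\<^sub>R 0"
    by (rule ex_outside_plane[OF dim_h, of ?N 0]) blast
  have mem: "(ad ^^ k) W \<in> h" for k
    by (induction k) (auto simp: ad_def intro: bracket N W)
  have nil: "(ad ^^ 5) W = 0 *\<^sub>R ?N"
  proof -
    obtain a b c d e f g k l where "W = mat3 a b c d e f g k l" by (rule mat3_cases)
    then show ?thesis by (simp add: eval_nat_numeral ad_def mat3_simps mat3_0)
  qed
  have "\<exists>k. (\<nexists>c. (ad ^^ k) W = c *\<^sub>R ?N) \<and> (\<exists>c. (ad ^^ Suc k) W = c *\<^sub>R ?N)"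
  proof (rule ccontr)
    assume "\<not> ?thesis"
    then have step: "(\<nexists>c. (ad ^^ k) W = c *\<^sub>R ?N) \<Longrightarrow> (\<nexists>c. (ad ^^ Suc k) W = c *\<^sub>R ?N)" for k by blast
    have "\<nexists>c. (ad ^^ k) W = c *\<^sub>R ?N" for k
    proof (induction k)
      case 0
      show ?case using W(2)[of _ 0] by simp
    next
      case (Suc k)
      then show ?case by (rule step)
    qed
    with nil show False by blast
  qed
  then obtain k c where "\<nexists>c. (ad ^^ k) W = c *\<^sub>R ?N" "ad ((ad ^^ k) W) = c *\<^sub>R ?N" by auto
  then obtain Z where Z: "Z \<in> h" "\<And>x. Z \<noteq> x *\<^sub>R ?N" "ad Z = c *\<^sub>R ?N"
    using mem[of k] by blast
  obtain z1 z2 z3 z4 z5 z6 z7 z8 z9 where Zm: "Z = mat3 z1 z2 z3 z4 z5 z6 z7 z8 z9" by (rule mat3_cases)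
  have eqs: "z4 = 0" "z7 = 0" "z8 = 0" "z5 - z1 = c" "z9 - z5 = c" "z6 = z2"
    using Z(3) by (simp_all add: ad_def Zm mat3_simps)
  have "z1 + z5 + z9 = 0" using trace_0[OF Z(1)] by (simp add: Zm mat3_trace)
  with eqs have Zm': "Z = mat3 (- c) z2 z3 0 0 z2 0 0 c" by (simp add: Zm mat3_eq_iff)
  show ?thesis
  proof (cases "c = 0")
    case True
    have "z3 \<noteq> 0" using Z(2)[of z2] by (auto simp: Zm' True mat3_simps)
    moreover have "mat3 0 0 z3 0 0 0 0 0 0 \<in> h"
      using diff_mem[OF Z(1) scale_mem[OF N, of z2]] by (simp add: Zm' True mat3_simps)
    ultimately have "E13 \<in> h"
      using scale_mem[of "mat3 0 0 z3 0 0 0 0 0 0" "1 / z3"] by (simp add: mat3_scaleR)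
    then show ?thesis
      using fills_chamber_regular_nilpotent[OF N] by (simp add: trichotomy_def)
  next
    case False
    show ?thesis
    proof (rule trichotomy_hyperbolic[OF Z(1)])
      show "det Z = 0" by (simp add: Zm' det_3)
      show "trace (Z ** Z) > 0" using False by (simp add: Zm' mat3_simps) (metis not_real_square_gt_zero)
    qed
  qed
qed

text \<open>Brackets with \<open>E13\<close> force every element to be upper triangular, since they
  are otherwise hyperbolic or of the kind treated in \<open>trichotomy_E13\<close>. A triangular
  element with middle entry zero, off the line of \<open>E13\<close>, has the same fate.\<close>

lemma trichotomy_rank_one:
  assumes E13: "E13 \<in> h"
  shows "trichotomy H h"
proof (rule ccontr)
  assume not: "\<not> trichotomy H h"
  have upper: "X$2$1 = 0 \<and> X$3$1 = 0 \<and> X$3$2 = 0" if X: "X \<in> h" for X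
  proof -
    obtain a b c d e f g k l where Xm: "X = mat3 a b c d e f g k l" by (rule mat3_cases)
    have Z: "mat3 g k (l - a) 0 0 (- d) 0 0 (- g) \<in> h"
      using bracket[OF E13 X] by (simp add: Xm mat3_simps)
    have g: "g = 0"
    proof (rule ccontr)
      assume "g \<noteq> 0"
      then have "g * g > 0" by (metis not_real_square_gt_zero)
      then have "trichotomy H h"
        by (intro trichotomy_hyperbolic[OF Z]) (simp_all add: det_3 mat3_simps)
      with not show False by blast
    qed
    have "mat3 0 k 0 0 0 (- d) 0 0 0 \<in> h"
      using diff_mem[OF Z scale_mem[OF E13, of "l - a"]] by (simp add: g mat3_simps)
    then have "k = 0 \<and> d = 0" using trichotomy_E13[OF E13] not by fastforce
    with g show ?thesis by (simp add: Xm)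
  qed
  have key: False if X: "X \<in> h" "X$2$2 = 0" "\<And>c. X \<noteq> c *\<^sub>R E13" for X
  proof -
    obtain a b c d e f g k l where Xm: "X = mat3 a b c d e f g k l" by (rule mat3_cases)
    have z: "d = 0" "g = 0" "k = 0" "e = 0" using upper[OF X(1)] X(2) by (simp_all add: Xm)
    have l: "l = - a" using trace_0[OF X(1)] z by (simp add: Xm mat3_trace)
    show False
    proof (cases "a = 0")
      case True
      have "mat3 0 b 0 0 0 f 0 0 0 \<in> h"
        using diff_mem[OF X(1) scale_mem[OF E13, of c]] by (simp add: Xm z l True mat3_simps)
      moreover have "b \<noteq> 0 \<or> f \<noteq> 0" using X(3)[of c] by (auto simp: Xm z l True mat3_simps)
      ultimately show False using trichotomy_E13[OF E13] not by blast
    next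
      case False
      then have "a * a > 0" by (metis not_real_square_gt_zero)
      then have "trichotomy H h"
        by (intro trichotomy_hyperbolic[OF X(1)]) (simp_all add: Xm z l det_3 mat3_simps)
      with not show False by blast
    qed
  qed
  obtain X where X: "X \<in> h" "\<And>a b. X \<noteq> a *\<^sub>R E13 + b *\<^sub>R 0"
    by (rule ex_outside_plane[OF dim_h, of "E13" 0]) blast
  have X22: "X$2$2 \<noteq> 0" using key[OF X(1)] X(2)[of _ 0] by auto
  \<comment> \<open>A third independent element is needed so that subtracting a multiple of X clears
    the middle entry without falling onto the line of \<open>E13\<close>.\<close>
  obtain Y where Y: "Y \<in> h" "\<And>a b. Y \<noteq> a *\<^sub>R E13 + b *\<^sub>R X"
    by (rule ex_outside_plane[OF dim_h, of "E13" X]) blast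
  show False
  proof (rule key)
    show "Y - (Y$2$2 / X$2$2) *\<^sub>R X \<in> h" by (intro diff_mem scale_mem X Y)
    show "(Y - (Y$2$2 / X$2$2) *\<^sub>R X) $ 2 $ 2 = 0" using X22 by simp
    show "Y - (Y$2$2 / X$2$2) *\<^sub>R X \<noteq> c *\<^sub>R E13" for c
      using Y(2)[of c "Y$2$2 / X$2$2"] by (simp add: diff_eq_eq)
  qed
qed

text \<open>The group preserves the Lie algebra of the definite form \<open>M\<close>, hence \<open>M\<close> up to a factor,
  which is one by the determinant condition.\<close>

lemma bounded_if_definite_form:
  assumes \<mu>: "\<mu> < 0" and J: "mat3 0 0 0 0 0 (- 1) 0 1 0 \<in> h" and E: "mat3 0 1 0 \<mu> 0 0 0 0 0 \<in> h"
    and inv: "\<And>X. X \<in> h \<Longrightarrow> transpose X ** diag3 (- \<mu>) 1 1 + diag3 (- \<mu>) 1 1 ** X = 0"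
  shows "bounded H"
proof -
  let ?M = "diag3 (- \<mu>) 1 1"
  have norm: "norm A \<le> 1 + 1 / sqrt (- \<mu>) + 1 / sqrt (- \<mu>) + sqrt (- \<mu>) + 1 + 1 + sqrt (- \<mu>) + 1 + 1" if A: "A \<in> H" for A
  proof -
    obtain B where AB: "A ** B = mat 1" using ex_inverse[OF A] by blast
    then have BA: "B ** A = mat 1" by (simp only: matrix_left_right_inverse)
    \<comment> \<open>The form pulled back along \<open>A\<close> is again invariant under the
      algebra, because Ad(A) preserves the algebra.\<close>
    define M' where "M' = transpose A ** ?M ** A"
    have M': "transpose X ** M' + M' ** X = 0" if X: "X \<in> h" for X
    proof -
      have e: "transpose (A ** X ** B) ** ?M + ?M ** (A ** X ** B) = 0" by (rule inv[OF Ad[OF X A AB]])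
      have "transpose A ** transpose (A ** X ** B) = transpose (A ** X ** (B ** A))"
        by (simp add: matrix_transpose_mul matrix_mul_assoc)
      then have t: "transpose A ** transpose (A ** X ** B) = transpose X ** transpose A"
        by (simp add: BA matrix_transpose_mul)
      have r: "A ** X ** B ** A = A ** X" by (simp add: matrix_mul_assoc[symmetric] BA)
      have "transpose A ** (transpose (A ** X ** B) ** ?M + ?M ** (A ** X ** B)) ** A =
          (transpose A ** transpose (A ** X ** B)) ** ?M ** A + transpose A ** ?M ** (A ** X ** B ** A)"
        by (simp add: matrix_mult_add_left matrix_mult_add_right matrix_mul_assoc)
      also have "\<dots> = transpose X ** M' + M' ** X"
        unfolding t r M'_def by (simp add: matrix_mul_assoc)
      finally show ?thesis by (simp add: e)
    qed
    obtain a1 a2 a3 a4 a5 a6 a7 a8 a9 where Am: "A = mat3 a1 a2 a3 a4 a5 a6 a7 a8 a9" by (rule mat3_cases)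
    obtain m1 m2 m3 m4 m5 m6 m7 m8 m9 where Mm: "M' = mat3 m1 m2 m3 m4 m5 m6 m7 m8 m9" by (rule mat3_cases)
    have "transpose M' = M'" by (simp add: M'_def matrix_transpose_mul matrix_mul_assoc diag3_def mat3_transpose)
    then have "transpose M' $ i $ j = M' $ i $ j" for i j by simp
    from this[of 1 2] this[of 1 3] this[of 2 3] have sym: "m4 = m2" "m7 = m3" "m8 = m6"
      by (simp_all only: Mm mat3_transpose mat3_nth)
    \<comment> \<open>Invariance under the rotation and the second generator leaves a symmetric form
      only one free parameter, the factor m5.\<close>
    have MJ: "m2 = 0" "m3 = 0" "m6 = 0" "m9 = m5"
      using M'[OF J] sym by (simp_all add: Mm mat3_simps mat3_0)
    have ME: "m1 = - \<mu> * m5" using M'[OF E] sym MJ by (simp add: Mm mat3_simps mat3_0)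
    have Meq: "M' = diag3 (- \<mu> * m5) m5 m5" by (simp add: Mm sym MJ ME diag3_def)
    have "det M' = - \<mu>" by (simp add: M'_def det_mul det_1[OF A] det_diag3)
    then have "m5 ^ 3 = 1" using \<mu> by (simp add: Meq det_diag3 power3_eq_cube mult.assoc)
    then have "(m5 - 1) * (m5 * m5 + m5 + 1) = 0" by (simp add: power3_eq_cube algebra_simps)
    moreover have "m5 * m5 + m5 + 1 > 0"
      using zero_le_square[of "2 * m5 + 1"] by (simp add: algebra_simps)
    ultimately have "m5 = 1" by auto
    then have "transpose A ** ?M ** A = diag3 (- \<mu>) 1 1" using Meq by (simp add: M'_def)
    \<comment> \<open>The diagonal of the identity bounds every column of \<open>A\<close> in the
      definite form.\<close>
    then have cols: "- \<mu> * a1\<^sup>2 + a4\<^sup>2 + a7\<^sup>2 = - \<mu>" "- \<mu> * a2\<^sup>2 + a5\<^sup>2 + a8\<^sup>2 = 1" "- \<mu> * a3\<^sup>2 + a6\<^sup>2 + a9\<^sup>2 = 1"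
      by (simp_all add: Am diag3_def mat3_simps power2_eq_square algebra_simps)
    define s where "s = sqrt (- \<mu>)"
    have s: "s > 0" "s * s = - \<mu>" using \<mu> by (simp_all add: s_def)
    have sq: "\<bar>x\<bar> \<le> y" if "x\<^sup>2 \<le> y\<^sup>2" "y \<ge> 0" for x y :: real
      using that by (metis abs_le_square_iff abs_of_nonneg)
    have nn: "- \<mu> * x\<^sup>2 \<ge> 0" for x by (rule mult_nonneg_nonneg) (use \<mu> in simp_all)
    have "a4\<^sup>2 \<le> s\<^sup>2" "a7\<^sup>2 \<le> s\<^sup>2"
      using cols(1) nn[of a1] zero_le_power2[of a4] zero_le_power2[of a7] s(2) unfolding power2_eq_square[of s] by linarith+
    then have r1: "\<bar>a4\<bar> \<le> s" "\<bar>a7\<bar> \<le> s" using s(1) by (auto intro!: sq)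
    have "a5\<^sup>2 \<le> 1\<^sup>2" "a8\<^sup>2 \<le> 1\<^sup>2" "a6\<^sup>2 \<le> 1\<^sup>2" "a9\<^sup>2 \<le> 1\<^sup>2"
      using cols nn[of a2] nn[of a3] zero_le_power2[of a5] zero_le_power2[of a8] zero_le_power2[of a6] zero_le_power2[of a9]
      unfolding one_power2 by linarith+
    then have r2: "\<bar>a5\<bar> \<le> 1" "\<bar>a8\<bar> \<le> 1" "\<bar>a6\<bar> \<le> 1" "\<bar>a9\<bar> \<le> 1" by (auto intro!: sq)
    have "- \<mu> * a1\<^sup>2 \<le> - \<mu>" using cols(1) zero_le_power2[of a4] zero_le_power2[of a7] by linarith
    then have "a1\<^sup>2 \<le> 1\<^sup>2" using \<mu> by simp
    then have r3: "\<bar>a1\<bar> \<le> 1" by (rule sq) simp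
    have "- \<mu> * a2\<^sup>2 \<le> 1" "- \<mu> * a3\<^sup>2 \<le> 1"
      using cols zero_le_power2[of a5] zero_le_power2[of a8] zero_le_power2[of a6] zero_le_power2[of a9] by linarith+
    then have "a2\<^sup>2 \<le> (1 / s)\<^sup>2" "a3\<^sup>2 \<le> (1 / s)\<^sup>2"
      using \<mu> s by (auto simp: power_divide power2_eq_square[of s] field_simps)
    then have r4: "\<bar>a2\<bar> \<le> 1 / s" "\<bar>a3\<bar> \<le> 1 / s" using s(1) by (auto intro!: sq)
    show "norm A \<le> 1 + 1 / sqrt (- \<mu>) + 1 / sqrt (- \<mu>) + sqrt (- \<mu>) + 1 + 1 + sqrt (- \<mu>) + 1 + 1"
      unfolding Am by (rule order_trans[OF norm_mat3_le]) (intro add_mono r3 r4[unfolded s_def] r1[unfolded s_def] r2)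
  qed
  then show ?thesis unfolding bounded_iff by blast
qed

text \<open>The square of ad J is -1 on the entries linking the first axis with the plane, -4 on the
  traceless symmetric part of the lower block and 0 on the rest; second and fourth iterates separate
  these parts.\<close>

lemma graded_J:
  assumes J: "mat3 0 0 0 0 0 (- 1) 0 1 0 \<in> h" and X: "mat3 a b c d e f g k l \<in> h"
  shows "mat3 0 b c d 0 0 g 0 0 \<in> h" "mat3 0 (- c) b (- g) 0 0 d 0 0 \<in> h"
    "mat3 0 0 0 0 ((e - l) / 2) ((f + k) / 2) 0 ((f + k) / 2) (- (e - l) / 2) \<in> h"
    "mat3 a 0 0 0 ((e + l) / 2) 0 0 0 ((e + l) / 2) \<in> h"
proof -
  have X1: "mat3 0 (- c) b (- g) (- k - f) (e - l) d (e - l) (f + k) \<in> h"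
    using bracket[OF J X] by (simp add: mat3_simps algebra_simps)
  have X2: "mat3 0 (- b) (- c) (- d) (- 2 * (e - l)) (- 2 * (f + k)) (- g) (- 2 * (f + k)) (2 * (e - l)) \<in> h"
    using bracket[OF J X1] by (simp add: mat3_simps algebra_simps)
  have X3: "mat3 0 c (- b) g (4 * (f + k)) (- 4 * (e - l)) (- d) (- 4 * (e - l)) (- 4 * (f + k)) \<in> h"
    using bracket[OF J X2] by (simp add: mat3_simps algebra_simps)
  have X4: "mat3 0 b c d (8 * (e - l)) (8 * (f + k)) g (8 * (f + k)) (- 8 * (e - l)) \<in> h"
    using bracket[OF J X3] by (simp add: mat3_simps algebra_simps)
  have W2: "mat3 0 0 0 0 (e - l) (f + k) 0 (f + k) (- (e - l)) \<in> h"
    using scale_mem[OF add_mem[OF X4 X2], of "1 / 6"] by (simp add: mat3_simps algebra_simps)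
  show W1: "mat3 0 b c d 0 0 g 0 0 \<in> h"
    using diff_mem[OF X4 scale_mem[OF W2, of 8]] by (simp add: mat3_simps algebra_simps)
  show "mat3 0 (- c) b (- g) 0 0 d 0 0 \<in> h"
    using bracket[OF J W1] by (simp add: mat3_simps)
  show W2': "mat3 0 0 0 0 ((e - l) / 2) ((f + k) / 2) 0 ((f + k) / 2) (- (e - l) / 2) \<in> h"
    using scale_mem[OF W2, of "1 / 2"] by (simp add: mat3_simps)
  show "mat3 a 0 0 0 ((e + l) / 2) 0 0 0 ((e + l) / 2) \<in> h"
    using diff_mem[OF diff_mem[OF diff_mem[OF X W1] W2'] scale_mem[OF J, of "(k - f) / 2"]]
    by (simp add: mat3_simps field_simps)
qed

text \<open>Hyperbolic elements and parabolic radicals already settle the matter. Excluding them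
  leaves J and one rotated pair with a parameter \<mu> < 0, which together preserve a definite
  form.\<close>

lemma trichotomy_J:
  assumes J: "mat3 0 0 0 0 0 (- 1) 0 1 0 \<in> h" (is "?J \<in> h")
  shows "trichotomy H h"
proof (rule ccontr)
  assume not: "\<not> trichotomy H h"
  have hyp: False if "X \<in> h" "det X = 0" "trace (X ** X) > 0" for X
    using trichotomy_hyperbolic[OF that] not by blast
  have sym0: "X$2$2 = X$3$3 \<and> X$2$3 = - X$3$2" if X: "X \<in> h" for X
  proof -
    obtain a b c d e f g k l where Xm: "X = mat3 a b c d e f g k l" by (rule mat3_cases)
    have "(e - l)\<^sup>2 + (f + k)\<^sup>2 \<le> 0"
    proof (rule ccontr)
      assume *: "\<not> ?thesis"
      show False
        by (rule hyp[OF graded_J(3)[OF J X[unfolded Xm]]])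
          (use * in \<open>simp_all add: det_3 mat3_simps power2_eq_square field_simps\<close>)
    qed
    then have "e - l = 0 \<and> f + k = 0" by (simp add: sum_power2_le_zero_iff)
    then show ?thesis by (simp add: Xm)
  qed
  \<comment> \<open>Rotation by J acts on (d, g) as multiplication by i; combining the column with
    its rotation yields both unit columns.\<close>
  have col: False if X: "mat3 0 0 0 d 0 0 g 0 0 \<in> h" "d \<noteq> 0 \<or> g \<noteq> 0" for d g
  proof -
    have Y: "mat3 0 0 0 (- g) 0 0 d 0 0 \<in> h" using bracket[OF J X(1)] by (simp add: mat3_simps)
    define r where "r = d\<^sup>2 + g\<^sup>2"
    have n: "r \<noteq> 0" using X(2) by (simp add: r_def sum_power2_eq_zero_iff)
    have "mat3 0 0 0 r 0 0 0 0 0 \<in> h"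
      using diff_mem[OF scale_mem[OF X(1), of d] scale_mem[OF Y, of g]] by (simp add: r_def mat3_simps power2_eq_square algebra_simps)
    from scale_mem[OF this, of "1 / r"] have "E21 \<in> h" using n by (simp add: mat3_scaleR)
    moreover have "mat3 0 0 0 0 0 0 r 0 0 \<in> h"
      using add_mem[OF scale_mem[OF X(1), of g] scale_mem[OF Y, of d]] by (simp add: r_def mat3_simps power2_eq_square algebra_simps)
    from scale_mem[OF this, of "1 / r"] have "E31 \<in> h" using n by (simp add: mat3_scaleR)
    ultimately show False using trichotomy_parabolic_21_31 not by blast
  qed
  \<comment> \<open>The same complex multiplication turns the first row into that of
    \<open>E12\<close>; the displayed quotients are what it does to the column.\<close>
  have first_row: "mat3 0 1 0 ((b * d + c * g) / (b\<^sup>2 + c\<^sup>2)) 0 0 ((b * g - c * d) / (b\<^sup>2 + c\<^sup>2)) 0 0 \<in> h"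
    if X: "mat3 0 b c d 0 0 g 0 0 \<in> h" "b \<noteq> 0 \<or> c \<noteq> 0" for b c d g
  proof -
    have Y: "mat3 0 (- c) b (- g) 0 0 d 0 0 \<in> h" using bracket[OF J X(1)] by (simp add: mat3_simps)
    have n: "b\<^sup>2 + c\<^sup>2 \<noteq> 0" using X(2) by (simp add: sum_power2_eq_zero_iff)
    have "mat3 0 (b\<^sup>2 + c\<^sup>2) 0 (b * d + c * g) 0 0 (b * g - c * d) 0 0 \<in> h"
      using diff_mem[OF scale_mem[OF X(1), of b] scale_mem[OF Y, of c]] by (simp add: mat3_simps power2_eq_square algebra_simps)
    from scale_mem[OF this, of "1 / (b\<^sup>2 + c\<^sup>2)"] show ?thesis using n by (auto simp: mat3_scaleR)
  qed
  have row: False if X: "mat3 0 b c 0 0 0 0 0 0 \<in> h" "b \<noteq> 0 \<or> c \<noteq> 0" for b c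
  proof -
    have E12: "E12 \<in> h" using first_row[OF X] by simp
    have "E13 \<in> h" using bracket[OF J E12] by (simp add: mat3_simps)
    with E12 show False using trichotomy_parabolic_dual not by blast
  qed
  \<comment> \<open>Otherwise diag(-2, 1, 1) is available, whose bracket scales the row by -3 and
    the column by 3. It splits them apart, both vanish, and the dimension drops to two.\<close>
  have X11: "X$1$1 = 0" if X: "X \<in> h" for X
  proof (rule ccontr)
    obtain a b c d e f g k l where Xm: "X = mat3 a b c d e f g k l" by (rule mat3_cases)
    assume "X$1$1 \<noteq> 0"
    then have a: "a \<noteq> 0" by (simp add: Xm)
    have "(e + l) / 2 = - a / 2" using trace_0[OF X] by (simp add: Xm mat3_trace)
    then have "mat3 a 0 0 0 (- a / 2) 0 0 0 (- a / 2) \<in> h" using graded_J(4)[OF J X[unfolded Xm]] by simp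
    from scale_mem[OF this, of "- 2 / a"] have T: "mat3 (- 2) 0 0 0 1 0 0 0 1 \<in> h" using a by (simp add: mat3_scaleR)
    obtain Y where Y: "Y \<in> h" "\<And>a b. Y \<noteq> a *\<^sub>R ?J + b *\<^sub>R mat3 (- 2) 0 0 0 1 0 0 0 1"
      by (rule ex_outside_plane[OF dim_h, of ?J "mat3 (- 2) 0 0 0 1 0 0 0 1"]) blast
    obtain a b c d e f g k l where Ym: "Y = mat3 a b c d e f g k l" by (rule mat3_cases)
    have W: "mat3 0 b c d 0 0 g 0 0 \<in> h" using graded_J(1)[OF J Y(1)[unfolded Ym]] .
    have W': "mat3 0 (- 3 * b) (- 3 * c) (3 * d) 0 0 (3 * g) 0 0 \<in> h" using bracket[OF T W] by (simp add: mat3_simps)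
    have "mat3 0 b c 0 0 0 0 0 0 \<in> h"
      using scale_mem[OF diff_mem[OF scale_mem[OF W, of 3] W'], of "1 / 6"] by (simp add: mat3_simps)
    then have bc: "b = 0 \<and> c = 0" using row by blast
    have "mat3 0 0 0 d 0 0 g 0 0 \<in> h" using W bc by simp
    then have dg: "d = 0 \<and> g = 0" using col by blast
    have "Y = k *\<^sub>R ?J + l *\<^sub>R mat3 (- 2) 0 0 0 1 0 0 0 1"
      using sym0[OF Y(1)] trace_0[OF Y(1)] bc dg by (simp add: Ym mat3_simps)
    with Y(2) show False by blast
  qed
  have form: "X = mat3 0 (X$1$2) (X$1$3) (X$2$1) 0 (- X$3$2) (X$3$1) (X$3$2) 0" if X: "X \<in> h" for X
  proof -
    obtain a b c d e f g k l where Xm: "X = mat3 a b c d e f g k l" by (rule mat3_cases)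
    show ?thesis using sym0[OF X] X11[OF X] trace_0[OF X] by (simp add: Xm mat3_simps)
  qed
  have W: "mat3 0 (X$1$2) (X$1$3) (X$2$1) 0 0 (X$3$1) 0 0 \<in> h" if "X \<in> h" for X
    using that by (subst (asm) form[OF that]) (rule graded_J(1)[OF J])
  \<comment> \<open>The bracket of this part with its rotation has (1,1) entry proportional to the
    difference of the two sides. The identity makes the (3,1) entry from \<open>first_row\<close>
    vanish.\<close>
  have par: "X$1$3 * X$2$1 = X$1$2 * X$3$1" if X: "X \<in> h" for X
    using X11[OF bracket[OF W[OF X] bracket[OF J W[OF X]]]] by (simp add: mat3_simps algebra_simps)
  obtain Y where Y: "Y \<in> h" "\<And>a b. Y \<noteq> a *\<^sub>R ?J + b *\<^sub>R 0"
    by (rule ex_outside_plane[OF dim_h, of ?J 0]) blast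
  have bc: "Y$1$2 \<noteq> 0 \<or> Y$1$3 \<noteq> 0"
  proof (rule ccontr)
    assume *: "\<not> ?thesis"
    then have "Y$2$1 = 0 \<and> Y$3$1 = 0" using W[OF Y(1)] col by auto
    with * have "Y = Y$3$2 *\<^sub>R ?J + 0 *\<^sub>R 0" by (subst form[OF Y(1)]) (simp add: mat3_simps)
    with Y(2) show False by blast
  qed
  define \<mu> where "\<mu> = (Y$1$2 * Y$2$1 + Y$1$3 * Y$3$1) / ((Y$1$2)\<^sup>2 + (Y$1$3)\<^sup>2)"
  have E: "mat3 0 1 0 \<mu> 0 0 0 0 0 \<in> h"
    using first_row[OF W[OF Y(1)] bc] par[OF Y(1)] by (simp add: \<mu>_def)
  have E': "mat3 0 0 1 0 0 0 \<mu> 0 0 \<in> h" using bracket[OF J E] by (simp add: mat3_simps)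
  have "\<mu> \<noteq> 0" using row[of 1 0] E by auto
  moreover have "\<not> \<mu> > 0" using hyp[OF E] by (auto simp: det_3 mat3_simps)
  ultimately have \<mu>: "\<mu> < 0" by simp
  have coords: "X$2$1 = \<mu> * X$1$2 \<and> X$3$1 = \<mu> * X$1$3" if X: "X \<in> h" for X
  proof -
    have "mat3 0 0 0 (X$2$1 - \<mu> * X$1$2) 0 0 (X$3$1 - \<mu> * X$1$3) 0 0 \<in> h"
      using diff_mem[OF diff_mem[OF W[OF X] scale_mem[OF E, of "X$1$2"]] scale_mem[OF E', of "X$1$3"]]
      by (simp add: mat3_simps mult.commute)
    then show ?thesis using col by fastforce
  qed
  have "bounded H"
  proof (rule bounded_if_definite_form[OF \<mu> J E])
    show "transpose X ** diag3 (- \<mu>) 1 1 + diag3 (- \<mu>) 1 1 ** X = 0" if X: "X \<in> h" for X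
      using coords[OF X] by (subst (1 2) form[OF X]) (simp add: diag3_def mat3_simps mat3_0)
  qed
  with not show False by (simp add: trichotomy_def)
qed

text \<open>Cayley-Hamilton gives X^3 = -s^2 X, so X acts on its image as s times a rotation; the
  kernel supplies the third basis vector.\<close>

lemma trichotomy_elliptic:
  assumes X: "X \<in> h" "det X = 0" "trace (X ** X) < 0"
  shows "trichotomy H h"
proof -
  define s where "s = sqrt (- trace (X ** X) / 2)"
  have s: "s > 0" "s * s = - trace (X ** X) / 2" using X(3) by (simp_all add: s_def)
  have cube: "X *v (X *v (X *v x)) = (- (s * s)) *\<^sub>R (X *v x)" for x
    using arg_cong[OF cube_singular_traceless[OF trace_0[OF X(1)] X(2)], of "\<lambda>A. A *v x"] s(2)
    by (simp add: matrix_vector_mul_assoc matrix_mul_assoc scaleR_matrix_vector_assoc[symmetric])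
  obtain u where u: "u \<noteq> 0" "X *v u = 0" by (rule det_eq_0_imp_ex_kernel[OF X(2)])
  have "X \<noteq> 0" using X(3) by (auto simp: trace_def)
  then obtain x where "X *v x \<noteq> 0" by (auto simp: matrix_eq)
  define v where "v = X *v x"
  define w where "w = (1 / s) *\<^sub>R (X *v v)"
  have v: "v \<noteq> 0" "X *v v = s *\<^sub>R w" and w: "X *v w = (- s) *\<^sub>R v"
    using \<open>X *v x \<noteq> 0\<close> s(1) cube[of x] by (simp_all add: v_def w_def matrix_vector_mult_scaleR)
  show ?thesis
  proof (rule trichotomy_normal_form[of X u 0 0 v 0 w 0 0 s 0 "- s" 0])
    show "trichotomy H' h'" if "lie_pair3 H' h'" and m: "mat3 0 0 0 0 0 (- s) 0 s 0 \<in> h'" for H' h'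
    proof -
      interpret N: lie_pair3 H' h' by fact
      show ?thesis
        using N.scale_mem[OF m, of "1 / s"] s(1) by (intro N.trichotomy_J) (simp add: mat3_scaleR)
    qed
    fix a b c assume e: "a *\<^sub>R u + b *\<^sub>R v + c *\<^sub>R w = 0"
    have "X *v (a *\<^sub>R u + b *\<^sub>R v + c *\<^sub>R w) = s *\<^sub>R (b *\<^sub>R w - c *\<^sub>R v)"
      by (simp add: matrix_vector_right_distrib matrix_vector_mult_scaleR u v w algebra_simps)
    then have e1: "b *\<^sub>R w = c *\<^sub>R v" using s(1) by (simp add: e)
    have "X *v (b *\<^sub>R w - c *\<^sub>R v) = (- s) *\<^sub>R (b *\<^sub>R v + c *\<^sub>R w)"
      by (simp add: matrix_vector_mult_diff_distrib matrix_vector_mult_scaleR v w algebra_simps)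
    then have e2: "b *\<^sub>R v + c *\<^sub>R w = 0" using s(1) by (simp add: e1)
    have "(b * b + c * c) *\<^sub>R v = b *\<^sub>R (b *\<^sub>R v) + c *\<^sub>R (c *\<^sub>R v)" by (simp add: scaleR_add_left)
    also have "\<dots> = b *\<^sub>R (b *\<^sub>R v + c *\<^sub>R w)" by (simp add: e1[symmetric] scaleR_add_right mult.commute)
    finally have "b * b + c * c = 0" using v(1) by (simp add: e2)
    then have "b = 0 \<and> c = 0" by (simp add: sum_squares_eq_zero_iff)
    with e u show "a = 0 \<and> b = 0 \<and> c = 0" by simp
  qed (use X u v w in simp_all)
qed

text \<open>Jordan form: either one chain of length three, or X^2 = 0 and X has rank one.\<close>

lemma trichotomy_nilpotent:
  assumes X: "X \<in> h" "X \<noteq> 0" and nil: "X ** X ** X = 0"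
  shows "trichotomy H h"
proof (cases "X ** X = 0")
  case False
  then obtain w where w: "X *v (X *v w) \<noteq> 0" by (auto simp: matrix_eq matrix_vector_mul_assoc)
  have z: "X *v (X *v (X *v w)) = 0" using nil by (simp add: matrix_vector_mul_assoc matrix_mul_assoc)
  show ?thesis
  proof (rule trichotomy_normal_form[of X "X *v (X *v w)" 0 0 "X *v w" 0 w 1 0 0 0 1 0])
    show "trichotomy H' h'" if "lie_pair3 H' h'" "mat3 0 1 0 0 0 1 0 0 0 \<in> h'" for H' h'
      using that by (rule lie_pair3.trichotomy_regular_nilpotent)
    fix a b c assume e: "a *\<^sub>R (X *v (X *v w)) + b *\<^sub>R (X *v w) + c *\<^sub>R w = 0"
    have "X *v (a *\<^sub>R (X *v (X *v w)) + b *\<^sub>R (X *v w) + c *\<^sub>R w) = b *\<^sub>R (X *v (X *v w)) + c *\<^sub>R (X *v w)"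
      by (simp add: matrix_vector_right_distrib matrix_vector_mult_scaleR z)
    then have e1: "b *\<^sub>R (X *v (X *v w)) + c *\<^sub>R (X *v w) = 0" by (simp add: e)
    have "X *v (b *\<^sub>R (X *v (X *v w)) + c *\<^sub>R (X *v w)) = c *\<^sub>R (X *v (X *v w))"
      by (simp add: matrix_vector_right_distrib matrix_vector_mult_scaleR z)
    then have "c = 0" using w by (simp add: e1)
    then show "a = 0 \<and> b = 0 \<and> c = 0" using e e1 w by simp
  qed (use X z in simp_all)
next
  case True
  then have z: "X *v (X *v x) = 0" for x by (simp add: matrix_vector_mul_assoc)
  obtain w where w: "X *v w \<noteq> 0" using X(2) by (auto simp: matrix_eq)
  have "\<not> (UNIV :: (real ^ 3) set) \<subseteq> span {w, X *v w}"
  proof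
    assume "(UNIV :: (real ^ 3) set) \<subseteq> span {w, X *v w}"
    then have "dim (UNIV :: (real ^ 3) set) \<le> card {w, X *v w}" by (intro dim_le_card) auto
    also have "\<dots> \<le> 2" by (simp add: card_insert_if)
    finally show False by simp
  qed
  then obtain x where x: "x \<notin> span {w, X *v w}" by blast
  have nspan: "x \<noteq> a *\<^sub>R w + b *\<^sub>R (X *v w)" for a b
    using x by (auto intro: span_add span_scale span_base)
  \<comment> \<open>If the images of x and w were independent, expanding \<open>X *v x\<close> in
    the basis w, \<open>X *v w\<close>, x and applying X would leave only the middle
    coefficient.\<close>
  have "\<exists>r. X *v x = r *\<^sub>R (X *v w)"
  proof (rule ccontr)
    assume *: "\<nexists>r. X *v x = r *\<^sub>R (X *v w)"
    have indep: "a = 0 \<and> b = 0" if "a *\<^sub>R (X *v x) + b *\<^sub>R (X *v w) = 0" for a b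
    proof -
      have "a = 0"
      proof (rule ccontr)
        assume "a \<noteq> 0"
        then have "X *v x = (- b / a) *\<^sub>R (X *v w)"
        proof -
          have "(1 / a) *\<^sub>R (a *\<^sub>R (X *v x) + b *\<^sub>R (X *v w)) = 0" using that by simp
          then have "X *v x + (b / a) *\<^sub>R (X *v w) = 0" using \<open>a \<noteq> 0\<close> by (simp add: scaleR_add_right)
          then show ?thesis by (simp add: eq_neg_iff_add_eq_0)
        qed
        with * show False by blast
      qed
      then show ?thesis using that w by simp
    qed
    define B :: "real ^ 3 ^ 3" where "B = transpose (vector [w, X *v w, x])"
    have "y = 0" if "B *v y = 0" for y
    proof -
      have e: "y $ 1 *\<^sub>R w + y $ 2 *\<^sub>R (X *v w) + y $ 3 *\<^sub>R x = 0" using that by (simp only: B_def columns_mult_vector)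
      then have "X *v (y $ 1 *\<^sub>R w + y $ 2 *\<^sub>R (X *v w) + y $ 3 *\<^sub>R x) = 0" by simp
      then have "y $ 3 *\<^sub>R (X *v x) + y $ 1 *\<^sub>R (X *v w) = 0"
        by (simp add: matrix_vector_right_distrib matrix_vector_mult_scaleR z add.commute)
      then have "y $ 3 = 0 \<and> y $ 1 = 0" by (rule indep)
      moreover from this have "y $ 2 = 0" using e w by simp
      ultimately show ?thesis by (simp add: vec_eq_iff forall_3)
    qed
    then obtain R where "R ** B = mat 1" using matrix_left_invertible_ker[of B] by blast
    then have "B ** R = mat 1" by (simp only: matrix_left_right_inverse)
    then have "(B ** R) *v (X *v x) = X *v x" by simp
    then have "B *v (R *v (X *v x)) = X *v x" by (simp only: matrix_vector_mul_assoc[symmetric])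
    then obtain y where y: "X *v x = y $ 1 *\<^sub>R w + y $ 2 *\<^sub>R (X *v w) + y $ (3::3) *\<^sub>R x"
      unfolding B_def columns_mult_vector by metis
    then have "X *v (y $ 1 *\<^sub>R w + y $ 2 *\<^sub>R (X *v w) + y $ 3 *\<^sub>R x) = 0" by (metis z)
    then have "y $ 3 *\<^sub>R (X *v x) + y $ 1 *\<^sub>R (X *v w) = 0"
      by (simp add: matrix_vector_right_distrib matrix_vector_mult_scaleR z add.commute)
    then have "y $ 3 = 0 \<and> y $ 1 = 0" by (rule indep)
    with y * show False by auto
  qed
  then obtain r where r: "X *v x = r *\<^sub>R (X *v w)" by blast
  define v where "v = x - r *\<^sub>R w"
  have v: "X *v v = 0" by (simp add: v_def matrix_vector_mult_diff_distrib matrix_vector_mult_scaleR r)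
  show ?thesis
  proof (rule trichotomy_normal_form[of X "X *v w" 0 0 v 0 w 0 0 0 1 0 0])
    show "trichotomy H' h'" if "lie_pair3 H' h'" "E13 \<in> h'" for H' h'
      using that by (rule lie_pair3.trichotomy_rank_one)
    fix a b c assume e: "a *\<^sub>R (X *v w) + b *\<^sub>R v + c *\<^sub>R w = 0"
    have "X *v (a *\<^sub>R (X *v w) + b *\<^sub>R v + c *\<^sub>R w) = c *\<^sub>R (X *v w)"
      by (simp add: matrix_vector_right_distrib matrix_vector_mult_scaleR z v)
    then have c: "c = 0" using w by (simp add: e)
    have "b = 0"
    proof (rule ccontr)
      assume b: "b \<noteq> 0"
      have "b *\<^sub>R x = (b * r) *\<^sub>R w + (- a) *\<^sub>R (X *v w)"
        using e c by (simp add: v_def algebra_simps)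
      then have "(1 / b) *\<^sub>R (b *\<^sub>R x) = (1 / b) *\<^sub>R ((b * r) *\<^sub>R w + (- a) *\<^sub>R (X *v w))" by simp
      then have "x = r *\<^sub>R w + (- a / b) *\<^sub>R (X *v w)" using b by (simp add: scaleR_add_right scaleR_diff_right)
      with nspan show False by blast
    qed
    with e c w show "a = 0 \<and> b = 0 \<and> c = 0" by simp
  qed (use X z v in simp_all)
qed

theorem trichotomy: "trichotomy H h"
proof -
  have "\<exists>X\<in>h. X \<noteq> 0 \<and> det X = 0"
  proof -
    obtain X where X: "X \<in> h" "\<And>a b. X \<noteq> a *\<^sub>R 0 + b *\<^sub>R 0"
      by (rule ex_outside_plane[OF dim_h, of 0 0]) blast
    obtain Y where Y: "Y \<in> h" "\<And>a b. Y \<noteq> a *\<^sub>R X + b *\<^sub>R 0"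
      by (rule ex_outside_plane[OF dim_h, of X 0]) blast
    \<comment> \<open>A half circle from X to -X; independence of X and Y keeps it away from
      0.\<close>
    define Z where "Z t = cos t *\<^sub>R X + sin t *\<^sub>R Y" for t :: real
    have "continuous_on {0..pi} (\<lambda>t. det (Z t))"
      unfolding Z_def by (intro continuous_on_compose2[OF continuous_on_det3[of UNIV]] continuous_intros) auto
    moreover have "det (Z 0) = det X" by (simp add: Z_def)
    moreover have "det (Z pi) = - det X" by (simp add: Z_def det_3)
    ultimately have "\<exists>t. 0 \<le> t \<and> t \<le> pi \<and> det (Z t) = 0"
      using IVT'[of "\<lambda>t. det (Z t)" 0 0 pi] IVT2'[of "\<lambda>t. det (Z t)" pi 0 0] by (cases "det X \<le> 0") auto
    then obtain t where t: "det (Z t) = 0" by blast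
    have "Z t \<noteq> 0"
    proof
      assume z: "Z t = 0"
      show False
      proof (cases "sin t = 0")
        case True
        then have "cos t \<noteq> 0" using sin_cos_squared_add[of t] by auto
        then show False using z True X(2)[of 0 0] by (simp add: Z_def)
      next
        case False
        have "Y = (1 / sin t) *\<^sub>R (Z t - cos t *\<^sub>R X)" using False by (simp add: Z_def)
        then have "Y = (- cos t / sin t) *\<^sub>R X + 0 *\<^sub>R 0" by (simp add: z)
        then show False using Y(2) by blast
      qed
    qed
    moreover have "Z t \<in> h" unfolding Z_def by (intro add_mem scale_mem X Y)
    ultimately show ?thesis using t by blast
  qed
  then obtain X where X: "X \<in> h" "X \<noteq> 0" "det X = 0" by blast
  consider "trace (X ** X) > 0" | "trace (X ** X) < 0" | "trace (X ** X) = 0" by linarith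
  then show ?thesis
  proof cases
    case 1
    then show ?thesis by (rule trichotomy_hyperbolic[OF X(1,3)])
  next
    case 2
    then show ?thesis by (rule trichotomy_elliptic[OF X(1,3)])
  next
    case 3
    then have "X ** X ** X = 0" using cube_singular_traceless[OF trace_0[OF X(1)] X(3)] by simp
    then show ?thesis by (rule trichotomy_nilpotent[OF X(1,2)])
  qed
qed

end

section \<open>Circles normalized by a finite subgroup\<close>

text \<open>Rodrigues' formula: the relation for the cube reduces the exponential series to 1, S and
  S^2 with trigonometric coefficients.\<close>

lemma matrix_exp_periodic:
  fixes S :: "real ^ 'n ^ 'n"
  assumes cube: "S ** S ** S = - (\<omega> * \<omega>) *\<^sub>R S" and \<omega>: "\<omega> > 0"
  shows "matrix_exp ((2 * pi / \<omega>) *\<^sub>R S) = mat 1"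
proof -
  define F where "F t = mat 1 + (sin (\<omega> * t) / \<omega>) *\<^sub>R S + ((1 - cos (\<omega> * t)) / (\<omega> * \<omega>)) *\<^sub>R (S ** S)" for t
  have "(F has_vector_derivative S ** F t) (at t)" for t
  proof -
    have "((\<lambda>t. sin (\<omega> * t) / \<omega>) has_real_derivative cos (\<omega> * t)) (at t)"
      "((\<lambda>t. (1 - cos (\<omega> * t)) / (\<omega> * \<omega>)) has_real_derivative sin (\<omega> * t) / \<omega>) (at t)"
      using \<omega> by (auto intro!: derivative_eq_intros simp: field_simps)
    from has_vector_derivative_add[OF has_vector_derivative_add[OF has_vector_derivative_const[of "mat 1"]
        has_vector_derivative_scaleR[OF this(1) has_vector_derivative_const[of S]]]
        has_vector_derivative_scaleR[OF this(2) has_vector_derivative_const[of "S ** S"]]]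
    have "(F has_vector_derivative cos (\<omega> * t) *\<^sub>R S + (sin (\<omega> * t) / \<omega>) *\<^sub>R (S ** S)) (at t)"
      unfolding F_def by simp
    moreover have "S ** F t = cos (\<omega> * t) *\<^sub>R S + (sin (\<omega> * t) / \<omega>) *\<^sub>R (S ** S)"
    proof -
      have "S ** F t = S + (sin (\<omega> * t) / \<omega>) *\<^sub>R (S ** S) + ((1 - cos (\<omega> * t)) / (\<omega> * \<omega>)) *\<^sub>R (S ** S ** S)"
        by (simp add: F_def matrix_mult_algebra matrix_mul_assoc)
      also have "((1 - cos (\<omega> * t)) / (\<omega> * \<omega>)) *\<^sub>R (S ** S ** S) = (cos (\<omega> * t) - 1) *\<^sub>R S"
        unfolding cube using \<omega> by (simp add: scaleR_diff_left)
      finally show ?thesis by (simp add: scaleR_diff_left)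
    qed
    ultimately show ?thesis by simp
  qed
  from matrix_exp_unique[OF this] have "F t = matrix_exp (t *\<^sub>R S)" for t
    by (simp add: F_def)
  from this[of "2 * pi / \<omega>"] show ?thesis using \<omega> by (simp add: F_def)
qed

lemma matrix_exp_int_multiple_period:
  fixes S :: "real ^ 'n ^ 'n"
  assumes "matrix_exp (p *\<^sub>R S) = mat 1"
  shows "matrix_exp ((t + of_int n * p) *\<^sub>R S) = matrix_exp (t *\<^sub>R S)"
proof -
  have nat: "matrix_exp ((of_nat m * p) *\<^sub>R S) = mat 1" for m
  proof -
    have "matrix_power (mat 1 :: real ^ 'n ^ 'n) m = mat 1" by (induction m) simp_all
    then show ?thesis using matrix_power_matrix_exp[where t = p and X = S and k = m] assms by simp
  qed
  have "matrix_exp ((of_int n * p) *\<^sub>R S) = mat 1"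
  proof (cases "n \<ge> 0")
    case True
    then show ?thesis using nat[of "nat n"] by simp
  next
    case False
    then have "matrix_exp ((- of_int n * p) *\<^sub>R S) = mat 1" using nat[of "nat (- n)"] by simp
    then show ?thesis using matrix_exp_minus[of "- of_int n * p" S] by simp
  qed
  then show ?thesis by (simp add: matrix_exp_add)
qed

text \<open>Average over the finite group, with signs chosen so that all summands lie in the same half of
  the double cone \<open>E\<close>.\<close>

lemma ex_normalized_direction:
  fixes K :: "(real ^ 3 ^ 3) set" and l :: "real ^ 3 ^ 3 \<Rightarrow> real"
  assumes fin: "finite K" and one: "mat 1 \<in> K" and mult: "\<And>A B. A \<in> K \<Longrightarrow> B \<in> K \<Longrightarrow> A ** B \<in> K"
    and inv: "\<And>A. A \<in> K \<Longrightarrow> iv A \<in> K \<and> A ** iv A = mat 1 \<and> iv A ** A = mat 1"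
    and Ad: "\<And>A X. A \<in> K \<Longrightarrow> X \<in> E \<Longrightarrow> A ** X ** iv A \<in> E"
    and l: "linear l" "\<And>X. X \<in> E \<Longrightarrow> l X \<noteq> 0"
    and E: "X0 \<in> E" "\<And>X c. X \<in> E \<Longrightarrow> c \<noteq> 0 \<Longrightarrow> c *\<^sub>R X \<in> E"
      "\<And>X Y. X \<in> E \<Longrightarrow> Y \<in> E \<Longrightarrow> l X > 0 \<Longrightarrow> l Y > 0 \<Longrightarrow> X + Y \<in> E"
  shows "\<exists>S\<in>E. \<forall>A\<in>K. A ** S ** iv A = S \<or> A ** S ** iv A = - S"
proof -
  define ad where "ad A X = A ** X ** iv A" for A X
  have adE: "A \<in> K \<Longrightarrow> X \<in> E \<Longrightarrow> ad A X \<in> E" for A X by (simp add: ad_def Ad)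
  have ad_lin: "linear (ad A)" for A unfolding ad_def by (rule linear_conj)
  have iv_mult: "iv (A ** B) = iv B ** iv A" if "A \<in> K" "B \<in> K" for A B
  proof -
    have "A ** B ** (iv B ** iv A) = A ** (B ** iv B) ** iv A" by (simp only: matrix_mul_assoc)
    then have "A ** B ** (iv B ** iv A) = mat 1" using inv that by simp
    then show ?thesis using inv[OF mult[OF that]] by (metis matrix_inverse_unique)
  qed
  have ad_ad: "ad A (ad B X) = ad (A ** B) X" if "A \<in> K" "B \<in> K" for A B X
    using that by (simp add: ad_def iv_mult matrix_mul_assoc)
  text \<open>Otherwise \<open>l \<circ> ad A\<close> would vanish at a positive combination of \<open>Y\<close> and \<open>Z\<close>.\<close>
  have same: "l (ad A Y) * l (ad A Z) > 0" if A: "A \<in> K" and YZ: "Y \<in> E" "Z \<in> E" "l Y > 0" "l Z > 0" for A Y Z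
  proof (rule ccontr)
    assume "\<not> ?thesis"
    then have neg: "l (ad A Y) * l (ad A Z) < 0"
      using l(2)[OF adE[OF A YZ(1)]] l(2)[OF adE[OF A YZ(2)]] by (simp add: not_less order_less_le)
    define c where "c = - l (ad A Y) / l (ad A Z)"
    have c: "c > 0" using neg by (auto simp: c_def mult_less_0_iff divide_pos_neg divide_neg_pos zero_less_divide_iff)
    have "c *\<^sub>R Z \<in> E" using c YZ by (intro E) auto
    moreover have "l (c *\<^sub>R Z) > 0" using c YZ by (simp add: linear_cmul[OF l(1)])
    ultimately have "Y + c *\<^sub>R Z \<in> E" using YZ by (intro E(3)) auto
    from l(2)[OF adE[OF A this]] have "l (ad A Y) + c * l (ad A Z) \<noteq> 0"
      by (simp add: linear_add[OF ad_lin] linear_cmul[OF ad_lin] linear_add[OF l(1)] linear_cmul[OF l(1)])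
    then show False
      using l(2)[OF adE[OF A YZ(2)]] by (simp add: c_def)
  qed
  \<comment> \<open>Chooses between Z and -Z the one in the half where l is positive.\<close>
  define pos where "pos X = sgn (l X) *\<^sub>R X" for X
  have posE: "pos X \<in> E" "l (pos X) > 0" if "X \<in> E" for X
    using l(2)[OF that] E(2)[OF that] by (auto simp: pos_def linear_cmul[OF l(1)] sgn_if)
  define S where "S = (\<Sum>A\<in>K. pos (ad A X0))"
  have sumE: "finite L \<Longrightarrow> L \<noteq> {} \<Longrightarrow> L \<subseteq> K \<Longrightarrow> (\<Sum>A\<in>L. pos (ad A X0)) \<in> E \<and> l (\<Sum>A\<in>L. pos (ad A X0)) > 0" for L
  proof (induction L rule: finite_ne_induct)
    case (singleton A)
    then show ?case using posE adE E(1) by simp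
  next
    case (insert A L)
    then have "pos (ad A X0) \<in> E" "l (pos (ad A X0)) > 0" using posE adE E(1) by auto
    with insert show ?case by (auto simp: linear_add[OF l(1)] intro!: E(3))
  qed
  have S: "S \<in> E" "l S > 0" using sumE[OF fin] one by (auto simp: S_def)
  have "ad A S = S \<or> ad A S = - S" if A: "A \<in> K" for A
  proof -
    define \<epsilon> where "\<epsilon> = sgn (l (ad A S))"
    have \<epsilon>: "\<epsilon> = 1 \<or> \<epsilon> = - 1" using l(2)[OF adE[OF A S(1)]] by (simp add: \<epsilon>_def sgn_if)
    \<comment> \<open>By \<open>same\<close>, ad A sends the entire positive half into one half, so
      the sign \<epsilon> does not depend on B. Hence ad A permutes the summands of \<open>S\<close>
      up to a common sign.\<close>
    have "ad A (pos (ad B X0)) = \<epsilon> *\<^sub>R pos (ad (A ** B) X0)" if B: "B \<in> K" for B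
    proof -
      define Y where "Y = pos (ad B X0)"
      have Y: "Y \<in> E" "l Y > 0" unfolding Y_def using posE adE B E(1) by auto
      have "sgn (l (ad A Y)) = \<epsilon>" using same[OF A Y(1) S(1) Y(2) S(2)]
        by (auto simp: \<epsilon>_def sgn_if zero_less_mult_iff)
      then have "pos (ad A Y) = \<epsilon> *\<^sub>R ad A Y" by (simp add: pos_def)
      moreover have "pos (ad A Y) = pos (ad A (ad B X0))"
      proof -
        have "ad A Y = sgn (l (ad B X0)) *\<^sub>R ad A (ad B X0)" by (simp add: Y_def pos_def linear_cmul[OF ad_lin])
        moreover have "sgn (l (ad B X0)) = 1 \<or> sgn (l (ad B X0)) = - 1"
          using l(2)[OF adE[OF B E(1)]] by (simp add: sgn_if)
        moreover have "pos (- Z) = pos Z" for Z by (simp add: pos_def linear_neg[OF l(1)] sgn_minus)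
        ultimately show ?thesis by auto
      qed
      ultimately have "pos (ad (A ** B) X0) = \<epsilon> *\<^sub>R ad A Y" by (simp add: ad_ad[OF A B])
      then show ?thesis using \<epsilon> by (auto simp: Y_def)
    qed
    then have "ad A S = (\<Sum>B\<in>K. \<epsilon> *\<^sub>R pos (ad (A ** B) X0))"
      unfolding S_def linear_sum[OF ad_lin] by (intro sum.cong) auto
    also have "\<dots> = \<epsilon> *\<^sub>R (\<Sum>B\<in>K. pos (ad (A ** B) X0))" by (simp add: scaleR_sum_right)
    also have "(\<Sum>B\<in>K. pos (ad (A ** B) X0)) = S"
      unfolding S_def
    proof (rule sum.reindex_bij_witness[of _ "\<lambda>B. iv A ** B" "\<lambda>B. A ** B"])
      show "iv A ** (A ** B) = B" "A ** (iv A ** B) = B" for B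
        using inv[OF A] by (simp_all add: matrix_mul_assoc)
    qed (use A inv mult in auto)
    finally show ?thesis using \<epsilon> by auto
  qed
  with S(1) show ?thesis unfolding ad_def by blast
qed

section \<open>Closed subgroups of the special linear group, and the conclusion\<close>

lemma subgroup_SL_D:
  assumes "subgroup H SL"
  shows "mat 1 \<in> H" "A \<in> H \<Longrightarrow> B \<in> H \<Longrightarrow> A ** B \<in> H" "A \<in> H \<Longrightarrow> \<exists>B\<in>H. A ** B = mat 1" "A \<in> H \<Longrightarrow> det A = 1"
proof -
  interpret subgroup H SL by fact
  show "mat 1 \<in> H" using one_closed by (simp add: SL_def)
  show "A \<in> H \<Longrightarrow> B \<in> H \<Longrightarrow> A ** B \<in> H" using m_closed by (simp add: SL_def)
  show "det A = 1" if "A \<in> H" using mem_carrier[OF that] by (simp add: SL_def)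
  show "\<exists>B\<in>H. A ** B = mat 1" if "A \<in> H"
    using group.r_inv[OF group_SL mem_carrier[OF that]] m_inv_closed[OF that] by (auto simp: SL_def)
qed

lemma closed_subgroup_SL_closed:
  fixes H :: "(real ^ 3 ^ 3) set"
  assumes "closed_subgroup H SL"
  shows "closed H"
proof -
  have "closed (carrier SL :: (real ^ 3 ^ 3) set)"
    using continuous_closed_preimage_constant[OF continuous_on_det3 closed_UNIV, of 1] by (simp add: SL_def)
  then show ?thesis
    using assms by (auto simp: closed_subgroup_def intro: closedin_closed_trans)
qed

text \<open>The determinant is constant along the one-parameter group, and its derivative at the
  identity is the trace.\<close>

lemma trace_lie_algebra_0:
  fixes H :: "(real ^ 3 ^ 3) set"
  assumes det: "\<And>A. A \<in> H \<Longrightarrow> det A = 1" and X: "X \<in> lie_algebra H"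
  shows "trace X = 0"
proof -
  define E where "E t = matrix_exp (t *\<^sub>R X)" for t
  have dE: "((\<lambda>t. E t $ i $ j) has_real_derivative X $ i $ j) (at 0)" for i j
    using matrix_exp_nth_deriv(1)[of X i j 0] by (simp add: E_def)
  have E0: "E 0 $ i $ j = mat 1 $ i $ j" for i j by (simp add: E_def)
  have "((\<lambda>t. det (E t)) has_real_derivative trace X) (at 0)"
    unfolding det_3 by (rule derivative_eq_intros dE refl)+ (simp add: E0 mat3_1 trace_def sum_3)
  moreover have "det (E t) = 1" for t using X det by (simp add: E_def lie_algebra_def)
  then have "((\<lambda>t. det (E t)) has_real_derivative 0) (at 0)" by simp
  ultimately show ?thesis by (rule DERIV_unique)
qed

lemma subgroup_of_subgroup_SL:
  assumes "subgroup H SL"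
  shows "subgroup L (SL\<lparr>carrier := H\<rparr>) \<longleftrightarrow> L \<subseteq> H \<and> subgroup L SL"
proof
  assume L: "subgroup L (SL\<lparr>carrier := H\<rparr>)"
  then show "L \<subseteq> H \<and> subgroup L SL"
    using group.incl_subgroup[OF group_SL assms L] subgroup.subset[OF L] by auto
next
  assume "L \<subseteq> H \<and> subgroup L SL"
  then show "subgroup L (SL\<lparr>carrier := H\<rparr>)"
    using group.subgroup_incl[OF group_SL _ assms] by blast
qed

lemma subgroup_SLI:
  fixes L :: "(real ^ 'n ^ 'n) set"
  assumes "\<And>A. A \<in> L \<Longrightarrow> det A = 1" "mat 1 \<in> L" "\<And>A B. A \<in> L \<Longrightarrow> B \<in> L \<Longrightarrow> A ** B \<in> L"
    "\<And>A. A \<in> L \<Longrightarrow> \<exists>B\<in>L. A ** B = mat 1"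
  shows "subgroup L SL"
proof (rule group.subgroupI[OF group_SL])
  show "L \<subseteq> carrier SL" using assms(1) by (auto simp: SL_def)
  show "L \<noteq> {}" using assms(2) by auto
  show "A \<otimes>\<^bsub>SL\<^esub> B \<in> L" if "A \<in> L" "B \<in> L" for A B using assms(3)[OF that] by (simp add: SL_def)
  show "inv\<^bsub>SL\<^esub> A \<in> L" if A: "A \<in> L" for A
  proof -
    have c: "A \<in> carrier SL" using assms(1)[OF A] by (simp add: SL_def)
    obtain B where B: "B \<in> L" "A ** B = mat 1" using assms(4)[OF A] by auto
    have "A ** (inv\<^bsub>SL\<^esub> A) = mat 1" using group.r_inv[OF group_SL c] by (simp add: SL_def)
    then have "inv\<^bsub>SL\<^esub> A = B" using B(2) by (rule matrix_inverse_unique)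
    with B(1) show ?thesis by simp
  qed
qed

theorem corollary1p11:
  fixes H K\<^sub>H :: "(real ^ 3 ^ 3) set"
  assumes "closed_subgroup H SL" and "connected H"
    and "maximal_compact_subgroup K\<^sub>H (SL\<lparr>carrier := H\<rparr>)"
    and "int (lie_dim H) - int (lie_dim K\<^sub>H) \<ge> 3"
  shows "Cartan_decomposition_subgroup H SL"
proof -
  let ?h = "lie_algebra H"
  have subH: "subgroup H SL" using assms(1) by (simp add: closed_subgroup_def)
  have clH: "closed H" using assms(1) by (rule closed_subgroup_SL_closed)
  interpret H: closed_matrix_group H
    using subgroup_SL_D[OF subH] clH by unfold_locales blast+
  have detH: "det A = 1" if "A \<in> H" for A using subgroup_SL_D(4)[OF subH that] .
  interpret L: lie_pair3 H ?h
  proof unfold_locales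
    show "dim ?h \<ge> 3" using assms(4) by (simp add: lie_dim_def)
    show "A ** B \<in> H" if "A \<in> H" "B \<in> H" for A B using that by (rule H.mult_mem)
    show "\<exists>B\<in>H. A ** B = mat 1" if "A \<in> H" for A using that by (rule H.ex_inverse)
    show "det A = 1" if "A \<in> H" for A using that by (rule detH)
    show "matrix_exp (t *\<^sub>R X) \<in> H" if "X \<in> ?h" for X t using that by (rule H.matrix_exp_mem)
    show "subspace ?h" by (rule H.lie_algebra_subspace)
    show "X ** Y - Y ** X \<in> ?h" if "X \<in> ?h" "Y \<in> ?h" for X Y using that by (rule H.lie_algebra_bracket)
    show "A ** X ** B \<in> ?h" if "X \<in> ?h" "A \<in> H" "A ** B = mat 1" for X A B using that by (rule H.lie_algebra_Ad)
    show "trace X = 0" if "X \<in> ?h" for X by (rule trace_lie_algebra_0[OF detH that])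
  qed
  have subK: "K\<^sub>H \<subseteq> H" "subgroup K\<^sub>H SL" and cK: "compact K\<^sub>H"
    and max: "\<And>L. L \<subseteq> H \<Longrightarrow> subgroup L SL \<Longrightarrow> compact L \<Longrightarrow> K\<^sub>H \<subseteq> L \<Longrightarrow> L = K\<^sub>H"
    using assms(3) unfolding maximal_compact_subgroup_def subgroup_of_subgroup_SL[OF subH] by blast+
  interpret K: closed_matrix_group K\<^sub>H
    using subgroup_SL_D[OF subK(2)] compact_imp_closed[OF cK] by unfold_locales blast+
  \<comment> \<open>A bounded closed H would be its own maximal compact subgroup, with dimension
    difference 0.\<close>
  have "\<not> bounded H"
  proof
    assume "bounded H"
    then have "compact H" using clH by (simp add: compact_eq_bounded_closed)
    then have "H = K\<^sub>H" using max[OF _ subH _ subK(1)] by simp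
    then show False using assms(4) by simp
  qed
  moreover have "\<not> index_one ?h"
  proof
    assume ix: "index_one ?h"
    then obtain l f g :: "real ^ 3 ^ 3 \<Rightarrow> real" where lin: "linear l" "linear f" "linear g" and
      tr: "\<And>X. X \<in> ?h \<Longrightarrow> trace (X ** X) = (f X)\<^sup>2 + (g X)\<^sup>2 - (l X)\<^sup>2"
      unfolding index_one_def by blast
    obtain X0 where X0: "X0 \<in> ?h" "trace (X0 ** X0) < 0" using ix unfolding index_one_def by blast
    have det0: "det X = 0" if "X \<in> ?h" for X using ix that unfolding index_one_def by blast
    have "dim ?h \<le> 3" using ix unfolding index_one_def by blast
    \<comment> \<open>Dimension at most 3 and difference at least 3 leave nothing for the compact
      subgroup.\<close>
    then have "dim (lie_algebra K\<^sub>H) = 0" using assms(4) unfolding lie_dim_def by linarith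
    then have K0: "lie_algebra K\<^sub>H \<subseteq> {0}" by simp
    then have fin: "finite K\<^sub>H" using K.lie_algebra_nontrivial[OF cK] by blast
    define iv where "iv A = (SOME B. B \<in> K\<^sub>H \<and> A ** B = mat 1)" for A
    have iv: "iv A \<in> K\<^sub>H \<and> A ** iv A = mat 1 \<and> iv A ** A = mat 1" if A: "A \<in> K\<^sub>H" for A
    proof -
      have "iv A \<in> K\<^sub>H \<and> A ** iv A = mat 1"
        unfolding iv_def by (rule someI_ex) (use K.ex_inverse[OF A] in blast)
      then show ?thesis by (simp add: matrix_left_right_inverse[of "iv A" A])
    qed
    define E where "E = {X \<in> ?h. trace (X ** X) < 0}"
    have "\<exists>S\<in>E. \<forall>A\<in>K\<^sub>H. A ** S ** iv A = S \<or> A ** S ** iv A = - S"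
    proof (rule ex_normalized_direction[OF fin K.one_mem K.mult_mem iv])
      show "A ** X ** iv A \<in> E" if "A \<in> K\<^sub>H" "X \<in> E" for A X
        using that iv[OF that(1)] subK(1) H.lie_algebra_Ad[of X A "iv A"]
        by (auto simp: E_def conj_mult trace_conj)
      show "linear l" by fact
      show "l X \<noteq> 0" if "X \<in> E" for X
        using that tr[of X] by (auto simp: E_def) (smt (verit) zero_le_power2)
      show "X0 \<in> E" using X0 by (simp add: E_def)
      show "c *\<^sub>R X \<in> E" if "X \<in> E" "c \<noteq> 0" for X c
        using that L.scale_mem[of X c]
        by (auto simp: E_def matrix_mult_scaleR_left matrix_mult_scaleR_right trace_def sum_distrib_left[symmetric]
            mult.assoc[symmetric] mult_pos_neg zero_less_mult_iff not_sum_squares_lt_zero mult_less_0_iff)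
      \<comment> \<open>Convexity of the half cone sqrt(f^2 + g^2) < l, by the triangle inequality
        in the plane.\<close>
      show "X + Y \<in> E" if XY: "X \<in> E" "Y \<in> E" "l X > 0" "l Y > 0" for X Y
      proof -
        have q: "sqrt ((f Z)\<^sup>2 + (g Z)\<^sup>2) < l Z" if "Z \<in> E" "l Z > 0" for Z
          using that tr[of Z] by (intro real_less_lsqrt) (auto simp: E_def)
        have "sqrt ((f X + f Y)\<^sup>2 + (g X + g Y)\<^sup>2) \<le> sqrt ((f X)\<^sup>2 + (g X)\<^sup>2) + sqrt ((f Y)\<^sup>2 + (g Y)\<^sup>2)"
          by (rule real_sqrt_sum_squares_triangle_ineq)
        also have "\<dots> < l X + l Y" using q[OF XY(1,3)] q[OF XY(2,4)] by simp
        finally have "(sqrt ((f X + f Y)\<^sup>2 + (g X + g Y)\<^sup>2))\<^sup>2 < (l X + l Y)\<^sup>2"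
          by (intro power_strict_mono) auto
        moreover have "X + Y \<in> ?h" using XY by (auto simp: E_def intro: L.add_mem)
        ultimately show ?thesis
          using tr[of "X + Y"] lin by (simp add: E_def linear_add)
      qed
    qed blast+
    then obtain S where S: "S \<in> E" "\<And>A. A \<in> K\<^sub>H \<Longrightarrow> A ** S ** iv A = S \<or> A ** S ** iv A = - S" by blast
    have Sh: "S \<in> ?h" and trS: "trace (S ** S) < 0" using S(1) by (auto simp: E_def)
    define \<omega> where "\<omega> = sqrt (- trace (S ** S) / 2)"
    have \<omega>: "\<omega> > 0" "\<omega> * \<omega> = - trace (S ** S) / 2" using trS by (simp_all add: \<omega>_def)
    have "S ** S ** S = - (\<omega> * \<omega>) *\<^sub>R S"
      using cube_singular_traceless[OF L.trace_0[OF Sh] det0[OF Sh]] \<omega>(2) by simp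
    from matrix_exp_periodic[OF this \<omega>(1)] obtain p where p: "p > 0" "matrix_exp (p *\<^sub>R S) = mat 1"
      using \<omega>(1) by (metis divide_pos_pos mult_pos_pos pi_gt_zero zero_less_numeral)
    define T where "T = range (\<lambda>t. matrix_exp (t *\<^sub>R S))"
    \<comment> \<open>By periodicity one period already covers the one-parameter group, which is
      therefore compact.\<close>
    have T_eq: "T = (\<lambda>t. matrix_exp (t *\<^sub>R S)) ` {0..p}"
    proof -
      have "matrix_exp (t *\<^sub>R S) \<in> (\<lambda>t. matrix_exp (t *\<^sub>R S)) ` {0..p}" for t
      proof -
        define n where "n = \<lfloor>t / p\<rfloor>"
        have "of_int n \<le> t / p" "t / p \<le> of_int n + 1" by (simp_all add: n_def)
        then have "t - of_int n * p \<in> {0..p}" using p(1) by (simp add: field_simps)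
        moreover have "matrix_exp (t *\<^sub>R S) = matrix_exp ((t - of_int n * p) *\<^sub>R S)"
          using matrix_exp_int_multiple_period[OF p(2), of "t - of_int n * p" n] by simp
        ultimately show ?thesis by blast
      qed
      then show ?thesis by (auto simp: T_def)
    qed
    then have cT: "compact T"
      using compact_continuous_image[OF continuous_on_matrix_exp compact_Icc] by simp
    \<comment> \<open>The product of the finite group with the circle it normalizes is a compact
      subgroup. Maximality puts the circle into the finite group, whose Lie algebra is zero,
      although \<open>S\<close> is not.\<close>
    define N where "N = (\<lambda>(A, B). A ** B) ` (K\<^sub>H \<times> T)"
    have normal: "\<exists>t'. matrix_exp (t *\<^sub>R S) ** A = A ** matrix_exp (t' *\<^sub>R S)" if A: "A \<in> K\<^sub>H" for A t
    proof -
      have A': "iv A \<in> K\<^sub>H" "iv A ** A = mat 1" "A ** iv A = mat 1" using iv[OF A] by auto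
      have "A ** matrix_exp (t' *\<^sub>R S) = matrix_exp (t' *\<^sub>R (A ** S ** iv A)) ** A" for t'
        unfolding matrix_exp_conj[OF A'(3)] using A'(2) by (simp add: matrix_mul_assoc[symmetric])
      from this[of t] this[of "- t"] show ?thesis using S(2)[OF A] by (metis minus_minus scaleR_minus_left scaleR_minus_right)
    qed
    have TH: "matrix_exp (t *\<^sub>R S) \<in> H" for t by (rule H.matrix_exp_mem[OF Sh])
    have "N = K\<^sub>H"
    proof (rule max)
      show "N \<subseteq> H" using subK(1) TH by (auto simp: N_def T_def intro!: H.mult_mem)
      show "compact N"
        unfolding N_def case_prod_beta
        by (intro compact_continuous_image compact_Times cK cT continuous_intros)
      show "K\<^sub>H \<subseteq> N"
      proof
        fix A assume "A \<in> K\<^sub>H"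
        moreover have "mat 1 \<in> T" unfolding T_def by (rule range_eqI[of _ _ 0]) simp
        ultimately show "A \<in> N" unfolding N_def by (intro image_eqI[of _ _ "(A, mat 1)"]) auto
      qed
      show "subgroup N SL"
      proof (rule subgroup_SLI)
        show "det A = 1" if "A \<in> N" for A using that \<open>N \<subseteq> H\<close> detH by blast
        show "mat 1 \<in> N" using \<open>K\<^sub>H \<subseteq> N\<close> K.one_mem by blast
        show "A ** B \<in> N" if N: "A \<in> N" "B \<in> N" for A B
        proof -
          obtain A' t B' r where AB: "A' \<in> K\<^sub>H" "B' \<in> K\<^sub>H" "A = A' ** matrix_exp (t *\<^sub>R S)" "B = B' ** matrix_exp (r *\<^sub>R S)"
            using N by (auto simp: N_def T_def)
          obtain t' where t': "matrix_exp (t *\<^sub>R S) ** B' = B' ** matrix_exp (t' *\<^sub>R S)" using normal[OF AB(2)] by blast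
          have "A ** B = A' ** (matrix_exp (t *\<^sub>R S) ** B') ** matrix_exp (r *\<^sub>R S)" by (simp only: AB matrix_mul_assoc)
          also have "\<dots> = (A' ** B') ** matrix_exp ((t' + r) *\<^sub>R S)" by (simp only: t' matrix_exp_add matrix_mul_assoc)
          finally show ?thesis using K.mult_mem[OF AB(1,2)] by (auto simp: N_def T_def)
        qed
        show "\<exists>B\<in>N. A ** B = mat 1" if N: "A \<in> N" for A
        proof -
          obtain A' t where A: "A' \<in> K\<^sub>H" "A = A' ** matrix_exp (t *\<^sub>R S)" using N by (auto simp: N_def T_def)
          obtain B' where B': "B' \<in> K\<^sub>H" "A' ** B' = mat 1" using K.ex_inverse[OF A(1)] by blast
          obtain t' where t': "matrix_exp (- t *\<^sub>R S) ** B' = B' ** matrix_exp (t' *\<^sub>R S)" using normal[OF B'(1)] by blast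
          have "A ** (B' ** matrix_exp (t' *\<^sub>R S)) = A' ** (matrix_exp (t *\<^sub>R S) ** matrix_exp (- t *\<^sub>R S)) ** B'"
            by (simp only: A t'[symmetric] matrix_mul_assoc)
          also have "\<dots> = mat 1" by (simp only: matrix_exp_minus matrix_mul_rid B')
          finally show ?thesis using B'(1) by (intro bexI) (auto simp: N_def T_def)
        qed
      qed
    qed
    moreover have "matrix_exp (t *\<^sub>R S) \<in> N" for t
      unfolding N_def T_def by (intro image_eqI[of _ _ "(mat 1, matrix_exp (t *\<^sub>R S))"]) (auto simp: K.one_mem)
    ultimately have "S \<in> lie_algebra K\<^sub>H" by (simp add: lie_algebra_def)
    then have "S = 0" using K0 by blast
    then show False using trS by (simp add: trace_def)
  qed
  ultimately have "fills_chamber H" using L.trichotomy unfolding trichotomy_def by blast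
  then show ?thesis by (rule fills_chamber_imp_Cartan_decomposition_subgroup[OF assms(1,2)])
qed

end
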